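(* Let $a=(a_i)_{i\in\mathbb Z}$ be an arbitrary sequence of complex numbers, let $n=1,2,\dots$, and let $\mu$ be an arbitrary Young diagram whose number $d=d(\mu)$ of diagonal squares satisfies $d\le n$. Then $$s_{\mu;a}(x_1,\dots,x_n;y_1,\dots,y_n)=\frac{\sum_{w\in\mathfrak S_n\times\mathfrak S_n}\varepsilon(w)\,w[f_{\mu;a}(x_1,\dots,x_n;y_1,\dots,y_n)]}{V(x_1,\dots,x_n)\,V(y_1,\dots,y_n)},$$ where $$f_{\mu;a}(x_1,\dots,x_n;y_1,\dots,y_n)=\prod_{i=1}^d(x_i\,|\,a)^{\mu_i-i}x_i^{(n-\mu_i)_+}(y_i\,|\,\widehat a)^{\mu'_i-i}y_i^{(n-\mu'_i)_+}\cdot\prod_{i=d+1}^nx_i^{n-i}y_i^{n-i}\cdot\prod_{\substack{i,j\le n\\(i,j)\in\mu}}(x_i+y_j).$$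
   Context: The base field is $\mathbb C$. $\Lambda=\mathbb C[\mathbf p_1,\mathbf p_2,\dots]$ is the algebra of symmetric functions (polynomial ring in the power sums). Its elements $h_k$ are defined by $H(u)=1+\sum_{k\ge1}h_ku^{-k}=\exp\big(\sum_{k\ge1}\mathbf p_ku^{-k}/k\big)\in\Lambda[[u^{-1}]]$. For $f\in\Lambda$, $f(x_1,\dots,x_n;y_1,\dots,y_n)$ denotes the result of substituting $\mathbf p_k\mapsto\sum_{i=1}^nx_i^k+(-1)^{k-1}\sum_{i=1}^ny_i^k$. The elements $h_{k;a}\in\Lambda$ are defined by $1+\sum_{k\ge1}\frac{h_{k;a}}{(u-a_1)\cdots(u-a_k)}=H(u)$ in $\Lambda[[u^{-1}]]$, with $h_{0;a}=1$, $h_{k;a}=0$ for $k<0$. For $r\in\mathbb Z$, $(\tau^ra)_i=a_{i+r}$. The multiparameter Schur function is $s_{\mu;a}=\det[h_{\mu_i-i+j;\,\tau^{1-j}a}]$ (order any number $\ge\ell(\mu)$). Notation: $\widehat a_i=-a_{-i+1}$; $(x\,|\,a)^m=(x-a_1)\cdots(x-a_m)$ for $m\ge1$ and $(x\,|\,a)^0=1$; $(k)_+=\max(k,0)$; $\mu'$ is the transposed diagram; $(i,j)\in\mu$ means the square in row $i$, column $j$ lies in $\mu$; $V(x_1,\dots,x_n)=\prod_{1\le i<k\le n}(x_i-x_k)$ and similarly for $y$. The group $\mathfrak S_n\times\mathfrak S_n$ acts on polynomials by permuting separately the $x$'s and the $y$'s, and $\varepsilon(w)=\operatorname{sgn}(w_1)\operatorname{sgn}(w_2)$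 for $w=(w_1,w_2)$. *)

theory Defs
  imports
    Complex_Main
    "HOL-Library.Poly_Mapping"
    "HOL-Computational_Algebra.Formal_Power_Series"
    "HOL-Computational_Algebra.Fraction_Field"
    "HOL-Combinatorics.Permutations"
    "Jordan_Normal_Form.Determinant"
begin

section \<open>Polynomials over the complex numbers\<close>

type_synonym 'v cpoly = "('v \<Rightarrow>\<^sub>0 nat) \<Rightarrow>\<^sub>0 complex"

definition Const :: "complex \<Rightarrow> 'v cpoly" where
  "Const c = Poly_Mapping.single 0 c"

definition Var :: "'v \<Rightarrow> 'v cpoly" where
  "Var v = Poly_Mapping.single (Poly_Mapping.single v 1) 1"

definition substitute :: "('v \<Rightarrow> 'w cpoly) \<Rightarrow> 'v cpoly \<Rightarrow> 'w cpoly" where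
  "substitute \<sigma> f = (\<Sum>m\<in>Poly_Mapping.keys f. Const (Poly_Mapping.lookup f m) *
     (\<Prod>v\<in>Poly_Mapping.keys m. \<sigma> v ^ Poly_Mapping.lookup m v))"


section \<open>The algebra of symmetric functions\<close>

text \<open>Variable number \<open>k - 1\<close> is the power sum of degree \<open>k\<close>, for \<open>k \<ge> 1\<close>, so that
  every element of the type is a polynomial in the power sums and conversely.\<close>

type_synonym symfun = "nat cpoly"

definition psum :: "nat \<Rightarrow> symfun" where
  "psum k = Var (k - 1)"

text \<open>Series in \<open>u\<^sup>-\<^sup>1\<close> are formal power series with \<open>fps_X\<close> in the role of \<open>u\<^sup>-\<^sup>1\<close>.
  The library's \<open>fps_exp\<close> needs a field of coefficients, hence the explicit exponential series.\<close>

definition H_series :: "symfun fps" where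
  "H_series = Abs_fps (\<lambda>k. Const (1 / fact k)) oo
     Abs_fps (\<lambda>k. if k = 0 then 0 else Const (1 / of_nat k) * psum k)"

text \<open>The expansion of \<open>1 / ((u - a\<^sub>1) \<dots> (u - a\<^sub>k))\<close>, that is, of
  \<open>u\<^sup>-\<^sup>k / ((1 - a\<^sub>1 u\<^sup>-\<^sup>1) \<dots> (1 - a\<^sub>k u\<^sup>-\<^sup>1))\<close>; the last argument of
  \<open>fps_right_inverse\<close> is the inverse of the constant term.\<close>

definition inv_falling :: "(int \<Rightarrow> complex) \<Rightarrow> nat \<Rightarrow> symfun fps" where
  "inv_falling a k = fps_X ^ k *
     fps_right_inverse (\<Prod>i=1..k. 1 - fps_const (Const (a (int i))) * fps_X) 1"

definition is_h_seq :: "(int \<Rightarrow> complex) \<Rightarrow> (nat \<Rightarrow> symfun) \<Rightarrow> bool" where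
  "is_h_seq a h \<longleftrightarrow> h 0 = 1 \<and>
     (\<lambda>k. fps_const (h (Suc k)) * inv_falling a (Suc k)) sums (H_series - 1)"

definition multi_h :: "(int \<Rightarrow> complex) \<Rightarrow> int \<Rightarrow> symfun" where
  "multi_h a k = (if k < 0 then 0 else (THE h. is_h_seq a h) (nat k))"

definition shift :: "int \<Rightarrow> (int \<Rightarrow> complex) \<Rightarrow> (int \<Rightarrow> complex)" where
  "shift r a = (\<lambda>i. a (i + r))"

lemma inv_falling_nth:
  "fps_nth (inv_falling a k) n = (if n < k then 0 else
     fps_nth (fps_right_inverse (\<Prod>i=1..k. 1 - fps_const (Const (a (int i))) * fps_X) 1) (n - k))"
  unfolding inv_falling_def by (simp add: fps_X_power_mult_nth)

lemma inv_falling_diag: "fps_nth (inv_falling a k) k = 1"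
  by (simp add: inv_falling_nth)

lemma inv_falling_inverse:
  "inv_falling a k * (\<Prod>i=1..k. 1 - fps_const (Const (a (int i))) * fps_X) = fps_X ^ k"
proof -
  let ?P = "\<Prod>i=1..k. 1 - fps_const (Const (a (int i))) * fps_X :: symfun fps"
  have "fps_nth (\<Prod>i\<in>A. 1 - fps_const (Const (a (int i))) * fps_X :: symfun fps) 0 = 1" for A
    by (induction A rule: infinite_finite_induct) auto
  then have "?P * fps_right_inverse ?P 1 = 1"
    by (intro fps_right_inverse) simp
  then have "fps_right_inverse ?P 1 * ?P = 1"
    by (simp only: mult.commute)
  then show ?thesis
    unfolding inv_falling_def by (simp only: mult.assoc mult_1_right)
qed

lemma H_series_nth_0: "fps_nth H_series 0 = 1"
  unfolding H_series_def by (simp add: fps_compose_nth Const_def)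

lemma is_h_seq_iff:
  "is_h_seq a h \<longleftrightarrow> (\<forall>n. (\<Sum>k\<le>n. h k * fps_nth (inv_falling a k) n) = fps_nth H_series n)"
proof -
  have part: "fps_nth (\<Sum>k<m. fps_const (h (Suc k)) * inv_falling a (Suc k)) n =
      (\<Sum>k<n. h (Suc k) * fps_nth (inv_falling a (Suc k)) n)" if "m \<ge> n" for m n
    unfolding fps_sum_nth fps_mult_left_const_nth
    by (rule sum.mono_neutral_right) (use that in \<open>auto simp: inv_falling_nth\<close>)
  have lim: "(\<lambda>k. fps_const (h (Suc k)) * inv_falling a (Suc k)) sums (H_series - 1) \<longleftrightarrow>
      (\<forall>n. (\<Sum>k<n. h (Suc k) * fps_nth (inv_falling a (Suc k)) n) = fps_nth (H_series - 1) n)"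
  proof -
    let ?S = "\<lambda>m n. fps_nth (\<Sum>k<m. fps_const (h (Suc k)) * inv_falling a (Suc k)) n"
    have "(\<exists>N. \<forall>m\<ge>N. ?S m n = c) \<longleftrightarrow>
        (\<Sum>k<n. h (Suc k) * fps_nth (inv_falling a (Suc k)) n) = c" (is "?L \<longleftrightarrow> ?R") for n c
    proof
      assume ?L
      then obtain N where "\<And>m. m \<ge> N \<Longrightarrow> ?S m n = c" by blast
      from this[of "max N n"] show ?R using part[of n "max N n"] by simp
    next
      assume ?R
      then show ?L using part[of n] by (intro exI[of _ n]) simp
    qed
    then show ?thesis
      unfolding sums_def tendsto_fps_iff eventually_sequentially by simp
  qed
  have split: "(\<Sum>k\<le>n. h k * fps_nth (inv_falling a k) n) =
      h 0 * fps_nth (inv_falling a 0) n + (\<Sum>k<n. h (Suc k) * fps_nth (inv_falling a (Suc k)) n)" for n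
    unfolding lessThan_Suc_atMost[symmetric] by (rule sum.lessThan_Suc_shift)
  have "inv_falling a 0 = 1" using inv_falling_inverse[of a 0] by simp
  then have zero: "fps_nth (inv_falling a 0) n = fps_nth (1 :: symfun fps) n" for n by simp
  have "h 0 = 1" if "\<forall>n. (\<Sum>k\<le>n. h k * fps_nth (inv_falling a k) n) = fps_nth H_series n"
    using that[rule_format, of 0] by (simp add: inv_falling_diag H_series_nth_0)
  then show ?thesis
    unfolding is_h_seq_def lim split zero
    by (auto simp del: One_nat_def simp: eq_diff_eq add.commute)
qed

text \<open>The sequence described by \<open>THE\<close> in \<open>multi_h\<close> exists and is unique.\<close>

fun h_rec :: "(nat \<Rightarrow> nat \<Rightarrow> 'a::comm_ring_1) \<Rightarrow> (nat \<Rightarrow> 'a) \<Rightarrow> nat \<Rightarrow> 'a" where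
  "h_rec c b n = b n - (\<Sum>k\<in>{..<n}. if k < n then h_rec c b k * c k n else 0)"

declare h_rec.simps [simp del]

lemma ex1_h_seq: "\<exists>!h. is_h_seq a h"
proof (rule ex1I)
  define h where "h = h_rec (\<lambda>k n. fps_nth (inv_falling a k) n) (fps_nth H_series)"
  have rec: "h n = fps_nth H_series n - (\<Sum>k<n. h k * fps_nth (inv_falling a k) n)" for n
    unfolding h_def by (subst h_rec.simps) simp
  have "(\<Sum>k\<le>n. h k * fps_nth (inv_falling a k) n) = fps_nth H_series n" for n
    unfolding lessThan_Suc_atMost[symmetric] sum.lessThan_Suc inv_falling_diag mult_1_right
    using eq_diff_eq[THEN iffD1, OF rec[of n]] by (metis add.commute)
  then show h: "is_h_seq a h" by (simp add: is_h_seq_iff)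
  fix g assume g: "is_h_seq a g"
  have "g n = h n" for n
  proof (induction n rule: less_induct)
    case (less n)
    have "(\<Sum>k\<le>n. g k * fps_nth (inv_falling a k) n) = (\<Sum>k\<le>n. h k * fps_nth (inv_falling a k) n)"
      using g h by (simp add: is_h_seq_iff)
    then have "(\<Sum>k<n. g k * fps_nth (inv_falling a k) n) + g n =
        (\<Sum>k<n. h k * fps_nth (inv_falling a k) n) + h n"
      unfolding lessThan_Suc_atMost[symmetric] sum.lessThan_Suc inv_falling_diag mult_1_right .
    moreover have "(\<Sum>k<n. g k * fps_nth (inv_falling a k) n) =
        (\<Sum>k<n. h k * fps_nth (inv_falling a k) n)"
      by (rule sum.cong) (simp_all add: less)
    ultimately show ?case by (simp only: add_left_cancel)
  qed
  then show "g = h" by auto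
qed


section \<open>Young diagrams\<close>

text \<open>A Young diagram is given by the list of its nonzero row lengths; rows, columns and
  the parts \<open>\<mu>\<^sub>i\<close> are numbered from 1.\<close>

definition is_partition :: "nat list \<Rightarrow> bool" where
  "is_partition \<mu> \<longleftrightarrow> sorted_wrt (\<ge>) \<mu> \<and> 0 \<notin> set \<mu>"

definition part :: "nat list \<Rightarrow> nat \<Rightarrow> nat" where
  "part \<mu> i = (if 1 \<le> i \<and> i \<le> length \<mu> then \<mu> ! (i - 1) else 0)"

definition diagram :: "nat list \<Rightarrow> (nat \<times> nat) set" where
  "diagram \<mu> = {(i, j). 1 \<le> i \<and> 1 \<le> j \<and> j \<le> part \<mu> i}"

definition part_transp :: "nat list \<Rightarrow> nat \<Rightarrow> nat" where
  "part_transp \<mu> j = card {i. (i, j) \<in> diagram \<mu>}"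

definition diag_length :: "nat list \<Rightarrow> nat" where
  "diag_length \<mu> = card {i. (i, i) \<in> diagram \<mu>}"


section \<open>Multiparameter Schur functions\<close>

text \<open>The determinant of order \<open>N\<close>, meaningful for every \<open>N \<ge> length \<mu>\<close>. Matrix entries are numbered from 0, so the row and column
  numbers in the mathematical formula are \<open>i + 1\<close> and \<open>j + 1\<close>.\<close>

definition multi_schur :: "nat \<Rightarrow> nat list \<Rightarrow> (int \<Rightarrow> complex) \<Rightarrow> symfun" where
  "multi_schur N \<mu> a = det (mat N N (\<lambda>(i, j).
     multi_h (shift (1 - int (j + 1)) a) (int (part \<mu> (i + 1)) - int (i + 1) + int (j + 1))))"


section \<open>Polynomials in two sets of variables\<close>

datatype xy = Xvar nat | Yvar nat

text \<open>The order on variables only serves to make the polynomials an integral domain: the library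
  instance asks for a linear order on exponents. Only \<open>Xvar i\<close> and \<open>Yvar i\<close> with
  \<open>1 \<le> i \<le> n\<close> occur in the polynomials for a given \<open>n\<close>.\<close>

instantiation xy :: linorder
begin

fun var_idx :: "xy \<Rightarrow> nat" where
  "var_idx (Xvar i) = 2 * i"
| "var_idx (Yvar i) = 2 * i + 1"

definition less_eq_xy :: "xy \<Rightarrow> xy \<Rightarrow> bool" where
  "less_eq_xy v w \<longleftrightarrow> var_idx v \<le> var_idx w"

definition less_xy :: "xy \<Rightarrow> xy \<Rightarrow> bool" where
  "less_xy v w \<longleftrightarrow> var_idx v < var_idx w"

instance
proof
  fix v w :: xy
  assume "v \<le> w" "w \<le> v"
  then have "var_idx v = var_idx w" by (simp add: less_eq_xy_def)
  then show "v = w" by (cases v; cases w) (simp_all, presburger+)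
qed (auto simp: less_eq_xy_def less_xy_def)

end

abbreviation xv :: "nat \<Rightarrow> xy cpoly" where "xv i \<equiv> Var (Xvar i)"
abbreviation yv :: "nat \<Rightarrow> xy cpoly" where "yv i \<equiv> Var (Yvar i)"

definition super_eval :: "nat \<Rightarrow> symfun \<Rightarrow> xy cpoly" where
  "super_eval n f = substitute (\<lambda>v. let k = v + 1 in
     (\<Sum>i=1..n. xv i ^ k) + (-1) ^ (k - 1) * (\<Sum>i=1..n. yv i ^ k)) f"

definition vandermonde :: "nat \<Rightarrow> (nat \<Rightarrow> xy cpoly) \<Rightarrow> xy cpoly" where
  "vandermonde n z = (\<Prod>(i, k)\<in>{(i, k). 1 \<le> i \<and> i < k \<and> k \<le> n}. z i - z k)"

definition act :: "(nat \<Rightarrow> nat) \<times> (nat \<Rightarrow> nat) \<Rightarrow> xy cpoly \<Rightarrow> xy cpoly" where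
  "act w = substitute (\<lambda>v. case v of Xvar i \<Rightarrow> xv (fst w i) | Yvar i \<Rightarrow> yv (snd w i))"

definition eps :: "(nat \<Rightarrow> nat) \<times> (nat \<Rightarrow> nat) \<Rightarrow> int" where
  "eps w = sign (fst w) * sign (snd w)"

definition hat :: "(int \<Rightarrow> complex) \<Rightarrow> (int \<Rightarrow> complex)" where
  "hat a = (\<lambda>i. - a (- i + 1))"

definition gen_power :: "xy cpoly \<Rightarrow> (int \<Rightarrow> complex) \<Rightarrow> nat \<Rightarrow> xy cpoly" where
  "gen_power z a m = (\<Prod>i=1..m. z - Const (a (int i)))"

text \<open>Subtraction of natural numbers is truncated; this is the positive part in the exponents
  \<open>n - part \<mu> i\<close> and \<open>n - part_transp \<mu> i\<close>, and in all other exponents the difference is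
  nonnegative. The squares in \<open>diagram \<mu>\<close> have coordinates at least 1.\<close>

definition f_poly :: "nat \<Rightarrow> nat list \<Rightarrow> (int \<Rightarrow> complex) \<Rightarrow> xy cpoly" where
  "f_poly n \<mu> a =
     (\<Prod>i=1..diag_length \<mu>.
        gen_power (xv i) a (part \<mu> i - i) * xv i ^ (n - part \<mu> i) *
        gen_power (yv i) (hat a) (part_transp \<mu> i - i) * yv i ^ (n - part_transp \<mu> i)) *
     (\<Prod>i=diag_length \<mu> + 1..n. xv i ^ (n - i) * yv i ^ (n - i)) *
     (\<Prod>(i, j)\<in>{(i, j). i \<le> n \<and> j \<le> n \<and> (i, j) \<in> diagram \<mu>}. xv i + yv j)"

text \<open>\<open>Fract p 0\<close> is \<open>0\<close> by convention; the denominator used below is never zero.\<close>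

lemma Var_neq: "v \<noteq> w \<Longrightarrow> Var v \<noteq> (Var w :: 'v cpoly)"
proof
  assume "v \<noteq> w" "Var v = (Var w :: 'v cpoly)"
  then have "Poly_Mapping.keys (Poly_Mapping.single (Poly_Mapping.single v (1::nat)) (1::complex)) =
    Poly_Mapping.keys (Poly_Mapping.single (Poly_Mapping.single w (1::nat)) (1::complex))"
    by (simp add: Var_def)
  then have "Poly_Mapping.keys (Poly_Mapping.single v (1::nat)) =
    Poly_Mapping.keys (Poly_Mapping.single w (1::nat))"
    by simp
  then show False using \<open>v \<noteq> w\<close> by simp
qed

lemma vandermonde_nonzero: "vandermonde n xv * vandermonde n yv \<noteq> 0"
proof -
  have fin: "finite {(i, k). 1 \<le> i \<and> i < k \<and> k \<le> n}"
    by (rule finite_subset[of _ "{1..n} \<times> {1..n}"]) auto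
  have "vandermonde n xv \<noteq> 0" "vandermonde n yv \<noteq> 0"
    unfolding vandermonde_def prod_zero_iff[OF fin] by (auto simp: Var_neq)
  then show ?thesis by simp
qed

end

theory Submission
  imports
    Defs
    "HOL-Computational_Algebra.Formal_Laurent_Series"
    "HOL-Computational_Algebra.Polynomial_Factorial"
begin

text \<open>The proof replaces the polynomial ring by its field of fractions and shows, for any field in which
\<open>2 \<noteq> 0\<close> and any point \<open>(x; y)\<close> in general position, that

  \<open>s\<^sub>\<mu>\<^sub>;\<^sub>a(x; y) V(x) V(y)\<close> is the alternating sum of \<open>f\<^sub>\<mu>\<^sub>;\<^sub>a\<close>.

At such a point \<open>H(u)\<close> becomes the rational function \<open>\<Prod>(u + y\<^sub>i) / \<Prod>(u - x\<^sub>i)\<close>. Expanding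
\<open>H(u)\<close> in inverse factorial powers gives \<open>h\<^sub>k\<^sub>;\<^sub>a\<close> as the coefficient of \<open>u\<^sup>-\<^sup>1\<close> in
\<open>H(u) (u|a)^(k - 1)\<close>, for all integers \<open>k\<close> if \<open>(u|a)^e\<close> is suitably defined for negative \<open>e\<close>. In the
Jacobi-Trudi matrix the shifts of \<open>a\<close> along a row then amount to monic polynomial factors of degree
0, 1, 2, ..., so \<open>s\<^sub>\<mu>\<^sub>;\<^sub>a\<close> is the determinant with entries
\<open>[u\<^sup>-\<^sup>1] H(u) (u|a)^(\<mu>\<^sub>i - i) u^(j - 1)\<close> (lemma \<open>specialize_multi_schur\<close>).

The identity is proved by induction on \<open>n\<close>, with three cases.

If the first row and the first column of \<open>\<mu>\<close> have at least \<open>n\<close> squares, the first hook is removed. In the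
alternating sum this is the expansion according to the variables that are moved to the first places
(\<open>sp_sum_remove_hook\<close>). In the determinant, the first row is a sum of residues at the \<open>x\<^sub>p\<close>, which
produces one summand for each \<open>p\<close>; in each summand, a linear relation between the columns, obtained by Lagrange
interpolation at the points \<open>-y\<^sub>r\<close>, removes the first column of \<open>\<mu>\<close>
(\<open>schur_det_row\<close>, \<open>schur_det_column\<close>, \<open>schur_det_remove_hook\<close>).

If the first row has at most \<open>n - 1\<close> squares, both sides are polynomials in \<open>x\<^sub>n\<close> of degree at most
\<open>2n - 2\<close>. They agree at the \<open>2n - 1\<close> points \<open>x\<^sub>1, ..., x\<^sub>n\<^sub>-\<^sub>1, -y\<^sub>1, ..., -y\<^sub>n\<close>: at the
first ones both vanish, and at \<open>x\<^sub>n = -y\<^sub>j\<close> both reduce to the case of \<open>n - 1\<close> variables. For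
the determinant this reduction is evident from \<open>H(u)\<close>. For the alternating sum it is the
cancellation property \<open>sp_sum_cancel\<close>, which has a similar proof: with \<open>x\<^sub>n = t\<close>
and \<open>y\<^sub>n = -t\<close> the sum has degree at most \<open>2n - 2\<close> in \<open>t\<close>, because all terms with a factor
\<open>x\<^sub>n + y\<^sub>n\<close> disappear, and so it is determined by its zeros and its value at \<open>t = 0\<close>.

The case of a short first column is treated in the same way, with \<open>y\<^sub>n\<close> in place of \<open>x\<^sub>n\<close>.\<close>

section \<open>Determinants of linear functionals on polynomials\<close>

definition linear_functional :: "('a::comm_ring_1 poly \<Rightarrow> 'a) \<Rightarrow> bool" where
  "linear_functional l \<longleftrightarrow> (\<forall>p q. l (p + q) = l p + l q) \<and> (\<forall>c p. l (smult c p) = c * l p)"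

text \<open>Row \<open>i\<close> consists of the moments of the functional \<open>l i\<close>. The determinant depends only on the
functionals and not on the choice of the monic basis (\<open>det_monic_basis\<close>), and this freedom replaces
all column operations below.\<close>

definition moment_det :: "nat \<Rightarrow> (nat \<Rightarrow> 'a::comm_ring_1 poly \<Rightarrow> 'a) \<Rightarrow> 'a" where
  "moment_det k l = det (mat k k (\<lambda>(i, j). l i (monom 1 j)))"

lemma linear_functional_0: "linear_functional l \<Longrightarrow> l 0 = 0"
  unfolding linear_functional_def by (metis mult_zero_left smult_0_left)

lemma linear_functional_sum:
  assumes "linear_functional l"
  shows "l (\<Sum>r\<in>A. smult (c r) (p r)) = (\<Sum>r\<in>A. c r * l (p r))"
  using assms linear_functional_0[OF assms]
  by (induction A rule: infinite_finite_induct) (simp_all add: linear_functional_def)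

lemma linear_functional_mult_left:
  "linear_functional l \<Longrightarrow> linear_functional (\<lambda>q. l (p * q))"
  unfolding linear_functional_def by (simp add: distrib_left)

lemma linear_functional_mult_right:
  "linear_functional l \<Longrightarrow> linear_functional (\<lambda>q. l (q * p))"
  unfolding linear_functional_def by (simp add: distrib_right)

text \<open>Passing from the monomials to another basis with one monic polynomial in each degree multiplies the matrix
by a unitriangular one.\<close>

lemma det_monic_basis:
  assumes lin: "\<And>i. i < k \<Longrightarrow> linear_functional (l i)"
    and deg: "\<And>j. j < k \<Longrightarrow> degree (p j) = j"
    and monic: "\<And>j. j < k \<Longrightarrow> lead_coeff (p j) = 1"
  shows "det (mat k k (\<lambda>(i, j). l i (p j))) = moment_det k l"
proof -
  define A where "A = mat k k (\<lambda>(i, j). l i (monom 1 j))"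
  define C where "C = mat k k (\<lambda>(r, j). coeff (p j) r)"
  have carrier: "A \<in> carrier_mat k k" "C \<in> carrier_mat k k"
    by (simp_all add: A_def C_def)
  have "upper_triangular C"
    unfolding upper_triangular_def C_def using deg by (auto intro!: coeff_eq_0)
  then have "det C = prod_list (diag_mat C)"
    using carrier(2) by (rule det_upper_triangular)
  also have "\<dots> = 1"
  proof -
    have "map (\<lambda>i. C $$ (i, i)) [0..<k] = map (\<lambda>_. 1) [0..<k]"
      using deg monic by (intro map_cong) (auto simp: C_def)
    then show ?thesis by (simp add: diag_mat_def C_def map_replicate_const)
  qed
  finally have "det C = 1" .
  have "mat k k (\<lambda>(i, j). l i (p j)) = A * C"
  proof (rule eq_matI)
    fix i j assume "i < dim_row (A * C)" "j < dim_col (A * C)"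
    then have ij: "i < k" "j < k" by (simp_all add: A_def C_def)
    have "p j = (\<Sum>r\<le>j. smult (coeff (p j) r) (monom 1 r))"
      using poly_as_sum_of_monoms[of "p j"] deg[OF ij(2)] by (simp add: smult_monom)
    also have "\<dots> = (\<Sum>r<k. smult (coeff (p j) r) (monom 1 r))"
      using ij deg by (intro sum.mono_neutral_left) (auto simp: coeff_eq_0)
    finally have "l i (p j) = l i (\<Sum>r<k. smult (coeff (p j) r) (monom 1 r))"
      by (rule arg_cong)
    also have "\<dots> = (\<Sum>r<k. coeff (p j) r * l i (monom 1 r))"
      by (rule linear_functional_sum[OF lin[OF ij(1)]])
    finally show "mat k k (\<lambda>(i, j). l i (p j)) $$ (i, j) = (A * C) $$ (i, j)"
      using ij by (simp add: A_def C_def scalar_prod_def mult.commute lessThan_atLeast0)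
  qed (simp_all add: A_def C_def)
  then have "det (mat k k (\<lambda>(i, j). l i (p j))) = det A * det C"
    using det_mult[OF carrier] by simp
  with \<open>det C = 1\<close> show ?thesis by (simp add: moment_det_def A_def)
qed

lemma moment_det_cong:
  "(\<And>i q. i < k \<Longrightarrow> l i q = l' i q) \<Longrightarrow> moment_det k l = moment_det k l'"
  unfolding moment_det_def by (intro arg_cong[of _ _ det] cong_mat) auto

lemma det_first_row_unit:
  fixes f :: "nat \<times> nat \<Rightarrow> 'a::comm_ring_1"
  assumes "\<And>j. j \<le> k \<Longrightarrow> f (0, j) = (if j = 0 then 1 else 0)"
  shows "det (mat (Suc k) (Suc k) f) = det (mat k k (\<lambda>(i, j). f (Suc i, Suc j)))"
proof -
  let ?M = "mat (Suc k) (Suc k) f"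
  have "det ?M = (\<Sum>j<Suc k. ?M $$ (0, j) * cofactor ?M 0 j)"
    by (rule laplace_expansion_row) auto
  also have "\<dots> = (\<Sum>j<Suc k. if j = 0 then cofactor ?M 0 0 else 0)"
    using assms by (intro sum.cong) auto
  also have "\<dots> = cofactor ?M 0 0" by simp
  also have "mat_delete ?M 0 0 = mat k k (\<lambda>(i, j). f (Suc i, Suc j))"
    by (intro eq_matI) (auto simp: mat_delete_def)
  then have "cofactor ?M 0 0 = det (mat k k (\<lambda>(i, j). f (Suc i, Suc j)))"
    by (simp add: cofactor_def)
  finally show ?thesis .
qed

lemma det_last_row_unit:
  fixes f :: "nat \<times> nat \<Rightarrow> 'a::comm_ring_1"
  assumes "\<And>j. j \<le> k \<Longrightarrow> f (k, j) = (if j = k then 1 else 0)"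
  shows "det (mat (Suc k) (Suc k) f) = det (mat k k f)"
proof -
  let ?M = "mat (Suc k) (Suc k) f"
  have "det ?M = (\<Sum>j<Suc k. ?M $$ (k, j) * cofactor ?M k j)"
    by (rule laplace_expansion_row) auto
  also have "\<dots> = (\<Sum>j<Suc k. if j = k then cofactor ?M k k else 0)"
    using assms by (intro sum.cong) auto
  also have "\<dots> = cofactor ?M k k" by simp
  also have "mat_delete ?M k k = mat k k f"
    by (intro eq_matI) (auto simp: mat_delete_def)
  then have "cofactor ?M k k = det (mat k k f)"
    by (simp add: cofactor_def)
  finally show ?thesis .
qed

lemma det_sum_row:
  fixes f :: "nat \<Rightarrow> nat \<Rightarrow> 'a::comm_ring_1"
  assumes "r < k"
  shows "det (mat k k (\<lambda>(i, j). if i = r then \<Sum>p\<in>A. c p * g p j else f i j)) =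
    (\<Sum>p\<in>A. c p * det (mat k k (\<lambda>(i, j). if i = r then g p j else f i j)))"
proof -
  let ?M = "\<lambda>h. mat k k (\<lambda>(i, j). if i = r then h j else f i j)"
  have cof: "cofactor (?M h) r j = cofactor (?M h') r j" if "j < k" for h h' j
  proof -
    have "mat_delete (?M h) r j = mat_delete (?M h') r j"
      using assms that by (intro eq_matI) (auto simp: mat_delete_def)
    then show ?thesis by (simp add: cofactor_def)
  qed
  have expand: "det (?M h) = (\<Sum>j<k. h j * cofactor (?M (\<lambda>_. 0)) r j)" for h
  proof -
    have "det (?M h) = (\<Sum>j<k. ?M h $$ (r, j) * cofactor (?M h) r j)"
      by (rule laplace_expansion_row) (use assms in auto)
    also have "\<dots> = (\<Sum>j<k. h j * cofactor (?M (\<lambda>_. 0)) r j)"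
      using assms cof by (intro sum.cong arg_cong2[of _ _ _ _ "(*)"]) auto
    finally show ?thesis .
  qed
  show ?thesis
    unfolding expand sum_distrib_left sum_distrib_right
    by (subst sum.swap) (simp add: mult.assoc)
qed

lemma det_mat_swap_indices:
  "det (mat k k (\<lambda>(i, j). f j i)) = det (mat k k (\<lambda>(i, j). f i j))"
proof -
  have "transpose_mat (mat k k (\<lambda>(i, j). f i j)) = mat k k (\<lambda>(i, j). f j i)"
    by (intro eq_matI) auto
  then show ?thesis using det_transpose[of "mat k k (\<lambda>(i, j). f i j)" k] by simp
qed

lemma det_sum_column:
  fixes f :: "nat \<Rightarrow> nat \<Rightarrow> 'a::comm_ring_1"
  assumes "r < k"
  shows "det (mat k k (\<lambda>(i, j). if j = r then \<Sum>p\<in>A. c p * g p i else f i j)) =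
    (\<Sum>p\<in>A. c p * det (mat k k (\<lambda>(i, j). if j = r then g p i else f i j)))"
  using det_sum_row[OF assms, of c g A "\<lambda>i j. f j i"]
    det_mat_swap_indices[of k "\<lambda>i j. if i = r then \<Sum>p\<in>A. c p * g p j else f j i"]
    det_mat_swap_indices[of k "\<lambda>i j. if i = r then g _ j else f j i"]
  by simp

text \<open>The Laplace expansions along the moved column have the same minors, and signs that differ by
\<open>(-1) ^ k\<close>.\<close>

lemma det_last_column_to_front:
  fixes v :: "nat \<Rightarrow> 'a::comm_ring_1"
  shows "det (mat (Suc k) (Suc k) (\<lambda>(i, j). if j = k then v i else w i j)) =
    (-1) ^ k * det (mat (Suc k) (Suc k) (\<lambda>(i, j). if j = 0 then v i else w i (j - 1)))"
    (is "det ?M = _ * det ?N")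
proof -
  have minor: "mat_delete ?M i k = mat_delete ?N i 0" for i
    by (intro eq_matI) (auto simp: mat_delete_def)
  have sgn: "(-1) ^ (i + k) = (-1) ^ k * ((-1) ^ i :: 'a)" for i
    by (simp add: power_add)
  have "det ?M = (\<Sum>i<Suc k. ?M $$ (i, k) * cofactor ?M i k)"
    by (rule laplace_expansion_column) auto
  also have "\<dots> = (\<Sum>i<Suc k. (-1) ^ k * (?N $$ (i, 0) * cofactor ?N i 0))"
    unfolding cofactor_def minor by (intro sum.cong refl) (simp add: sgn mult_ac)
  also have "\<dots> = (-1) ^ k * det ?N"
    unfolding sum_distrib_left[symmetric]
    by (subst laplace_expansion_column[of ?N "Suc k" 0]) auto
  finally show ?thesis .
qed

lemma degree_linear_times:
  fixes c :: "'a::idom"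
  shows "degree ([:c, 1:] * monom 1 j) = Suc j" "lead_coeff ([:c, 1:] * monom 1 j) = 1"
proof -
  show d: "degree ([:c, 1:] * monom 1 j) = Suc j"
    by (subst degree_mult_eq) (auto simp: degree_monom_eq)
  show "lead_coeff ([:c, 1:] * monom 1 j) = 1"
    by (subst lead_coeff_mult) (simp add: degree_monom_eq)
qed

text \<open>The form in which a linear factor \<open>u + c\<close> is split off: only the first column does not carry it.\<close>

lemma moment_det_insert_root:
  fixes l :: "nat \<Rightarrow> 'a::idom poly \<Rightarrow> 'a"
  assumes "\<And>i. i < k \<Longrightarrow> linear_functional (l i)"
  shows "moment_det k l =
    det (mat k k (\<lambda>(i, j). l i (if j = 0 then 1 else [:c, 1:] * monom 1 (j - 1))))"
proof (rule det_monic_basis[symmetric, OF assms])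
  let ?p = "\<lambda>j. if j = 0 then 1 else [:c, 1:] * monom 1 (j - 1)"
  show "degree (?p j) = j" "lead_coeff (?p j) = 1" for j
    using degree_linear_times[of c "j - 1"] by (cases "j = 0"; simp del: mult_pCons_left)+
qed

text \<open>Evaluation at \<open>x p\<close> kills all multiples of \<open>u - x p\<close>. In the basis
\<open>1, (u - x p), (u - x p) u, ...\<close> a first row of values at \<open>x p\<close> is therefore a unit vector, and the
other rows see their functionals only on multiples of \<open>u - x p\<close>.\<close>

lemma moment_det_row:
  fixes l :: "nat \<Rightarrow> 'a::idom poly \<Rightarrow> 'a"
  assumes lin: "\<And>i. i < Suc k \<Longrightarrow> linear_functional (l i)"
    and row: "\<And>q. l 0 q = (\<Sum>p\<in>A. c p * poly q (x p))"
  shows "moment_det (Suc k) l =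
    (\<Sum>p\<in>A. c p * moment_det k (\<lambda>i q. l (Suc i) ([:- x p, 1:] * q)))"
proof -
  define e where "e p i = (if i = 0 then (\<lambda>q. poly q (x p)) else l i)" for p i
  have lin_e: "linear_functional (e p i)" if "i < Suc k" for p i
    using lin[OF that] by (auto simp: e_def linear_functional_def)
  have eval: "moment_det (Suc k) (e p) = moment_det k (\<lambda>i q. l (Suc i) ([:- x p, 1:] * q))" for p
    apply (subst moment_det_insert_root[where c = "- x p"], rule lin_e, assumption)
    apply (subst det_first_row_unit)
    by (auto simp: e_def moment_det_def simp del: mult_pCons_left)
  have "moment_det (Suc k) l =
      det (mat (Suc k) (Suc k) (\<lambda>(i, j). if i = 0 then \<Sum>p\<in>A. c p * poly (monom 1 j) (x p)
        else l i (monom 1 j)))"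
    unfolding moment_det_def row[symmetric]
    by (intro arg_cong[of _ _ det] cong_mat) auto
  also have "\<dots> = (\<Sum>p\<in>A. c p * moment_det (Suc k) (e p))"
    unfolding det_sum_row[of 0 "Suc k", OF zero_less_Suc] moment_det_def
    by (intro sum.cong arg_cong2[of _ _ _ _ "(*)"] arg_cong[of _ _ det] refl cong_mat)
      (auto simp: e_def)
  finally show ?thesis by (simp only: eval)
qed

text \<open>The kernel element \<open>Y \<alpha> + \<Sum> c r Z r\<close> allows the last column of the determinant for \<open>Y\<close> to be
replaced by a combination of the columns \<open>l i (Z r)\<close>. Since \<open>Y\<close> is a multiple of \<open>Z r\<close>, the new
column and the remaining ones are, up to order, the values of \<open>l i (Z r * q)\<close> on a monic basis.\<close>

lemma moment_det_column:
  fixes l :: "nat \<Rightarrow> 'a::idom poly \<Rightarrow> 'a"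
  assumes lin: "\<And>i. i < Suc k \<Longrightarrow> linear_functional (l i)"
    and kernel: "\<And>i. i < Suc k \<Longrightarrow> l i (Y * \<alpha>) + (\<Sum>r\<in>A. c r * l i (Z r)) = 0"
    and \<alpha>: "degree \<alpha> = k" "lead_coeff \<alpha> = 1"
    and Y: "\<And>r. r \<in> A \<Longrightarrow> Y = [:y r, 1:] * Z r"
  shows "moment_det (Suc k) (\<lambda>i q. l i (Y * q)) =
    (-1) ^ Suc k * (\<Sum>r\<in>A. c r * moment_det (Suc k) (\<lambda>i q. l i (Z r * q)))"
proof -
  let ?p = "\<lambda>j. if j = k then \<alpha> else monom 1 j"
  have "moment_det (Suc k) (\<lambda>i q. l i (Y * q)) =
      det (mat (Suc k) (Suc k) (\<lambda>(i, j). l i (Y * ?p j)))"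
    using \<alpha> by (intro det_monic_basis[symmetric] linear_functional_mult_left lin)
      (auto simp: degree_monom_eq)
  also have "\<dots> = det (mat (Suc k) (Suc k) (\<lambda>(i, j). if j = k then \<Sum>r\<in>A. - c r * l i (Z r)
      else l i (Y * monom 1 j)))"
    using kernel by (intro arg_cong[of _ _ det] cong_mat)
      (auto simp: sum_negf eq_neg_iff_add_eq_0)
  also have "\<dots> = (\<Sum>r\<in>A. - c r * det (mat (Suc k) (Suc k)
      (\<lambda>(i, j). if j = k then l i (Z r) else l i (Y * monom 1 j))))"
    by (rule det_sum_column) simp
  also have "\<dots> = (\<Sum>r\<in>A. (-1) ^ Suc k * (c r * moment_det (Suc k) (\<lambda>i q. l i (Z r * q))))"
  proof (rule sum.cong[OF refl])
    fix r assume "r \<in> A"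
    have "moment_det (Suc k) (\<lambda>i q. l i (Z r * q)) =
      det (mat (Suc k) (Suc k) (\<lambda>(i, j). if j = 0 then l i (Z r) else l i (Y * monom 1 (j - 1))))"
      by (subst moment_det_insert_root[where c = "y r"])
        (auto simp: Y[OF \<open>r \<in> A\<close>] ac_simps simp del: mult_pCons_left mult_pCons_right
          intro!: linear_functional_mult_right lin arg_cong[of _ _ det] cong_mat)
    then show "- c r * det (mat (Suc k) (Suc k)
        (\<lambda>(i, j). if j = k then l i (Z r) else l i (Y * monom 1 j))) =
      (-1) ^ Suc k * (c r * moment_det (Suc k) (\<lambda>i q. l i (Z r * q)))"
      unfolding det_last_column_to_front[of k] by simp
  qed
  finally show ?thesis by (simp only: sum_distrib_left)
qed

section \<open>Lagrange interpolation\<close>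

lemma prod_linear_factors_dvd:
  fixes v :: "'b \<Rightarrow> 'a::idom"
  assumes "finite S" "inj_on v S" "\<And>r. r \<in> S \<Longrightarrow> poly f (v r) = 0"
  shows "(\<Prod>r\<in>S. [:- v r, 1:]) dvd f"
  using assms
proof (induction S arbitrary: f rule: finite_induct)
  case (insert s S)
  from insert.prems have "poly f (v s) = 0" by simp
  then obtain g where g: "f = [:- v s, 1:] * g"
    by (auto simp: poly_eq_0_iff_dvd elim: dvdE)
  have "poly g (v r) = 0" if "r \<in> S" for r
  proof -
    have "v r \<noteq> v s" using insert that by (auto simp: inj_on_def)
    moreover have "poly f (v r) = 0" using insert.prems that by simp
    ultimately show ?thesis by (simp add: g)
  qed
  then have "(\<Prod>r\<in>S. [:- v r, 1:]) dvd g"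
    using insert by (intro insert.IH) auto
  then show ?case using insert.hyps by (simp add: g mult_dvd_mono del: mult_pCons_left)
qed simp

text \<open>Division of \<open>f\<close> by the polynomial with the simple roots \<open>v r\<close>, with the remainder written by Lagrange's
formula.\<close>

lemma lagrange_decomposition:
  fixes v :: "'b \<Rightarrow> 'a::field"
  assumes S: "finite S" "inj_on v S"
  obtains Q where "f = (\<Prod>r\<in>S. [:- v r, 1:]) * Q +
    (\<Sum>r\<in>S. smult (poly f (v r) / (\<Prod>s\<in>S - {r}. v r - v s)) (\<Prod>s\<in>S - {r}. [:- v s, 1:]))"
proof -
  let ?R = "\<Sum>r\<in>S. smult (poly f (v r) / (\<Prod>s\<in>S - {r}. v r - v s)) (\<Prod>s\<in>S - {r}. [:- v s, 1:])"
  have "(\<Prod>r\<in>S. [:- v r, 1:]) dvd f - ?R"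
  proof (rule prod_linear_factors_dvd[OF S])
    fix t assume t: "t \<in> S"
    have "poly ?R (v t) = (\<Sum>r\<in>S. if r = t then poly f (v t) else 0)"
      unfolding poly_sum
    proof (rule sum.cong[OF refl])
      fix r assume r: "r \<in> S"
      show "poly (smult (poly f (v r) / (\<Prod>s\<in>S - {r}. v r - v s)) (\<Prod>s\<in>S - {r}. [:- v s, 1:])) (v t)
        = (if r = t then poly f (v t) else 0)"
      proof (cases "r = t")
        case True
        have "(\<Prod>s\<in>S - {t}. v t - v s) \<noteq> 0"
          using S t by (auto simp: inj_on_def)
        with True show ?thesis by (simp add: poly_prod)
      next
        case False
        then have "(\<Prod>s\<in>S - {r}. v t - v s) = 0"
          using S t by (intro prod_zero) auto
        with False show ?thesis by (simp add: poly_prod)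
      qed
    qed
    also have "\<dots> = poly f (v t)" using S t by simp
    finally show "poly (f - ?R) (v t) = 0" by simp
  qed
  then obtain Q where "f - ?R = (\<Prod>r\<in>S. [:- v r, 1:]) * Q" by (elim dvdE)
  then have "f = (\<Prod>r\<in>S. [:- v r, 1:]) * Q + ?R" by (simp add: algebra_simps)
  then show ?thesis by (rule that)
qed

section \<open>Expansions at infinity and residues\<close>

text \<open>The library series are in the variable \<open>fls_X\<close>, which stands for \<open>u\<^sup>-\<^sup>1\<close>; a polynomial in \<open>u\<close> is
thus evaluated at \<open>fls_X_inv\<close>.\<close>

definition laurent_poly :: "'a::field poly \<Rightarrow> 'a fls" where
  "laurent_poly p = poly (map_poly fls_const p) fls_X_inv"

text \<open>The coefficient of \<open>u\<^sup>-\<^sup>1\<close>.\<close>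

abbreviation residue :: "'a::field fls \<Rightarrow> 'a" where
  "residue f \<equiv> fls_nth f 1"

lemma laurent_poly_pCons: "laurent_poly (pCons a p) = fls_const a + fls_X_inv * laurent_poly p"
  unfolding laurent_poly_def by (cases "a = 0 \<and> p = 0") (auto simp: map_poly_pCons)

lemma laurent_poly_0 [simp]: "laurent_poly 0 = 0" and laurent_poly_1 [simp]: "laurent_poly 1 = 1"
  by (simp_all add: laurent_poly_def)

lemma laurent_poly_add: "laurent_poly (p + q) = laurent_poly p + laurent_poly q"
  by (induction p q rule: poly_induct2) (simp_all add: laurent_poly_pCons algebra_simps flip: fls_plus_const)

lemma laurent_poly_smult: "laurent_poly (smult c p) = fls_const c * laurent_poly p"
  by (induction p) (simp_all add: laurent_poly_pCons algebra_simps flip: fls_const_mult_const)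

lemma laurent_poly_mult: "laurent_poly (p * q) = laurent_poly p * laurent_poly q"
  by (induction p) (simp_all add: laurent_poly_pCons laurent_poly_add laurent_poly_smult algebra_simps)

lemma laurent_poly_sum: "laurent_poly (\<Sum>i\<in>A. f i) = (\<Sum>i\<in>A. laurent_poly (f i))"
  by (induction A rule: infinite_finite_induct) (simp_all add: laurent_poly_add)

lemma laurent_poly_prod: "laurent_poly (\<Prod>i\<in>A. f i) = (\<Prod>i\<in>A. laurent_poly (f i))"
  by (induction A rule: infinite_finite_induct) (simp_all add: laurent_poly_mult)

lemma laurent_poly_linear: "laurent_poly [:c, 1:] = fls_X_inv + fls_const c"
  by (simp add: laurent_poly_pCons)

lemma laurent_poly_monom: "laurent_poly (monom 1 j) = fls_X_inv ^ j"
  by (induction j) (simp_all add: monom_Suc laurent_poly_pCons monom_0)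

lemma laurent_poly_nth_pos: "n > 0 \<Longrightarrow> fls_nth (laurent_poly p) n = 0"
  by (induction p arbitrary: n) (auto simp: laurent_poly_pCons fls_X_inv_times_conv_shift)

lemma linear_functional_residue: "linear_functional (\<lambda>q. residue (f * laurent_poly q))"
proof -
  have "residue (f * laurent_poly (smult c q)) = c * residue (f * laurent_poly q)" for c q
    unfolding laurent_poly_smult by (metis fls_mult_const_nth(1) mult.left_commute)
  then show ?thesis
    unfolding linear_functional_def by (simp add: laurent_poly_add distrib_left)
qed

text \<open>Series of the form \<open>u^d + (lower powers of u)\<close>; they form a group under multiplication.\<close>

definition monic_at :: "int \<Rightarrow> 'a::field fls \<Rightarrow> bool" where
  "monic_at d f \<longleftrightarrow> fls_nth f (- d) = 1 \<and> (\<forall>k. k < - d \<longrightarrow> fls_nth f k = 0)"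

lemma monic_at_iff: "monic_at d f \<longleftrightarrow> f \<noteq> 0 \<and> fls_subdegree f = - d \<and> fls_nth f (fls_subdegree f) = 1"
  unfolding monic_at_def by (metis fls_eq0_below_subdegree fls_subdegree_eqI fls_zero_nth one_neq_zero)

lemma monic_at_mult: "monic_at d f \<Longrightarrow> monic_at e g \<Longrightarrow> monic_at (d + e) (f * g)"
  unfolding monic_at_iff using fls_times_base[of f g] by auto

lemma monic_at_1: "monic_at 0 1"
  by (auto simp: monic_at_def)

lemma monic_at_inverse:
  assumes "monic_at d f" shows "monic_at (- d) (inverse f)"
proof -
  have f: "f \<noteq> 0" "fls_subdegree f = - d" "fls_nth f (fls_subdegree f) = 1"
    using assms by (auto simp: monic_at_iff)
  have sub: "fls_subdegree (inverse f) = d" using f by simp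
  have "fls_nth (f * inverse f) (fls_subdegree f + fls_subdegree (inverse f)) =
      fls_nth f (fls_subdegree f) * fls_nth (inverse f) (fls_subdegree (inverse f))"
    by (rule fls_times_base)
  then show ?thesis using f sub unfolding monic_at_iff by simp
qed

lemma monic_at_linear: "monic_at 1 (fls_X_inv + fls_const c)"
  by (auto simp: monic_at_def)

lemma monic_at_prod:
  "(\<And>i. i \<in> A \<Longrightarrow> monic_at 1 (f i)) \<Longrightarrow> monic_at (int (card A)) (\<Prod>i\<in>A. f i)"
proof (induction A rule: infinite_finite_induct)
  case (insert a A)
  then show ?case using monic_at_mult[of 1 "f a" "int (card A)" "\<Prod>i\<in>A. f i"] by (simp add: add.commute)
qed (simp_all add: monic_at_1)

lemma monic_at_power: "monic_at (int j) (fls_X_inv ^ j)"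
  by (auto simp: monic_at_def)

lemma residue_monic: "monic_at d f \<Longrightarrow> d = - 1 \<Longrightarrow> residue f = 1"
  by (simp add: monic_at_def)

lemma residue_monic_0: "monic_at d f \<Longrightarrow> d < - 1 \<Longrightarrow> residue f = 0"
  by (simp add: monic_at_def)

lemma linear_neq_0 [simp]: "fls_X_inv + fls_const c \<noteq> (0 :: 'a::field fls)"
  using monic_at_linear[of c] by (auto simp: monic_at_iff)

lemma residue_inverse_linear: "residue (inverse (fls_X_inv + fls_const c)) = 1"
  using monic_at_inverse[OF monic_at_linear[of c]] by (rule residue_monic) simp

definition root_poly :: "('b \<Rightarrow> 'a::field) \<Rightarrow> 'b set \<Rightarrow> 'a poly" where
  "root_poly v A = (\<Prod>r\<in>A. [:- v r, 1:])"

lemma laurent_poly_root_poly_neq_0: "finite A \<Longrightarrow> laurent_poly (root_poly v A) \<noteq> 0"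
  by (simp add: root_poly_def laurent_poly_prod laurent_poly_linear del: fls_const_uminus)

lemma root_poly_remove:
  "finite A \<Longrightarrow> r \<in> A \<Longrightarrow> root_poly v A = [:- v r, 1:] * root_poly v (A - {r})"
  unfolding root_poly_def by (rule prod.remove)

lemma poly_root_poly: "poly (root_poly v A) t = (\<Prod>s\<in>A. t - v s)"
  by (simp add: root_poly_def poly_prod)

lemma degree_root_poly: "degree (root_poly v A) = card A"
  unfolding root_poly_def by (subst degree_prod_sum_eq) auto

lemma lead_coeff_root_poly: "lead_coeff (root_poly v A) = 1"
  unfolding root_poly_def by (simp add: lead_coeff_prod)

lemma root_poly_neq_0 [simp]: "root_poly v A \<noteq> 0"
  using lead_coeff_root_poly[of v A] by auto

text \<open>The sum of the residues of \<open>f / \<Prod>(u - v r)\<close> at its poles. A polynomial has no term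
\<open>u\<^sup>-\<^sup>1\<close>, so only the partial fractions of the quotient contribute.\<close>

lemma residue_divide_root_poly:
  assumes A: "finite A" "inj_on v A"
  shows "residue (laurent_poly f / laurent_poly (root_poly v A)) =
    (\<Sum>r\<in>A. poly f (v r) / (\<Prod>s\<in>A - {r}. v r - v s))"
proof -
  let ?c = "\<lambda>r. poly f (v r) / (\<Prod>s\<in>A - {r}. v r - v s)"
  obtain Q where Q: "f = root_poly v A * Q + (\<Sum>r\<in>A. smult (?c r) (root_poly v (A - {r})))"
    using lagrange_decomposition[OF A, of f] unfolding root_poly_def by blast
  have "laurent_poly f / laurent_poly (root_poly v A) =
      laurent_poly Q + (\<Sum>r\<in>A. fls_const (?c r) * (laurent_poly (root_poly v (A - {r})) / laurent_poly (root_poly v A)))"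
    using laurent_poly_root_poly_neq_0[OF A(1), of v]
    by (subst Q) (simp add: laurent_poly_add laurent_poly_mult laurent_poly_sum laurent_poly_smult add_divide_distrib sum_divide_distrib)
  also have "(\<Sum>r\<in>A. fls_const (?c r) * (laurent_poly (root_poly v (A - {r})) / laurent_poly (root_poly v A))) =
      (\<Sum>r\<in>A. fls_const (?c r) * inverse (fls_X_inv + fls_const (- v r)))"
  proof (intro sum.cong arg_cong2[of _ _ _ _ "(*)"] refl)
    fix r assume r: "r \<in> A"
    show "laurent_poly (root_poly v (A - {r})) / laurent_poly (root_poly v A) = inverse (fls_X_inv + fls_const (- v r))"
      unfolding root_poly_remove[OF A(1) r] laurent_poly_mult laurent_poly_linear
      using laurent_poly_root_poly_neq_0[of "A - {r}" v] A(1)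
      by (simp add: divide_inverse del: fls_const_uminus)
  qed
  finally show ?thesis
    by (simp add: fls_nth_sum laurent_poly_nth_pos residue_inverse_linear del: fls_const_uminus)
qed

section \<open>Expansions of the residue determinant\<close>

text \<open>The functional of row \<open>i\<close> is \<open>q \<mapsto> [u\<^sup>-\<^sup>1] R(u) g\<^sub>i(u) q(u)\<close>. For \<open>R = H(u)\<close> and
\<open>g\<^sub>i = (u|a)^(\<mu>\<^sub>i - i)\<close> this is a multiparameter Schur function.\<close>

definition schur_det :: "(nat \<Rightarrow> 'a::field fls) \<Rightarrow> nat \<Rightarrow> 'a fls \<Rightarrow> 'a" where
  "schur_det g N R = moment_det N (\<lambda>i q. residue (R * g i * laurent_poly q))"

text \<open>The entries \<open>[u\<^sup>-\<^sup>1] R g\<^sub>N u^j\<close> of the last row have degree \<open>j - N - 1\<close> in \<open>u\<close>, so they vanish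
for \<open>j < N\<close> and the last one is 1. This is why the order of the Jacobi-Trudi determinant is
irrelevant.\<close>

lemma schur_det_Suc:
  assumes "monic_at 0 R" "monic_at (- int (Suc N)) (g N)"
  shows "schur_det g (Suc N) R = schur_det g N R"
proof -
  have "monic_at (0 + - int (Suc N) + int j) (R * g N * laurent_poly (monom 1 j))" for j
    unfolding laurent_poly_monom by (intro monic_at_mult assms monic_at_power)
  then have "residue (R * g N * laurent_poly (monom 1 j)) = (if j = N then 1 else 0)" if "j \<le> N" for j
    using that by (cases "j = N")
      (auto intro: residue_monic[OF \<open>\<And>j. monic_at _ (R * g N * laurent_poly (monom 1 j))\<close>]
        residue_monic_0[OF \<open>\<And>j. monic_at _ (R * g N * laurent_poly (monom 1 j))\<close>])
  then show ?thesis
    unfolding schur_det_def moment_det_def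
    by (subst det_last_row_unit) auto
qed

text \<open>Since \<open>g 0\<close> is a polynomial, the first row is a sum of residues at the points \<open>x p\<close>. Multiplying the
remaining functionals by \<open>u - x p\<close> removes the variable \<open>x p\<close> from the denominator.\<close>

lemma schur_det_row:
  fixes x :: "'b \<Rightarrow> 'a::field"
  assumes A: "finite A" "inj_on x A" and g0: "g 0 = laurent_poly G"
  shows "schur_det g (Suc N) (laurent_poly Y / laurent_poly (root_poly x A)) =
    (\<Sum>p\<in>A. poly G (x p) * poly Y (x p) / (\<Prod>s\<in>A - {p}. x p - x s) *
      schur_det (g \<circ> Suc) N (laurent_poly Y / laurent_poly (root_poly x (A - {p}))))"
proof -
  let ?R = "laurent_poly Y / laurent_poly (root_poly x A)"
  have row: "residue (?R * g 0 * laurent_poly q) =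
      (\<Sum>p\<in>A. poly G (x p) * poly Y (x p) / (\<Prod>s\<in>A - {p}. x p - x s) * poly q (x p))" for q
    using residue_divide_root_poly[OF A, of "Y * G * q"]
    by (simp add: g0 laurent_poly_mult mult_ac)
  have "schur_det g (Suc N) ?R =
    (\<Sum>p\<in>A. poly G (x p) * poly Y (x p) / (\<Prod>s\<in>A - {p}. x p - x s) *
      moment_det N (\<lambda>i q. residue (?R * g (Suc i) * laurent_poly ([:- x p, 1:] * q))))"
    unfolding schur_det_def
    by (rule moment_det_row) (rule linear_functional_residue, rule row)
  also have "\<dots> = (\<Sum>p\<in>A. poly G (x p) * poly Y (x p) / (\<Prod>s\<in>A - {p}. x p - x s) *
      schur_det (g \<circ> Suc) N (laurent_poly Y / laurent_poly (root_poly x (A - {p}))))"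
  proof (intro sum.cong refl arg_cong2[of _ _ _ _ "(*)"])
    fix p assume p: "p \<in> A"
    show "moment_det N (\<lambda>i q. residue (?R * g (Suc i) * laurent_poly ([:- x p, 1:] * q))) =
        schur_det (g \<circ> Suc) N (laurent_poly Y / laurent_poly (root_poly x (A - {p})))"
      unfolding schur_det_def
    proof (rule moment_det_cong)
      fix i q
      have cancel: "a / (b * c) * d * (b * e) = a / c * d * e" if "b \<noteq> 0" for a b c d e :: "'a fls"
        using that by (simp add: field_simps)
      have "?R * g (Suc i) * laurent_poly ([:- x p, 1:] * q) =
          laurent_poly Y / laurent_poly (root_poly x (A - {p})) * (g \<circ> Suc) i * laurent_poly q"
        unfolding root_poly_remove[OF A(1) p] laurent_poly_mult laurent_poly_linear cancel[OF linear_neq_0] by simp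
      then show "residue (?R * g (Suc i) * laurent_poly ([:- x p, 1:] * q)) =
          residue (laurent_poly Y / laurent_poly (root_poly x (A - {p})) * (g \<circ> Suc) i * laurent_poly q)"
        by (rule arg_cong)
    qed
  qed
  finally show ?thesis .
qed

text \<open>The polynomial \<open>root_poly x A * E\<close> is in the kernel of all rows: times \<open>g i / root_poly x A\<close> it is the
polynomial \<open>E g i\<close>, which has no residue. Its Lagrange decomposition at the points \<open>y r\<close> is the kernel element
required by \<open>moment_det_column\<close>, and the degrees of \<open>A\<close>, \<open>B\<close> and \<open>E\<close> are such that the quotient is
monic of degree \<open>N - 1\<close> for \<open>N > 0\<close>.\<close>

lemma schur_det_column:
  fixes x y :: "'b \<Rightarrow> 'a::field"
  assumes A: "finite A" and B: "finite B" "inj_on y B" "card B = Suc (card A)"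
    and E: "degree E = N" "lead_coeff E = 1"
    and g: "\<And>i. i < N \<Longrightarrow> \<exists>h. laurent_poly E * g i = laurent_poly h"
  shows "schur_det g N (laurent_poly (root_poly y B) / laurent_poly (root_poly x A)) =
    (-1) ^ N * (\<Sum>r\<in>B. poly (root_poly x A * E) (y r) / (\<Prod>s\<in>B - {r}. y r - y s) *
      schur_det g N (laurent_poly (root_poly y (B - {r})) / laurent_poly (root_poly x A)))"
proof -
  define \<kappa> where "\<kappa> = root_poly x A * E"
  define c where "c r = poly \<kappa> (y r) / (\<Prod>s\<in>B - {r}. y r - y s)" for r
  define Z where "Z r = root_poly y (B - {r})" for r
  define P where "P = (\<Sum>r\<in>B. smult (c r) (Z r))"
  have "E \<noteq> 0" using E(2) by auto
  then have deg_\<kappa>: "degree \<kappa> = card A + N" and lead_\<kappa>: "lead_coeff \<kappa> = 1"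
    using E lead_coeff_mult[of "root_poly x A" E] lead_coeff_root_poly[of x A] unfolding \<kappa>_def
    by (simp_all add: degree_mult_eq degree_root_poly)
  obtain \<alpha> where \<alpha>: "\<kappa> = root_poly y B * \<alpha> + P"
    using lagrange_decomposition[OF B(1,2), of \<kappa>] unfolding P_def c_def Z_def root_poly_def by blast
  have deg_Z: "degree (Z r) = card A" if "r \<in> B" for r
    using that B by (simp add: Z_def degree_root_poly)
  have deg_P: "degree P \<le> card A"
    unfolding P_def using deg_Z by (intro degree_sum_le B) (metis degree_smult_le)
  show ?thesis
  proof (cases N)
    case 0
    \<comment> \<open>Both determinants are empty; the coefficients \<open>c r\<close> add up to the leading coefficient of \<open>\<kappa>\<close>.\<close>
    have "root_poly y B * \<alpha> = \<kappa> - P" using \<alpha> by (simp add: algebra_simps)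
    then have "degree (root_poly y B * \<alpha>) \<le> card A"
      using degree_diff_le[of \<kappa> "card A" P] deg_P deg_\<kappa> 0 by simp
    then have "\<alpha> = 0"
      using B(3) by (cases "\<alpha> = 0") (simp_all add: degree_mult_eq degree_root_poly)
    then have "coeff \<kappa> (card A) = coeff P (card A)" using \<alpha> by simp
    also have "\<dots> = (\<Sum>r\<in>B. c r)"
    proof -
      have "coeff (Z r) (card A) = 1" if "r \<in> B" for r
        using deg_Z[OF that] lead_coeff_root_poly[of y "B - {r}"] by (simp add: Z_def)
      then show ?thesis by (simp add: P_def coeff_sum)
    qed
    finally show ?thesis
      using lead_\<kappa> deg_\<kappa> 0 by (simp add: schur_det_def moment_det_def c_def \<kappa>_def)
  next
    case (Suc k)
    have prod: "root_poly y B * \<alpha> = \<kappa> + (- P)" using \<alpha> by (simp add: algebra_simps)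
    have "degree (- P) < degree \<kappa>" using deg_P deg_\<kappa> Suc by simp
    then have "degree (\<kappa> + (- P)) = degree \<kappa>" "coeff (- P) (degree \<kappa>) = 0"
      by (rule degree_add_eq_left, rule coeff_eq_0)
    then have deg: "degree (root_poly y B * \<alpha>) = card A + N"
      and lead: "lead_coeff (root_poly y B * \<alpha>) = 1"
      unfolding prod using deg_\<kappa> lead_\<kappa> by simp_all
    then have "\<alpha> \<noteq> 0" by auto
    then have deg_\<alpha>: "degree \<alpha> = k"
      using deg B(3) Suc by (simp add: degree_mult_eq degree_root_poly)
    have lead_\<alpha>: "lead_coeff \<alpha> = 1"
      using lead lead_coeff_root_poly[of y B] unfolding lead_coeff_mult by simp
    let ?l = "\<lambda>i q. residue (g i / laurent_poly (root_poly x A) * laurent_poly q)"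
    have kernel: "?l i (root_poly y B * \<alpha>) + (\<Sum>r\<in>B. c r * ?l i (Z r)) = 0" if "i < Suc k" for i
    proof -
      obtain h where h: "laurent_poly E * g i = laurent_poly h" using g \<open>i < Suc k\<close> Suc by auto
      have lin: "linear_functional (?l i)" by (rule linear_functional_residue)
      have "?l i (root_poly y B * \<alpha>) + (\<Sum>r\<in>B. c r * ?l i (Z r)) = ?l i \<kappa>"
        unfolding \<alpha> P_def linear_functional_sum[OF lin, symmetric]
        using lin unfolding linear_functional_def by simp
      also have "g i / laurent_poly (root_poly x A) * laurent_poly \<kappa> = laurent_poly h"
        using laurent_poly_root_poly_neq_0[OF A, of x] h by (simp add: \<kappa>_def laurent_poly_mult mult.commute)
      finally show ?thesis by (simp add: laurent_poly_nth_pos)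
    qed
    have "moment_det (Suc k) (\<lambda>i q. ?l i (root_poly y B * q)) =
        (-1) ^ Suc k * (\<Sum>r\<in>B. c r * moment_det (Suc k) (\<lambda>i q. ?l i (Z r * q)))"
      by (rule moment_det_column[where y = "\<lambda>r. - y r"])
        (rule linear_functional_residue, erule kernel, rule deg_\<alpha>, rule lead_\<alpha>,
          unfold Z_def, rule root_poly_remove[OF B(1)])
    then show ?thesis
      unfolding schur_det_def Suc c_def \<kappa>_def Z_def by (simp add: laurent_poly_mult mult_ac)
  qed
qed

section \<open>Polynomial dependence on one variable\<close>

text \<open>Identities in one of the variables are proved by comparing degrees with numbers of zeros; a function of the
variable is more convenient there than an element of \<open>'a poly\<close>.\<close>

definition polynomial_function :: "nat \<Rightarrow> ('a::comm_ring_1 \<Rightarrow> 'a) \<Rightarrow> bool" where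
  "polynomial_function d F \<longleftrightarrow> (\<exists>p. degree p \<le> d \<and> (\<forall>t. F t = poly p t))"

lemma polynomial_function_const: "polynomial_function d (\<lambda>_. c)"
  unfolding polynomial_function_def by (rule exI[of _ "[:c:]"]) simp

lemma polynomial_function_mono: "polynomial_function d F \<Longrightarrow> d \<le> e \<Longrightarrow> polynomial_function e F"
  unfolding polynomial_function_def using order_trans by blast

lemma polynomial_function_mult:
  "polynomial_function d F \<Longrightarrow> polynomial_function e G \<Longrightarrow> polynomial_function (d + e) (\<lambda>t. F t * G t)"
  unfolding polynomial_function_def by (metis poly_mult degree_mult_le add_mono order_trans)

lemma polynomial_function_add:
  "polynomial_function d F \<Longrightarrow> polynomial_function d G \<Longrightarrow> polynomial_function d (\<lambda>t. F t + G t)"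
  unfolding polynomial_function_def by (metis poly_add degree_add_le)

lemma polynomial_function_cmult: "polynomial_function d F \<Longrightarrow> polynomial_function d (\<lambda>t. c * F t)"
  using polynomial_function_mult[OF polynomial_function_const[of 0 c]] by simp

lemma polynomial_function_diff:
  "polynomial_function d F \<Longrightarrow> polynomial_function d G \<Longrightarrow> polynomial_function d (\<lambda>t. F t - G t)"
  unfolding polynomial_function_def by (metis poly_diff degree_diff_le)

lemma polynomial_function_sum:
  "(\<And>i. i \<in> A \<Longrightarrow> polynomial_function d (F i)) \<Longrightarrow> polynomial_function d (\<lambda>t. \<Sum>i\<in>A. F i t)"
  by (induction A rule: infinite_finite_induct)
    (simp_all add: polynomial_function_const polynomial_function_add)

lemma polynomial_function_prod:
  "(\<And>i. i \<in> A \<Longrightarrow> polynomial_function (d i) (F i)) \<Longrightarrow>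
    polynomial_function (\<Sum>i\<in>A. d i) (\<lambda>t. \<Prod>i\<in>A. F i t)"
  by (induction A rule: infinite_finite_induct)
    (simp_all add: polynomial_function_const polynomial_function_mult)

lemma polynomial_function_ident: "polynomial_function 1 (\<lambda>t. t)"
  unfolding polynomial_function_def by (rule exI[of _ "[:0, 1:]"]) simp

lemma polynomial_function_power: "polynomial_function d (\<lambda>t. t ^ d)"
  using polynomial_function_prod[of "{..<d}" "\<lambda>_. 1" "\<lambda>_ t. t", OF polynomial_function_ident] by simp

lemma polynomial_function_eq_0:
  fixes F :: "'a::idom \<Rightarrow> 'a"
  assumes "polynomial_function d F" "finite S" "d < card S" "\<And>t. t \<in> S \<Longrightarrow> F t = 0"
  shows "F t = 0"
proof -
  obtain p where p: "degree p \<le> d" "\<And>t. F t = poly p t"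
    using assms(1) by (auto simp: polynomial_function_def)
  have "p = 0"
    by (rule poly_eqI_degree[of S]) (use assms p in auto)
  then show ?thesis by (simp add: p)
qed

text \<open>By the residue theorem \<open>u^j / (u - t)\<close> contributes \<open>t^j\<close>, and the part of \<open>W\<close> of negative degree
in \<open>u\<close> contributes nothing.\<close>

lemma polynomial_function_residue_divide_linear:
  fixes W :: "'a::field fls"
  assumes "\<And>k. k < - int d \<Longrightarrow> fls_nth W k = 0"
  shows "polynomial_function d (\<lambda>t. residue (W / (fls_X_inv + fls_const (- t))))"
proof -
  have base: "residue (V / (fls_X_inv + fls_const (- t))) = 0" if "\<And>k. k < 1 \<Longrightarrow> fls_nth V k = 0"
    for V :: "'a fls" and t
  proof (cases "V = 0")
    case False
    have "fls_subdegree (inverse (fls_X_inv + fls_const (- t))) = 1"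
      using monic_at_inverse[OF monic_at_linear[of "- t"]] by (simp add: monic_at_iff)
    moreover have "fls_subdegree V \<ge> 1"
      using False that by (intro fls_subdegree_geI) auto
    ultimately show ?thesis
      unfolding divide_inverse by (intro fls_times_nth_eq0) simp
  qed simp
  have step: "residue (fls_X_inv ^ j / (fls_X_inv + fls_const (- t))) = t ^ j" for j and t :: 'a
    using residue_divide_root_poly[of "{()}" "\<lambda>_. t" "monom 1 j"]
    by (simp add: root_poly_def laurent_poly_linear laurent_poly_monom poly_monom del: fls_const_uminus)
  \<comment> \<open>\<open>V\<close> is the part of \<open>W\<close> of negative degree in \<open>u\<close>.\<close>
  define V where "V = W - (\<Sum>j\<le>d. fls_const (fls_nth W (- int j)) * fls_X_inv ^ j)"
  have V: "fls_nth V k = 0" if "k < 1" for k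
  proof -
    have "(\<Sum>j\<le>d. fls_nth (fls_const (fls_nth W (- int j)) * fls_X_inv ^ j) k) =
      (\<Sum>j\<le>d. if j = nat (- k) then fls_nth W k else 0)"
      using that by (intro sum.cong) auto
    also have "\<dots> = fls_nth W k"
      using that assms[of k] by (auto simp: not_le)
    finally show ?thesis by (simp add: V_def fls_nth_sum)
  qed
  have "residue (W / (fls_X_inv + fls_const (- t))) = (\<Sum>j\<le>d. fls_nth W (- int j) * t ^ j)" for t
  proof -
    have "W = V + (\<Sum>j\<le>d. fls_const (fls_nth W (- int j)) * fls_X_inv ^ j)"
      by (simp add: V_def)
    then have "W / (fls_X_inv + fls_const (- t)) = V / (fls_X_inv + fls_const (- t)) +
        (\<Sum>j\<le>d. fls_const (fls_nth W (- int j)) * (fls_X_inv ^ j / (fls_X_inv + fls_const (- t))))"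
      by (metis (no_types, lifting) add_divide_distrib sum.cong sum_divide_distrib times_divide_eq_right)
    then show ?thesis using base[OF V, of t]
      by (simp add: fls_nth_sum step del: fls_const_uminus times_divide_eq_right)
  qed
  then show ?thesis
    by (auto intro!: polynomial_function_sum polynomial_function_cmult polynomial_function_mono[OF polynomial_function_power])
qed

text \<open>All entries depend on \<open>t\<close>, but in a basis of multiples of \<open>u - t\<close>, completed by 1, only the
first column does. The degree is thus bounded by that of a single column.\<close>

lemma polynomial_function_schur_det_root:
  assumes "\<And>i k. i < N \<Longrightarrow> k < - int d \<Longrightarrow> fls_nth (W * g i) k = 0"
  shows "polynomial_function d (\<lambda>t. schur_det g N (W / (fls_X_inv + fls_const (- t))))"
proof (cases N)
  case 0
  then show ?thesis by (simp add: schur_det_def moment_det_def polynomial_function_const)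
next
  case (Suc k)
  define M where "M t = mat N N (\<lambda>(i, j). if j = 0 then residue (W * g i / (fls_X_inv + fls_const (- t)))
      else residue (W * g i * laurent_poly (monom 1 (j - 1))))" for t
  have det: "schur_det g N (W / (fls_X_inv + fls_const (- t))) = det (M t)" for t
  proof -
    let ?R = "W / (fls_X_inv + fls_const (- t))"
    have "?R * g i * laurent_poly ([:- t, 1:] * q) = W * g i * laurent_poly q" for i q
      unfolding laurent_poly_mult laurent_poly_linear by (simp del: fls_const_uminus)
    then show ?thesis
      unfolding schur_det_def M_def
      by (subst moment_det_insert_root[where c = "- t"])
        (rule linear_functional_residue,
          auto intro!: arg_cong[of _ _ det] cong_mat simp del: mult_pCons_left fls_const_uminus)
  qed
  define C where "C i = cofactor (M 0) i 0" for i
  have cof: "cofactor (M t) i 0 = C i" for t i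
  proof -
    have "mat_delete (M t) i 0 = mat_delete (M 0) i 0"
      by (intro eq_matI) (auto simp: mat_delete_def M_def)
    then show ?thesis by (simp add: cofactor_def C_def)
  qed
  have "det (M t) = (\<Sum>i<N. C i * residue (W * g i / (fls_X_inv + fls_const (- t))))" for t
  proof -
    have "det (M t) = (\<Sum>i<N. M t $$ (i, 0) * cofactor (M t) i 0)"
      by (rule laplace_expansion_column) (simp_all add: M_def Suc)
    also have "\<dots> = (\<Sum>i<N. C i * residue (W * g i / (fls_X_inv + fls_const (- t))))"
      unfolding cof by (intro sum.cong) (simp_all add: M_def mult.commute)
    finally show ?thesis .
  qed
  then show ?thesis
    unfolding det using assms
    by (auto intro!: polynomial_function_sum polynomial_function_cmult polynomial_function_residue_divide_linear
      simp del: fls_const_uminus)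
qed

text \<open>Every row is affine in \<open>t\<close>, so the degree is at most the number of rows. For a residue determinant
with as many rows as \<open>\<mu>\<close>, this is the length of the first column.\<close>

lemma polynomial_function_schur_det_pole:
  "polynomial_function N (\<lambda>t. schur_det g N (W * (fls_X_inv + fls_const t)))"
proof -
  have entry: "polynomial_function 1 (\<lambda>t. residue (W * (fls_X_inv + fls_const t) * h))" for h
  proof -
    have "residue (W * (fls_X_inv + fls_const t) * h) = residue (W * fls_X_inv * h) + t * residue (W * h)" for t
      by (simp add: distrib_left distrib_right mult.assoc)
        (metis fls_mult_const_nth(1) mult.left_commute)
    then show ?thesis
      using polynomial_function_mult[OF polynomial_function_ident polynomial_function_const[of 0 "residue (W * h)"]]
      by (auto intro!: polynomial_function_add polynomial_function_const)
  qed
  have "schur_det g N (W * (fls_X_inv + fls_const t)) =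
      (\<Sum>p\<in>{p. p permutes {0..<N}}. signof p *
        (\<Prod>i = 0..<N. residue (W * (fls_X_inv + fls_const t) * (g i * laurent_poly (monom 1 (p i))))))" for t
    unfolding schur_det_def moment_det_def
    by (subst det_def'[of _ N]) (auto intro!: sum.cong prod.cong arg_cong2[of _ _ _ _ "(*)"]
        simp: mult.assoc permutes_in_image)
  moreover have "polynomial_function N (\<lambda>t. \<Prod>i = 0..<N. residue (W * (fls_X_inv + fls_const t) * h i))" for h
    using polynomial_function_prod[of "{0..<N}" "\<lambda>_. 1", OF entry] by simp
  ultimately show ?thesis
    by (auto intro!: polynomial_function_sum polynomial_function_cmult)
qed

section \<open>Alternating sums and Vandermonde products\<close>

definition alternating_sum :: "nat \<Rightarrow> ((nat \<Rightarrow> 'a) \<Rightarrow> 'a) \<Rightarrow> (nat \<Rightarrow> 'a) \<Rightarrow> 'a::comm_ring_1" where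
  "alternating_sum n F x = (\<Sum>p | p permutes {1..n}. of_int (sign p) * F (x \<circ> p))"

text \<open>The Vandermonde product over an arbitrary ring; it will be evaluated in the field of fractions and at shifted
or permuted sequences.\<close>

definition vander :: "nat \<Rightarrow> (nat \<Rightarrow> 'a) \<Rightarrow> 'a::comm_ring_1" where
  "vander n z = (\<Prod>(i, k)\<in>{(i, k). 1 \<le> i \<and> i < k \<and> k \<le> n}. z i - z k)"

lemma alternating_sum_permute:
  assumes "q permutes {1..n}"
  shows "alternating_sum n F (x \<circ> q) = of_int (sign q) * alternating_sum n F x"
proof -
  have "alternating_sum n F x = (\<Sum>p | p permutes {1..n}. of_int (sign (q \<circ> p)) * F (x \<circ> (q \<circ> p)))"
    unfolding alternating_sum_def by (rule setum_permutations_compose_left[OF assms])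
  also have "\<dots> = (\<Sum>p | p permutes {1..n}. of_int (sign q) * (of_int (sign p) * F (x \<circ> q \<circ> p)))"
  proof (intro sum.cong refl)
    fix p assume "p \<in> {p. p permutes {1..n}}"
    then have "sign (q \<circ> p) = sign q * sign p"
      using assms by (intro sign_compose) (auto intro: permutation_permutes[THEN iffD2])
    then show "of_int (sign (q \<circ> p)) * F (x \<circ> (q \<circ> p)) =
        of_int (sign q) * (of_int (sign p) * F (x \<circ> q \<circ> p))"
      by (simp add: comp_assoc mult.assoc)
  qed
  also have "\<dots> = of_int (sign q) * alternating_sum n F (x \<circ> q)"
    by (simp add: alternating_sum_def sum_distrib_left)
  finally have "of_int (sign q) * alternating_sum n F x = of_int (sign q * sign q) * alternating_sum n F (x \<circ> q)"
    by (simp only: mult.assoc of_int_mult)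
  then show ?thesis by simp
qed

lemma alternating_sum_transpose:
  assumes "a \<in> {1..n}" "b \<in> {1..n}"
  shows "alternating_sum n F (x \<circ> transpose a b) = (if a = b then alternating_sum n F x else - alternating_sum n F x)"
  using alternating_sum_permute[OF permutes_swap_id[OF assms], of F x] by (simp add: sign_swap_id)

text \<open>A transposition of equal arguments changes the sign of the sum.\<close>

lemma alternating_sum_eq_0:
  fixes x :: "nat \<Rightarrow> 'a::idom"
  assumes "(2::'a) \<noteq> 0" "i \<in> {1..n}" "j \<in> {1..n}" "i \<noteq> j" "x i = x j"
  shows "alternating_sum n F x = 0"
proof -
  have "x \<circ> transpose i j = x"
    using assms by (auto simp: fun_eq_iff transpose_def)
  then have "alternating_sum n F x = - alternating_sum n F x"
    using alternating_sum_transpose[OF assms(2,3), of F x] assms by simp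
  then have "2 * alternating_sum n F x = 0" by simp
  with assms(1) show ?thesis by simp
qed

lemma alternating_sum_cong: "(\<And>p. p permutes {1..n} \<Longrightarrow> F (x \<circ> p) = G (x \<circ> p)) \<Longrightarrow> alternating_sum n F x = alternating_sum n G x"
  unfolding alternating_sum_def by (intro sum.cong) auto

lemma alternating_sum_cmult: "alternating_sum n (\<lambda>z. c * F z) x = c * alternating_sum n F x"
  unfolding alternating_sum_def by (simp add: sum_distrib_left mult.left_commute)

lemma alternating_sum_swap: "alternating_sum n (\<lambda>z. alternating_sum n (\<lambda>w. F z w) y) x = alternating_sum n (\<lambda>w. alternating_sum n (\<lambda>z. F z w) x) y"
  unfolding alternating_sum_def sum_distrib_left by (subst sum.swap) (simp add: mult.left_commute)

lemma sum_permutes_shift: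
  "(\<Sum>q | q permutes {2..Suc k}. of_int (sign q) * F (q \<circ> Suc)) =
    (\<Sum>p | p permutes {1..k}. of_int (sign p) * (F (Suc \<circ> p) :: 'a::comm_ring_1))"
proof (rule sum.reindex_bij_witness[where
    i = "map_permutation {1..k} Suc" and j = "map_permutation {2..Suc k} (\<lambda>i. i - 1)"])
  have bij: "bij_betw Suc {1..k} {2..Suc k}"
    by (rule bij_betwI[of _ _ _ "\<lambda>i. i - 1"]) auto
  have bij': "bij_betw (\<lambda>i. i - 1) {2..Suc k} {1..k}"
    by (rule bij_betwI[of _ _ _ Suc]) auto
  show "map_permutation {2..Suc k} (\<lambda>i. i - 1) (map_permutation {1..k} Suc p) = p"
    if "p \<in> {p. p permutes {1..k}}" for p
    using map_permutation_compose_inv[OF bij, of p "\<lambda>i. i - 1"] that by simp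
  show "map_permutation {1..k} Suc p \<in> {q. q permutes {2..Suc k}}"
    if "p \<in> {p. p permutes {1..k}}" for p
    using map_permutation_permutes[OF bij] that by simp
  fix q assume q: "q \<in> {q. q permutes {2..Suc k}}"
  show "map_permutation {1..k} Suc (map_permutation {2..Suc k} (\<lambda>i. i - 1) q) = q"
    using map_permutation_compose_inv[OF bij', of q Suc] q by simp
  show "map_permutation {2..Suc k} (\<lambda>i. i - 1) q \<in> {p. p permutes {1..k}}"
    using map_permutation_permutes[OF bij'] q by simp
  have "Suc (map_permutation {2..Suc k} (\<lambda>i. i - 1) q i) = q (Suc i)" for i
  proof (cases "i \<in> {1..k}")
    case True
    then have "Suc i \<in> {2..Suc k}" by auto
    then have "q (Suc i) \<in> {2..Suc k}" using q permutes_in_image[of q] by blast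
    moreover have "map_permutation {2..Suc k} (\<lambda>i. i - 1) q (Suc i - 1) = q (Suc i) - 1"
      using \<open>Suc i \<in> {2..Suc k}\<close> bij' q by (intro map_permutation_apply) (auto simp: bij_betw_def)
    ultimately show ?thesis by simp
  next
    case False
    then have "Suc i \<notin> {2..Suc k}" by auto
    then have "q (Suc i) = Suc i" using q by (simp add: permutes_not_in)
    moreover have "map_permutation {2..Suc k} (\<lambda>i. i - 1) q i = i"
      using permutes_not_in[OF map_permutation_permutes[OF bij']] q False by blast
    ultimately show ?thesis by simp
  qed
  then have "Suc \<circ> map_permutation {2..Suc k} (\<lambda>i. i - 1) q = q \<circ> Suc" by (simp add: fun_eq_iff)
  moreover have "sign (map_permutation {2..Suc k} (\<lambda>i. i - 1) q) = sign q"
    using q bij' by (intro sign_map_permutation) (auto simp: bij_betw_def)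
  ultimately show "of_int (sign (map_permutation {2..Suc k} (\<lambda>i. i - 1) q)) *
      F (Suc \<circ> map_permutation {2..Suc k} (\<lambda>i. i - 1) q) = of_int (sign q) * F (q \<circ> Suc)"
    by simp
qed

text \<open>The permutations are sorted by the element \<open>b\<close> that is moved to place 1. Each is the transposition of
1 and \<open>b\<close> after a permutation of \<open>{2..Suc k}\<close>.\<close>

lemma alternating_sum_first:
  "alternating_sum (Suc k) (\<lambda>z. F (z 1) (z \<circ> Suc)) x =
    (\<Sum>b=1..Suc k. of_int (sign (transpose 1 b)) * alternating_sum k (F (x b)) (x \<circ> transpose 1 b \<circ> Suc))"
proof -
  have ins: "{1..Suc k} = insert 1 {2..Suc k}" by auto
  have "alternating_sum (Suc k) (\<lambda>z. F (z 1) (z \<circ> Suc)) x =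
    (\<Sum>b=1..Suc k. \<Sum>q | q permutes {2..Suc k}. of_int (sign (transpose 1 b \<circ> q)) *
      F (x (transpose 1 b (q 1))) (x \<circ> (transpose 1 b \<circ> q) \<circ> Suc))"
    unfolding alternating_sum_def ins by (subst sum_over_permutations_insert) simp_all
  also have "\<dots> = (\<Sum>b=1..Suc k. of_int (sign (transpose 1 b)) * (\<Sum>q | q permutes {2..Suc k}.
      of_int (sign q) * F (x b) (x \<circ> transpose 1 b \<circ> (q \<circ> Suc))))"
    unfolding sum_distrib_left
  proof (intro sum.cong refl)
    fix b q assume "b \<in> {1..Suc k}" "q \<in> {q. q permutes {2..Suc k}}"
    then have q: "q permutes {2..Suc k}" by simp
    have "sign (transpose 1 b \<circ> q) = sign (transpose 1 b) * sign q"
      using q by (intro sign_compose) (auto intro: permutation_permutes[THEN iffD2] permutation_swap_id)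
    moreover have "q 1 = 1" using q by (auto intro: permutes_not_in)
    ultimately show "of_int (sign (transpose 1 b \<circ> q)) *
        F (x (transpose 1 b (q 1))) (x \<circ> (transpose 1 b \<circ> q) \<circ> Suc) =
      of_int (sign (transpose 1 b)) * (of_int (sign q) * F (x b) (x \<circ> transpose 1 b \<circ> (q \<circ> Suc)))"
      by (simp add: comp_assoc mult.assoc)
  qed
  also have "\<dots> = (\<Sum>b=1..Suc k. of_int (sign (transpose 1 b)) * alternating_sum k (F (x b)) (x \<circ> transpose 1 b \<circ> Suc))"
    unfolding alternating_sum_def sum_permutes_shift[of "\<lambda>q. F (x _) (x \<circ> transpose 1 _ \<circ> q)" k]
    by (simp add: comp_assoc)
  finally show ?thesis .
qed

lemma finite_pairs [simp]: "finite {(i, k). Suc 0 \<le> i \<and> i < k \<and> k \<le> n}"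
  by (rule finite_subset[of _ "{1..n} \<times> {1..n}"]) auto

lemma vander_adjacent:
  assumes "1 \<le> j" "Suc j \<le> n"
  shows "vander n (z \<circ> transpose j (Suc j)) = - vander n z"
proof -
  let ?s = "transpose j (Suc j)"
  let ?P = "{(i, k). 1 \<le> i \<and> i < k \<and> k \<le> n}"
  let ?Q = "?P - {(j, Suc j)}"
  have split: "vander n w = (w j - w (Suc j)) * (\<Prod>(i, k)\<in>?Q. w i - w k)" for w :: "nat \<Rightarrow> 'a"
    unfolding vander_def using assms by (subst prod.remove[of _ "(j, Suc j)"]) auto
  have maps: "(?s i, ?s k) \<in> ?Q" if "(i, k) \<in> ?Q" for i k
    using that assms by (auto simp: transpose_def split: if_splits)
  have "(\<Prod>(i, k)\<in>?Q. (z \<circ> ?s) i - (z \<circ> ?s) k) = (\<Prod>(i, k)\<in>?Q. z i - z k)"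
    by (rule prod.reindex_bij_witness[where i = "\<lambda>(i, k). (?s i, ?s k)" and j = "\<lambda>(i, k). (?s i, ?s k)"])
      (use maps in force)+
  then show ?thesis
    unfolding split[of "z \<circ> ?s"] split[of z] by (simp add: algebra_simps)
qed

text \<open>Adjacent transpositions exchange the factors, except for one which changes its sign; they generate all
transpositions.\<close>

lemma vander_transpose:
  assumes "a \<in> {1..n}" "b \<in> {1..n}"
  shows "vander n (z \<circ> transpose a b) = of_int (sign (transpose a b)) * vander n z"
proof -
  have less: "vander n (z \<circ> transpose a b) = - vander n z" if "1 \<le> a" "a < b" "b \<le> n" for a b z
    using that
  proof (induction b arbitrary: z)
    case (Suc b)
    show ?case
    proof (cases "a = b")
      case True
      then show ?thesis using vander_adjacent[of b n z] Suc.prems by (simp only: One_nat_def)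
    next
      case False
      then have "transpose a (Suc b) = transpose b (Suc b) \<circ> transpose a b \<circ> transpose b (Suc b)"
        using Suc.prems by (auto simp: fun_eq_iff transpose_def)
      then have "z \<circ> transpose a (Suc b) =
          z \<circ> transpose b (Suc b) \<circ> transpose a b \<circ> transpose b (Suc b)"
        by (simp only: comp_assoc)
      moreover have "a < b" "b \<le> n" "1 \<le> b" "Suc b \<le> n" using False Suc.prems by auto
      ultimately show ?thesis
        using Suc.prems(1) by (simp only: vander_adjacent Suc.IH minus_minus)
    qed
  qed simp
  show ?thesis
    using assms less[of a b z] less[of b a z]
    by (cases a b rule: linorder_cases) (auto simp: sign_swap_id transpose_commute)
qed

lemma vander_first: "vander (Suc n) z = (\<Prod>k=1..n. z 1 - z (Suc k)) * vander n (z \<circ> Suc)"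
proof -
  let ?A = "(\<lambda>k. (1, Suc k)) ` {1..n}" and ?B = "(\<lambda>(i, k). (Suc i, Suc k)) ` {(i, k). 1 \<le> i \<and> i < k \<and> k \<le> n}"
  have "{(i, k). 1 \<le> i \<and> i < k \<and> k \<le> Suc n} = ?A \<union> ?B"
  proof (intro equalityI subrelI)
    fix i k assume "(i, k) \<in> {(i, k). 1 \<le> i \<and> i < k \<and> k \<le> Suc n}"
    then show "(i, k) \<in> ?A \<union> ?B"
      by (cases i; cases k) (auto simp: image_iff)
  qed auto
  then have "vander (Suc n) z = (\<Prod>(i, k)\<in>?A \<union> ?B. z i - z k)"
    by (simp add: vander_def)
  also have "\<dots> = (\<Prod>(i, k)\<in>?A. z i - z k) * (\<Prod>(i, k)\<in>?B. z i - z k)"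
    by (rule prod.union_disjoint) auto
  also have "(\<Prod>(i, k)\<in>?A. z i - z k) = (\<Prod>k=1..n. z 1 - z (Suc k))"
    by (subst prod.reindex) (auto simp: inj_on_def)
  also have "(\<Prod>(i, k)\<in>?B. z i - z k) = vander n (z \<circ> Suc)"
    unfolding vander_def by (subst prod.reindex) (auto simp: inj_on_def case_prod_beta)
  finally show ?thesis .
qed

lemma vander_last: "vander (Suc n) z = vander n z * (\<Prod>i=1..n. z i - z (Suc n))"
proof -
  let ?P = "{(i, k). 1 \<le> i \<and> i < k \<and> k \<le> n}"
  have "{(i, k). 1 \<le> i \<and> i < k \<and> k \<le> Suc n} = ?P \<union> (\<lambda>i. (i, Suc n)) ` {1..n}"
    by (auto simp: le_Suc_eq)
  then have "vander (Suc n) z = (\<Prod>(i, k)\<in>?P \<union> (\<lambda>i. (i, Suc n)) ` {1..n}. z i - z k)"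
    by (simp add: vander_def)
  also have "\<dots> = vander n z * (\<Prod>(i, k)\<in>(\<lambda>i. (i, Suc n)) ` {1..n}. z i - z k)"
    unfolding vander_def by (rule prod.union_disjoint) auto
  also have "(\<Prod>(i, k)\<in>(\<lambda>i. (i, Suc n)) ` {1..n}. z i - z k) = (\<Prod>i=1..n. z i - z (Suc n))"
    by (subst prod.reindex) (auto simp: inj_on_def)
  finally show ?thesis .
qed

lemma vander_cong: "(\<And>i. i \<in> {1..n} \<Longrightarrow> z i = w i) \<Longrightarrow> vander n z = vander n w"
  unfolding vander_def by (intro prod.cong) auto

text \<open>Moving \<open>x b\<close> to place 1 and dropping this place leaves the other \<open>x q\<close>, up to their order.\<close>

lemma prod_transpose_Suc:
  assumes "b \<in> {1..Suc k}"
  shows "(\<Prod>i=1..k. h ((x \<circ> transpose 1 b \<circ> Suc) i)) = (\<Prod>q\<in>{1..Suc k} - {b}. h (x q) :: 'a::comm_monoid_mult)"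
proof (rule prod.reindex_bij_witness[where i = "\<lambda>q. transpose 1 b q - 1" and j = "\<lambda>i. transpose 1 b (Suc i)"])
qed (use assms in \<open>auto simp: transpose_def split: if_splits\<close>)

section \<open>The terms of the Sergeev-Pragacz sum\<close>

text \<open>The lengths of the rows and the columns of one diagram, numbered from 1. In this form the two functions have
symmetric roles, and the removal of a hook is a shift of both.\<close>

definition conjugate :: "(nat \<Rightarrow> nat) \<Rightarrow> (nat \<Rightarrow> nat) \<Rightarrow> bool" where
  "conjugate m m' \<longleftrightarrow> (\<forall>i\<ge>1. \<forall>j\<ge>1. j \<le> m i \<longleftrightarrow> i \<le> m' j)"

text \<open>The contribution of the \<open>i\<close>-th variable to \<open>f\<^sub>\<mu>\<^sub>;\<^sub>a\<close> apart from the binomials. The condition \<open>i \<le> m i\<close>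
says that row \<open>i\<close> meets the diagonal, that is \<open>i \<le> d\<close>.\<close>

definition row_factor :: "nat \<Rightarrow> (nat \<Rightarrow> nat) \<Rightarrow> (int \<Rightarrow> 'a) \<Rightarrow> nat \<Rightarrow> 'a \<Rightarrow> 'a::comm_ring_1" where
  "row_factor n m a i t = (if i \<le> m i then (\<Prod>l=1..m i - i. t - a (int l)) * t ^ (n - m i) else t ^ (n - i))"

definition squares :: "nat \<Rightarrow> (nat \<Rightarrow> nat) \<Rightarrow> (nat \<times> nat) set" where
  "squares n m = {(i, j). i \<in> {1..n} \<and> j \<in> {1..n} \<and> j \<le> m i}"

text \<open>The polynomial \<open>f\<^sub>\<mu>\<^sub>;\<^sub>a\<close> over an arbitrary ring, with \<open>b\<close> in the role of the dual parameter sequence.\<close>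

definition sp_term :: "nat \<Rightarrow> (nat \<Rightarrow> nat) \<Rightarrow> (nat \<Rightarrow> nat) \<Rightarrow> (int \<Rightarrow> 'a) \<Rightarrow> (int \<Rightarrow> 'a) \<Rightarrow>
    (nat \<Rightarrow> 'a) \<Rightarrow> (nat \<Rightarrow> 'a) \<Rightarrow> 'a::comm_ring_1" where
  "sp_term n m m' a b x y = (\<Prod>i=1..n. row_factor n m a i (x i)) *
     (\<Prod>j=1..n. row_factor n m' b j (y j)) * (\<Prod>(i, j)\<in>squares n m. x i + y j)"

definition sp_sum :: "nat \<Rightarrow> (nat \<Rightarrow> nat) \<Rightarrow> (nat \<Rightarrow> nat) \<Rightarrow> (int \<Rightarrow> 'a) \<Rightarrow> (int \<Rightarrow> 'a) \<Rightarrow>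
    (nat \<Rightarrow> 'a) \<Rightarrow> (nat \<Rightarrow> 'a) \<Rightarrow> 'a::comm_ring_1" where
  "sp_sum n m m' a b x y = alternating_sum n (\<lambda>z. alternating_sum n (\<lambda>w. sp_term n m m' a b z w) y) x"

lemma conjugate_sym: "conjugate m m' \<Longrightarrow> conjugate m' m"
  unfolding conjugate_def by blast

lemma conjugateD: "conjugate m m' \<Longrightarrow> 1 \<le> i \<Longrightarrow> 1 \<le> j \<Longrightarrow> j \<le> m i \<longleftrightarrow> i \<le> m' j"
  unfolding conjugate_def by blast

lemma conjugate_antimono:
  assumes "conjugate m m'" "1 \<le> i" "i \<le> k" shows "m k \<le> m i"
proof (cases "m k")
  case (Suc j)
  then have "k \<le> m' (m k)" using conjugateD[OF assms(1), of k "m k"] assms by simp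
  then show ?thesis using conjugateD[OF assms(1), of i "m k"] assms Suc by simp
qed simp

lemma conjugate_diag:
  assumes "conjugate m m'" "m (Suc n) \<le> n" shows "m' (Suc n) \<le> n"
  using conjugateD[OF assms(1), of "Suc n" "Suc n"] assms(2) by auto

lemma finite_squares [simp]: "finite (squares n m)"
  unfolding squares_def by (rule finite_subset[of _ "{1..n} \<times> {1..n}"]) auto

lemma prod_squares:
  "(\<Prod>(i, j)\<in>squares n m. f i j) = (\<Prod>i=1..n. \<Prod>j=1..n. if j \<le> m i then f i j else 1)"
proof -
  have "squares n m = {e \<in> {1..n} \<times> {1..n}. snd e \<le> m (fst e)}"
    by (auto simp: squares_def)
  then have "(\<Prod>(i, j)\<in>squares n m. f i j) =
      (\<Prod>e\<in>{1..n} \<times> {1..n}. if snd e \<le> m (fst e) then f (fst e) (snd e) else 1)"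
    by (simp add: prod.inter_filter case_prod_beta)
  then show ?thesis by (simp add: prod.cartesian_product case_prod_beta)
qed

lemma sp_term_swap:
  assumes "conjugate m m'"
  shows "sp_term n m m' a b x y = sp_term n m' m b a y x"
proof -
  have "(\<Prod>(i, j)\<in>squares n m. x i + y j) = (\<Prod>(j, i)\<in>squares n m'. y j + x i)"
    by (rule prod.reindex_bij_witness[where i = prod.swap and j = prod.swap])
      (use conjugateD[OF assms] in \<open>auto simp: squares_def add.commute\<close>)
  then show ?thesis by (simp add: sp_term_def mult_ac)
qed

lemma sp_sum_swap:
  assumes "conjugate m m'"
  shows "sp_sum n m m' a b x y = sp_sum n m' m b a y x"
  unfolding sp_sum_def sp_term_swap[OF assms, of n a b] by (rule alternating_sum_swap)

lemma sp_sum_transpose_x: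
  assumes "i \<in> {1..n}" "j \<in> {1..n}"
  shows "sp_sum n m m' a b (x \<circ> transpose i j) y = of_int (sign (transpose i j)) * sp_sum n m m' a b x y"
  unfolding sp_sum_def by (rule alternating_sum_permute[OF permutes_swap_id[OF assms]])

lemma sp_sum_transpose_y:
  assumes "i \<in> {1..n}" "j \<in> {1..n}" "conjugate m m'"
  shows "sp_sum n m m' a b x (y \<circ> transpose i j) = of_int (sign (transpose i j)) * sp_sum n m m' a b x y"
  unfolding sp_sum_swap[OF assms(3)] by (rule sp_sum_transpose_x[OF assms(1,2)])

section \<open>Degrees in the Sergeev-Pragacz sum\<close>

lemma polynomial_function_linear:
  "polynomial_function (Suc 0) (\<lambda>t. t + c)" "polynomial_function (Suc 0) (\<lambda>t. c + t)"
  "polynomial_function (Suc 0) (\<lambda>t. t - c)" "polynomial_function (Suc 0) (\<lambda>t. c - t)"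
  using polynomial_function_ident
  by (auto intro!: polynomial_function_add polynomial_function_diff polynomial_function_const)

lemma polynomial_function_row_factor:
  "polynomial_function (if i \<le> m i then max n (m i) - i else n - i) (row_factor n m a i)"
proof (cases "i \<le> m i")
  case True
  have prod: "polynomial_function (m i - i) (\<lambda>t. \<Prod>l=1..m i - i. t - a (int l))"
    using polynomial_function_prod[of "{1..m i - i}" "\<lambda>_. Suc 0" "\<lambda>l t. t - a (int l)",
      OF polynomial_function_linear(3)] by simp
  have "polynomial_function (m i - i + (n - m i)) (row_factor n m a i)"
    using polynomial_function_mult[OF prod polynomial_function_power[of "n - m i"]] True
    unfolding row_factor_def by (simp only: if_True)
  with True show ?thesis by (auto elim!: polynomial_function_mono)
next
  case False
  then show ?thesis unfolding row_factor_def by (simp add: polynomial_function_power)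
qed

lemma polynomial_function_uminus:
  assumes "polynomial_function d F" shows "polynomial_function d (\<lambda>t. F (- t))"
proof -
  obtain p where p: "degree p \<le> d" "\<And>t. F t = poly p t"
    using assms by (auto simp: polynomial_function_def)
  have "degree (pcompose p [:0, -1:]) \<le> d"
    using degree_pcompose_le[of p "[:0, -1:]"] p(1) by simp
  then show ?thesis
    unfolding polynomial_function_def by (intro exI[of _ "pcompose p [:0, -1:]"]) (simp add: p poly_pcompose)
qed

lemma card_squares_row: "i \<in> {1..n} \<Longrightarrow> (\<Sum>e\<in>squares n m. if fst e = i then 1 else 0) = min n (m i)"
proof -
  assume i: "i \<in> {1..n}"
  have "(\<Sum>e\<in>squares n m. if fst e = i then 1 else 0) = card (squares n m \<inter> {e. fst e = i})"
    by (simp add: sum.If_cases)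
  also have "squares n m \<inter> {e. fst e = i} = {i} \<times> {1..min n (m i)}"
    using i by (auto simp: squares_def)
  finally show ?thesis by simp
qed

lemma card_squares_column:
  assumes "conjugate m m'" "j \<in> {1..n}"
  shows "(\<Sum>e\<in>squares n m. if snd e = j then 1 else 0) = min n (m' j)"
proof -
  have "(\<Sum>e\<in>squares n m. if snd e = j then 1 else 0) = card (squares n m \<inter> {e. snd e = j})"
    by (simp add: sum.If_cases)
  also have "squares n m \<inter> {e. snd e = j} = {1..min n (m' j)} \<times> {j}"
    using conjugateD[OF assms(1)] assms(2) by (auto simp: squares_def)
  finally show ?thesis by simp
qed

lemma polynomial_function_prod_row_factor:
  assumes "i \<in> {1..n}"
  shows "polynomial_function (if i \<le> m i then max n (m i) - i else n - i)
    (\<lambda>t. \<Prod>k=1..n. row_factor n m a k ((x(i := t)) k))"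
proof -
  have "(\<Prod>k=1..n. row_factor n m a k ((x(i := t)) k)) =
      row_factor n m a i t * (\<Prod>k\<in>{1..n} - {i}. row_factor n m a k (x k))" for t
    using assms by (subst prod.remove[of _ i]) (auto intro!: prod.cong)
  then show ?thesis
    using polynomial_function_mult[OF polynomial_function_row_factor polynomial_function_const[of 0], of i m n a]
    by simp
qed

text \<open>Row \<open>i\<close> contributes \<open>max n (m i) - i\<close> from its generalized power and \<open>min n (m i)\<close> from the binomials.\<close>

lemma polynomial_function_sp_term:
  assumes "i \<in> {1..n}"
  shows "polynomial_function (n - i + m i) (\<lambda>t. sp_term n m m' a b (x(i := t)) y)"
proof -
  let ?d = "if i \<le> m i then max n (m i) - i else n - i"
  have "polynomial_function (\<Sum>e\<in>squares n m. if fst e = i then 1 else 0)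
      (\<lambda>t. \<Prod>e\<in>squares n m. (x(i := t)) (fst e) + y (snd e))"
    by (rule polynomial_function_prod) (auto simp: polynomial_function_linear polynomial_function_const)
  then have "polynomial_function (?d + 0 + min n (m i)) (\<lambda>t. sp_term n m m' a b (x(i := t)) y)"
    unfolding sp_term_def card_squares_row[OF assms] case_prod_beta
    by (intro polynomial_function_mult polynomial_function_prod_row_factor assms polynomial_function_const)
  then show ?thesis by (rule polynomial_function_mono) (use assms in auto)
qed

text \<open>For \<open>(i, j)\<close> outside the diagram, \<open>m i \<le> j - 1\<close> and \<open>m' j \<le> i - 1\<close>. The sum
\<open>(n - i + m i) + (n - j + m' j)\<close> of the degrees in the two variables is then at most
\<open>2 (n - 1)\<close>.\<close>

lemma polynomial_function_sp_term_diagonal: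
  assumes "conjugate m m'" "i \<in> {1..n}" "j \<in> {1..n}" "m i < j"
  shows "polynomial_function (2 * (n - 1)) (\<lambda>t. sp_term n m m' a b (x(i := t)) (y(j := - t)))"
proof -
  have m': "m' j < i" using conjugateD[OF assms(1), of i j] assms by auto
  let ?d = "if i \<le> m i then max n (m i) - i else n - i"
  let ?e = "if j \<le> m' j then max n (m' j) - j else n - j"
  have "polynomial_function (\<Sum>e\<in>squares n m. (if fst e = i then 1 else 0) + (if snd e = j then 1 else 0))
      (\<lambda>t. \<Prod>e\<in>squares n m. (x(i := t)) (fst e) + (y(j := - t)) (snd e))"
  proof (rule polynomial_function_prod)
    fix e assume "e \<in> squares n m"
    then have "\<not> (fst e = i \<and> snd e = j)" using assms by (auto simp: squares_def)
    then show "polynomial_function ((if fst e = i then 1 else 0) + (if snd e = j then 1 else 0))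
        (\<lambda>t. (x(i := t)) (fst e) + (y(j := - t)) (snd e))"
      by (auto simp: polynomial_function_linear polynomial_function_const)
  qed
  then have sq: "polynomial_function (min n (m i) + min n (m' j))
      (\<lambda>t. \<Prod>(k, l)\<in>squares n m. (x(i := t)) k + (y(j := - t)) l)"
    unfolding sum.distrib card_squares_row[OF assms(2)] card_squares_column[OF assms(1,3)] case_prod_beta .
  have "polynomial_function (?d + ?e + (min n (m i) + min n (m' j)))
      (\<lambda>t. sp_term n m m' a b (x(i := t)) (y(j := - t)))"
    unfolding sp_term_def
    by (intro polynomial_function_mult sq polynomial_function_prod_row_factor assms
        polynomial_function_uminus[OF polynomial_function_prod_row_factor[OF assms(3)]])
  then show ?thesis by (rule polynomial_function_mono) (use assms m' in auto)
qed

lemma sp_term_eq_0: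
  assumes "i \<in> {1..n}" "j \<in> {1..n}" "j \<le> m i" "x i + y j = 0"
  shows "sp_term n m m' a b x y = 0"
proof -
  have "(i, j) \<in> squares n m" using assms by (simp add: squares_def)
  then have "(\<Prod>(i, j)\<in>squares n m. x i + y j) = 0"
    using assms(4) by (intro prod_zero finite_squares) (auto intro!: bexI[of _ "(i, j)"])
  then show ?thesis by (simp add: sp_term_def)
qed

lemma update_comp_permutes:
  assumes "p permutes S"
  shows "x(k := t) \<circ> p = (x \<circ> p)(inv_into UNIV p k := t)"
  using assms by (auto simp: fun_eq_iff permutes_inverses permutes_inv_eq)

text \<open>The bound \<open>n - i + m i\<close> for the variable at place \<open>i\<close> is largest for \<open>i = 1\<close>.\<close>

lemma polynomial_function_sp_sum:
  assumes "conjugate m m'" "k \<in> {1..n}"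
  shows "polynomial_function (n - 1 + m 1) (\<lambda>t. sp_sum n m m' a b (x(k := t)) y)"
proof -
  have "polynomial_function (n - 1 + m 1) (\<lambda>t. sp_term n m m' a b (x(k := t) \<circ> p) (y \<circ> q))"
    if p: "p permutes {1..n}" for p q
  proof -
    let ?i = "inv_into UNIV p k"
    have i: "?i \<in> {1..n}"
      using permutes_in_image[OF permutes_inv[OF p]] assms by blast
    have "polynomial_function (n - ?i + m ?i) (\<lambda>t. sp_term n m m' a b (x(k := t) \<circ> p) (y \<circ> q))"
      unfolding update_comp_permutes[OF p] by (rule polynomial_function_sp_term[OF i])
    then show ?thesis
      using conjugate_antimono[OF assms(1), of 1 ?i] i
      by (auto elim!: polynomial_function_mono)
  qed
  then show ?thesis
    unfolding sp_sum_def alternating_sum_def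
    by (intro polynomial_function_sum polynomial_function_cmult) auto
qed

section \<open>The cancellation property\<close>

text \<open>A zero \<open>x i\<close> at a place before the last kills the power of \<open>x i\<close> in the term, unless \<open>n \<le> m i\<close>; in that
case the square \<open>(i, j)\<close> belongs to the diagram, and the binomial for it vanishes.\<close>

lemma sp_term_vanishes_at_0:
  fixes x y :: "nat \<Rightarrow> 'a::comm_ring_1"
  assumes "x i = 0" "i \<in> {1..k}" "y j = 0" "j \<in> {1..Suc k}"
  shows "sp_term (Suc k) m m' a b x y = 0"
proof (cases "i \<le> m i \<and> Suc k \<le> m i")
  case True
  then show ?thesis using assms by (intro sp_term_eq_0[of i _ j]) auto
next
  case False
  then have "row_factor (Suc k) m a i (x i) = 0"
    using assms by (auto simp: row_factor_def power_0_left)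
  then have "(\<Prod>i=1..Suc k. row_factor (Suc k) m a i (x i)) = 0"
    using assms(2) by (intro prod_zero bexI[of _ i]) auto
  then show ?thesis by (simp add: sp_term_def)
qed

text \<open>Passing from \<open>k\<close> to \<open>k + 1\<close> variables adds a factor \<open>t\<close> to row \<open>i\<close>: in the explicit power if the row is
short, and otherwise in the new binomial \<open>x i + y (k + 1)\<close>, taken at \<open>y (k + 1) = 0\<close>.\<close>

lemma row_factor_Suc:
  "i \<le> k \<Longrightarrow> row_factor (Suc k) m a i t * (if Suc k \<le> m i then t else 1) = t * row_factor k m a i t"
  by (auto simp: row_factor_def Suc_diff_le not_le)

lemma sp_term_last_0:
  assumes "conjugate m m'" "m (Suc k) \<le> k" "x (Suc k) = 0" "y (Suc k) = 0"
  shows "sp_term (Suc k) m m' a b x y = (\<Prod>i=1..k. x i * y i) * sp_term k m m' a b x y"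
proof -
  let ?n = "Suc k"
  have m': "m' ?n \<le> k" using assms conjugate_diag by blast
  have row: "(\<Prod>i=1..?n. row_factor ?n m a i (x i)) * (\<Prod>i=1..k. if ?n \<le> m i then x i else 1) =
      (\<Prod>i=1..k. x i) * (\<Prod>i=1..k. row_factor k m a i (x i))"
    if "m ?n \<le> k" for m a and x :: "nat \<Rightarrow> 'a"
    using that row_factor_Suc[of _ k m a]
    by (simp add: prod.distrib[symmetric] row_factor_def[of ?n m a ?n])
  have "(\<Prod>(i, j)\<in>squares ?n m. x i + y j) =
      (\<Prod>i=1..k. (\<Prod>j=1..k. if j \<le> m i then x i + y j else 1) * (if ?n \<le> m i then x i else 1)) *
      (\<Prod>j=1..k. if ?n \<le> m' j then y j else 1)"
    unfolding prod_squares using assms(2-) m' conjugateD[OF assms(1), of ?n]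
    by (simp add: prod.nat_ivl_Suc' mult.commute cong: if_cong)
  also have "\<dots> = (\<Prod>(i, j)\<in>squares k m. x i + y j) * (\<Prod>i=1..k. if ?n \<le> m i then x i else 1) *
      (\<Prod>j=1..k. if ?n \<le> m' j then y j else 1)"
    unfolding prod_squares prod.distrib ..
  finally have "sp_term ?n m m' a b x y =
      ((\<Prod>i=1..?n. row_factor ?n m a i (x i)) * (\<Prod>i=1..k. if ?n \<le> m i then x i else 1)) *
      ((\<Prod>i=1..?n. row_factor ?n m' b i (y i)) * (\<Prod>i=1..k. if ?n \<le> m' i then y i else 1)) *
      (\<Prod>(i, j)\<in>squares k m. x i + y j)"
    by (simp only: sp_term_def mult_ac)
  also have "\<dots> = (\<Prod>i=1..k. x i * y i) * sp_term k m m' a b x y"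
    unfolding row[where m = m, OF assms(2)] row[where m = m', OF m'] by (simp only: sp_term_def prod.distrib mult_ac)
  finally show ?thesis .
qed

text \<open>The positions of all zeros used in the degree arguments are distinct at such a point. It is made of
independent variables in the application.\<close>

definition generic_point :: "nat \<Rightarrow> (nat \<Rightarrow> 'a) \<Rightarrow> (nat \<Rightarrow> 'a::field) \<Rightarrow> bool" where
  "generic_point n x y \<longleftrightarrow> inj_on x {1..n} \<and> inj_on y {1..n} \<and>
     (\<forall>i\<in>{1..n}. x i \<noteq> 0 \<and> y i \<noteq> 0) \<and> (\<forall>i\<in>{1..n}. \<forall>j\<in>{1..n}. x i + y j \<noteq> 0)"

text \<open>Only permutations that leave the two zeros in the last places contribute.\<close>

lemma sp_sum_at_0:
  fixes x y :: "nat \<Rightarrow> 'a::comm_ring_1"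
  assumes "conjugate m m'" "m (Suc k) \<le> k"
  shows "sp_sum (Suc k) m m' a b (x(Suc k := 0)) (y(Suc k := 0)) =
    (\<Prod>i=1..k. x i * y i) * sp_sum k m m' a b x y"
proof -
  let ?n = "Suc k"
  let ?x = "x(?n := 0)" and ?y = "y(?n := 0)"
  have drop: "(\<Sum>p | p permutes {1..?n}. f p) = (\<Sum>p | p permutes {1..k}. f p)"
    if f: "\<And>p. p permutes {1..?n} \<Longrightarrow> inv_into UNIV p ?n \<noteq> ?n \<Longrightarrow> f p = 0" for f :: "_ \<Rightarrow> 'a"
  proof (rule sum.mono_neutral_right)
    show "{p. p permutes {1..k}} \<subseteq> {p. p permutes {1..?n}}"
      by (auto elim!: permutes_subset)
    show "\<forall>p\<in>{p. p permutes {1..?n}} - {p. p permutes {1..k}}. f p = 0"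
    proof
      fix p assume p: "p \<in> {p. p permutes {1..?n}} - {p. p permutes {1..k}}"
      have "p ?n \<noteq> ?n"
      proof
        assume "p ?n = ?n"
        then have "p permutes {1..k}"
          using p by (metis DiffD1 DiffD2 atLeastAtMost_iff le_SucE mem_Collect_eq permutes_superset)
        with p show False by simp
      qed
      then show "f p = 0" using p by (intro f) (auto simp: permutes_inv_eq)
    qed
  qed (simp add: finite_permutations)
  have inv_in: "inv_into UNIV p ?n \<in> {1..k}" if "p permutes {1..?n}" "inv_into UNIV p ?n \<noteq> ?n" for p
    using permutes_in_image[OF permutes_inv[OF that(1)], of ?n] that(2) by auto
  have inv_in': "inv_into UNIV p ?n \<in> {1..?n}" if "p permutes {1..?n}" for p
    using permutes_in_image[OF permutes_inv[OF that(1)], of ?n] by auto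
  have x0: "(z(?n := 0) \<circ> p) (inv_into UNIV p ?n) = 0" if "p permutes {1..?n}" for p and z :: "nat \<Rightarrow> 'a"
    using that by (simp add: permutes_inverses)
  have zx: "sp_term ?n m m' a b (?x \<circ> p) (?y \<circ> q) = 0"
    if "p permutes {1..?n}" "q permutes {1..?n}" "inv_into UNIV p ?n \<noteq> ?n" for p q
    by (rule sp_term_vanishes_at_0[of "?x \<circ> p" "inv_into UNIV p ?n" _ "?y \<circ> q" "inv_into UNIV q ?n",
      OF x0[OF that(1)] inv_in[OF that(1,3)] x0[OF that(2)] inv_in'[OF that(2)]])
  have zy: "sp_term ?n m m' a b (?x \<circ> p) (?y \<circ> q) = 0"
    if "p permutes {1..?n}" "q permutes {1..?n}" "inv_into UNIV q ?n \<noteq> ?n" for p q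
    unfolding sp_term_swap[OF assms(1)]
    by (rule sp_term_vanishes_at_0[of "?y \<circ> q" "inv_into UNIV q ?n" _ "?x \<circ> p" "inv_into UNIV p ?n",
      OF x0[OF that(2)] inv_in[OF that(2,3)] x0[OF that(1)] inv_in'[OF that(1)]])
  have sub: "p permutes {1..?n}" if "p permutes {1..k}" for p
    using that by (rule permutes_subset) auto
  have "sp_sum ?n m m' a b ?x ?y = (\<Sum>p | p permutes {1..k}. of_int (sign p) *
      (\<Sum>q | q permutes {1..?n}. of_int (sign q) * sp_term ?n m m' a b (?x \<circ> p) (?y \<circ> q)))"
    unfolding sp_sum_def alternating_sum_def by (intro drop) (simp add: zx)
  also have "\<dots> = (\<Sum>p | p permutes {1..k}. of_int (sign p) *
      (\<Sum>q | q permutes {1..k}. of_int (sign q) * sp_term ?n m m' a b (?x \<circ> p) (?y \<circ> q)))"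
  proof (intro sum.cong[OF refl] arg_cong2[of _ _ _ _ "(*)", OF refl])
    fix p assume "p \<in> {p. p permutes {1..k}}"
    then have "p permutes {1..?n}" using sub by simp
    then show "(\<Sum>q | q permutes {1..?n}. of_int (sign q) * sp_term ?n m m' a b (?x \<circ> p) (?y \<circ> q)) =
      (\<Sum>q | q permutes {1..k}. of_int (sign q) * sp_term ?n m m' a b (?x \<circ> p) (?y \<circ> q))"
      by (intro drop) (simp only: zy not_False_eq_True mult_zero_right)
  qed
  also have "\<dots> = (\<Sum>p | p permutes {1..k}. of_int (sign p) *
      (\<Sum>q | q permutes {1..k}. of_int (sign q) *
        ((\<Prod>i=1..k. x i * y i) * sp_term k m m' a b (x \<circ> p) (y \<circ> q))))"
  proof (intro sum.cong refl arg_cong2[of _ _ _ _ "(*)"])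
    fix p q assume "p \<in> {p. p permutes {1..k}}" "q \<in> {q. q permutes {1..k}}"
    then have p: "p permutes {1..k}" and q: "q permutes {1..k}" by auto
    have fix_p: "p ?n = ?n" "\<And>i. i \<in> {1..k} \<Longrightarrow> p i \<noteq> ?n"
    proof -
      show "p ?n = ?n" by (rule permutes_not_in[OF p]) simp
      show "p i \<noteq> ?n" if "i \<in> {1..k}" for i
        using permutes_in_image[OF p, of i] that by auto
    qed
    have fix_q: "q ?n = ?n" "\<And>i. i \<in> {1..k} \<Longrightarrow> q i \<noteq> ?n"
    proof -
      show "q ?n = ?n" by (rule permutes_not_in[OF q]) simp
      show "q i \<noteq> ?n" if "i \<in> {1..k}" for i
        using permutes_in_image[OF q, of i] that by auto
    qed
    have "sp_term ?n m m' a b (?x \<circ> p) (?y \<circ> q) =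
        (\<Prod>i=1..k. (?x \<circ> p) i * (?y \<circ> q) i) * sp_term k m m' a b (?x \<circ> p) (?y \<circ> q)"
      using fix_p fix_q by (intro sp_term_last_0 assms) auto
    also have "sp_term k m m' a b (?x \<circ> p) (?y \<circ> q) = sp_term k m m' a b (x \<circ> p) (y \<circ> q)"
      unfolding sp_term_def using fix_p fix_q
      by (intro arg_cong2[of _ _ _ _ "(*)"] prod.cong) (auto simp: squares_def)
    also have "(\<Prod>i=1..k. (?x \<circ> p) i * (?y \<circ> q) i) = (\<Prod>i=1..k. (x \<circ> p) i) * (\<Prod>i=1..k. (y \<circ> q) i)"
      unfolding prod.distrib[symmetric] using fix_p fix_q by (intro prod.cong) auto
    also have "\<dots> = (\<Prod>i=1..k. x i * y i)"
      using prod.permute[OF p, of x] prod.permute[OF q, of y] by (simp add: prod.distrib)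
    finally show "sp_term ?n m m' a b (?x \<circ> p) (?y \<circ> q) =
        (\<Prod>i=1..k. x i * y i) * sp_term k m m' a b (x \<circ> p) (y \<circ> q)" .
  qed
  also have "\<dots> = (\<Prod>i=1..k. x i * y i) * sp_sum k m m' a b x y"
    unfolding sp_sum_def alternating_sum_cmult[symmetric] by (simp add: alternating_sum_def)
  finally show ?thesis .
qed

lemma card_union_negated:
  fixes x y :: "nat \<Rightarrow> 'a::field"
  assumes "inj_on x {1..k}" "inj_on y {1..l}" "\<And>i j. i \<in> {1..k} \<Longrightarrow> j \<in> {1..l} \<Longrightarrow> x i + y j \<noteq> 0"
  shows "card (x ` {1..k} \<union> (\<lambda>j. - y j) ` {1..l}) = k + l"
proof -
  have inj: "inj_on (\<lambda>j. - y j) {1..l}"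
  proof (rule inj_onI)
    fix i j assume "i \<in> {1..l}" "j \<in> {1..l}" "- y i = - y j"
    then show "i = j" using inj_onD[OF assms(2), of i j] by simp
  qed
  have "card (x ` {1..k} \<union> (\<lambda>j. - y j) ` {1..l}) = card (x ` {1..k}) + card ((\<lambda>j. - y j) ` {1..l})"
  proof (rule card_Un_disjoint)
    show "x ` {1..k} \<inter> (\<lambda>j. - y j) ` {1..l} = {}"
      using assms(3) unfolding eq_neg_iff_add_eq_0[symmetric] by blast
  qed simp_all
  then show ?thesis using assms(1) inj by (simp add: card_image)
qed

text \<open>In terms of \<open>t\<close>, both sides are polynomials of degree at most \<open>2 k\<close>: a term in which \<open>t\<close> and
\<open>- t\<close> stand at places \<open>(i, j)\<close> of the diagram has a vanishing binomial, and the others have small degree.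
Both sides vanish at the \<open>2 k\<close> points \<open>x i\<close> and \<open>- y i\<close>, by antisymmetry on the left, and they
agree at 0.\<close>

lemma sp_sum_cancel:
  fixes x y :: "nat \<Rightarrow> 'a::field"
  assumes two: "(2::'a) \<noteq> 0" and m: "conjugate m m'" "m (Suc k) \<le> k" and gen: "generic_point k x y"
  shows "sp_sum (Suc k) m m' a b (x(Suc k := t)) (y(Suc k := - t)) =
    (\<Prod>i=1..k. (x i - t) * (y i + t)) * sp_sum k m m' a b x y"
proof -
  let ?n = "Suc k"
  let ?F = "\<lambda>t. sp_sum ?n m m' a b (x(?n := t)) (y(?n := - t))"
  let ?G = "\<lambda>t. (\<Prod>i=1..k. (x i - t) * (y i + t)) * sp_sum k m m' a b x y"
  have summand: "polynomial_function (2 * k) (\<lambda>t. sp_term ?n m m' a b (x(?n := t) \<circ> p) (y(?n := - t) \<circ> q))"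
    if p: "p permutes {1..?n}" and q: "q permutes {1..?n}" for p q
  proof -
    have ij: "inv_into UNIV p ?n \<in> {1..?n}" "inv_into UNIV q ?n \<in> {1..?n}"
      using permutes_in_image[OF permutes_inv[OF p], of ?n] permutes_in_image[OF permutes_inv[OF q], of ?n]
      by auto
    show ?thesis
    proof (cases "inv_into UNIV q ?n \<le> m (inv_into UNIV p ?n)")
      case True
      have "sp_term ?n m m' a b (x(?n := t) \<circ> p) (y(?n := - t) \<circ> q) = 0" for t
        unfolding update_comp_permutes[OF p] update_comp_permutes[OF q]
        using ij True by (intro sp_term_eq_0[of "inv_into UNIV p ?n" _ "inv_into UNIV q ?n"]) auto
      then show ?thesis by (simp only: polynomial_function_const)
    next
      case False
      then show ?thesis
        unfolding update_comp_permutes[OF p] update_comp_permutes[OF q]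
        using polynomial_function_sp_term_diagonal[OF m(1) ij] by simp
    qed
  qed
  have F: "polynomial_function (2 * k) ?F"
    unfolding sp_sum_def alternating_sum_def
    by (intro polynomial_function_sum polynomial_function_cmult) (auto intro: summand)
  have "polynomial_function (\<Sum>i=1..k. 2) (\<lambda>t. \<Prod>i=1..k. (x i - t) * (y i + t))"
    using polynomial_function_mult[OF polynomial_function_linear(4) polynomial_function_linear(2)]
    by (intro polynomial_function_prod) (simp add: numeral_2_eq_2)
  then have G: "polynomial_function (2 * k) ?G"
    using polynomial_function_mult[OF _ polynomial_function_const[of 0]] by (fastforce simp: mult.commute)
  have inj: "inj_on x {1..k}" "inj_on y {1..k}"
    using gen unfolding generic_point_def by blast+
  have nz: "x i \<noteq> 0" "y i \<noteq> 0" if "i \<in> {1..k}" for i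
    using gen that unfolding generic_point_def by blast+
  \<comment> \<open>The points where both sides are compared; they are distinct because the point is generic.\<close>
  let ?S = "insert 0 (x ` {1..k} \<union> (\<lambda>i. - y i) ` {1..k})"
  have "card (x ` {1..k} \<union> (\<lambda>i. - y i) ` {1..k}) = 2 * k"
    using card_union_negated[OF inj] gen unfolding generic_point_def by simp
  moreover have "0 \<notin> x ` {1..k} \<union> (\<lambda>i. - y i) ` {1..k}"
    using nz by force
  ultimately have card: "card ?S = Suc (2 * k)" by simp
  have "?F t - ?G t = 0"
  proof (rule polynomial_function_eq_0[OF polynomial_function_diff[OF F G], of ?S])
    fix t assume "t \<in> ?S"
    then consider "t = 0" | i where "i \<in> {1..k}" "t = x i" | i where "i \<in> {1..k}" "t = - y i" by auto
    then show "?F t - ?G t = 0"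
    proof cases
      case 1
      then show ?thesis using sp_sum_at_0[OF m, of a b x y] by simp
    next
      case (2 i)
      then have "?F t = 0"
        unfolding sp_sum_def by (intro alternating_sum_eq_0[OF two, of i _ ?n]) auto
      moreover have "(\<Prod>i=1..k. (x i - t) * (y i + t)) = 0"
        using 2 by (intro prod_zero) auto
      ultimately show ?thesis by simp
    next
      case (3 i)
      then have "?F t = 0"
        unfolding sp_sum_swap[OF m(1)] unfolding sp_sum_def
        by (intro alternating_sum_eq_0[OF two, of i _ ?n]) auto
      moreover have "(\<Prod>i=1..k. (x i - t) * (y i + t)) = 0"
        using 3 by (intro prod_zero) auto
      ultimately show ?thesis by simp
    qed
  next
    show "2 * k < card ?S" unfolding card by simp
  qed simp
  then show ?thesis by simp
qed

section \<open>Removing a hook from the Sergeev-Pragacz sum\<close>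

text \<open>The diagram without its first row and its first column.\<close>

definition remove_hook :: "(nat \<Rightarrow> nat) \<Rightarrow> nat \<Rightarrow> nat" where
  "remove_hook m i = m (Suc i) - 1"

lemma conjugate_remove_hook:
  assumes "conjugate m m'"
  shows "conjugate (remove_hook m) (remove_hook m')"
  unfolding conjugate_def
proof (intro allI impI)
  fix i j :: nat assume "1 \<le> i" "1 \<le> j"
  have "j \<le> c - 1 \<longleftrightarrow> Suc j \<le> c" if "1 \<le> j" for j c :: nat
    using that by linarith
  with \<open>1 \<le> i\<close> \<open>1 \<le> j\<close> show "j \<le> remove_hook m i \<longleftrightarrow> i \<le> remove_hook m' j"
    unfolding remove_hook_def using conjugateD[OF assms, of "Suc i" "Suc j"] by (metis le_add1 plus_1_eq_Suc)
qed

lemma row_factor_remove_hook: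
  "1 \<le> i \<Longrightarrow> row_factor (Suc k) m a (Suc i) t = row_factor k (remove_hook m) a i t"
  by (auto simp: row_factor_def remove_hook_def)

text \<open>The factors of a term that belong to the first hook, where \<open>s\<close> and \<open>t\<close> are the variables at the first place
and \<open>z\<close> and \<open>w\<close> the others, for a diagram whose first row and first column have at least \<open>Suc k\<close> squares. Only
such hooks contribute a symmetric polynomial in \<open>z\<close> and in \<open>w\<close>, which can be taken out of the alternating sums over
the other variables.\<close>

definition hook_factor :: "nat \<Rightarrow> (nat \<Rightarrow> nat) \<Rightarrow> (nat \<Rightarrow> nat) \<Rightarrow> (int \<Rightarrow> 'a) \<Rightarrow> (int \<Rightarrow> 'a) \<Rightarrow>
    'a \<Rightarrow> 'a \<Rightarrow> (nat \<Rightarrow> 'a) \<Rightarrow> (nat \<Rightarrow> 'a) \<Rightarrow> 'a::comm_ring_1" where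
  "hook_factor k m m' a b s t z w =
    (\<Prod>l=1..m 1 - 1. s - a (int l)) * (\<Prod>l=1..m' 1 - 1. t - b (int l)) *
    ((s + t) * (\<Prod>j=1..k. s + w j) * (\<Prod>i=1..k. z i + t))"

lemma sp_term_remove_hook:
  assumes m: "conjugate m m'" "Suc k \<le> m 1" "Suc k \<le> m' 1"
  shows "sp_term (Suc k) m m' a b x y =
    hook_factor k m m' a b (x 1) (y 1) (x \<circ> Suc) (y \<circ> Suc) *
    sp_term k (remove_hook m) (remove_hook m') a b (x \<circ> Suc) (y \<circ> Suc)"
proof -
  have rows: "(\<Prod>i=1..Suc k. row_factor (Suc k) m a i (x i)) = (\<Prod>l=1..m 1 - 1. x 1 - a (int l)) *
      (\<Prod>i=1..k. row_factor k (remove_hook m) a i (x (Suc i)))"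
    if "Suc k \<le> m 1" for m a and x :: "nat \<Rightarrow> 'a"
  proof -
    have "(\<Prod>i=1..Suc k. row_factor (Suc k) m a i (x i)) =
        row_factor (Suc k) m a 1 (x 1) * (\<Prod>i=1..k. row_factor (Suc k) m a (Suc i) (x (Suc i)))"
      by (subst prod.atLeast_Suc_atMost) (simp_all add: prod.shift_bounds_cl_Suc_ivl del: prod.cl_ivl_Suc)
    also have "row_factor (Suc k) m a 1 (x 1) = (\<Prod>l=1..m 1 - 1. x 1 - a (int l))"
      using that by (simp add: row_factor_def)
    also have "(\<Prod>i=1..k. row_factor (Suc k) m a (Suc i) (x (Suc i))) =
        (\<Prod>i=1..k. row_factor k (remove_hook m) a i (x (Suc i)))"
      by (intro prod.cong refl row_factor_remove_hook) auto
    finally show ?thesis .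
  qed
  have col: "Suc 0 \<le> m (Suc i)" if "i \<in> {1..k}" for i
    using conjugateD[OF m(1), of "Suc i" 1] m(3) that by simp
  have first: "(\<Prod>j=1..Suc k. f j) = f 1 * (\<Prod>j=1..k. f (Suc j))" for f :: "nat \<Rightarrow> 'a"
    by (subst prod.atLeast_Suc_atMost) (simp_all add: prod.shift_bounds_cl_Suc_ivl del: prod.cl_ivl_Suc)
  have "(\<Prod>(i, j)\<in>squares (Suc k) m. x i + y j) =
      (x 1 + y 1) * (\<Prod>j=1..k. x 1 + y (Suc j)) *
      (\<Prod>i=1..k. (x (Suc i) + y 1) * (\<Prod>j=1..k. if j \<le> remove_hook m i then x (Suc i) + y (Suc j) else 1))"
  proof -
    have first_row: "(\<Prod>j=1..k. if Suc j \<le> m 1 then x 1 + y (Suc j) else 1) =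
        (\<Prod>j=1..k. x 1 + y (Suc j))"
      using m(2) by (intro prod.cong) auto
    have shift: "Suc j \<le> c \<longleftrightarrow> j \<le> c - 1" if "j \<in> {1..k}" for j c
      using that by auto
    have other_rows: "(if 1 \<le> m (Suc i) then x (Suc i) + y 1 else 1) *
        (\<Prod>j=1..k. if Suc j \<le> m (Suc i) then x (Suc i) + y (Suc j) else 1) =
      (x (Suc i) + y 1) * (\<Prod>j=1..k. if j \<le> m (Suc i) - 1 then x (Suc i) + y (Suc j) else 1)"
      if "i \<in> {1..k}" for i
      using col[OF that] by (intro arg_cong2[of _ _ _ _ "(*)"] prod.cong refl) (simp_all add: shift)
    have "1 \<le> m 1" using m(2) by simp
    then show ?thesis
      unfolding prod_squares first remove_hook_def first_row
      by (intro arg_cong2[of _ _ _ _ "(*)"] prod.cong refl other_rows) simp_all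
  qed
  also have "\<dots> = (x 1 + y 1) * (\<Prod>j=1..k. x 1 + y (Suc j)) * (\<Prod>i=1..k. x (Suc i) + y 1) *
      (\<Prod>(i, j)\<in>squares k (remove_hook m). x (Suc i) + y (Suc j))"
    unfolding prod_squares prod.distrib by (simp only: mult.assoc)
  finally show ?thesis
    unfolding sp_term_def rows[where m = m, OF m(2)] rows[where m = m', OF m(3)] hook_factor_def
    by (simp add: mult_ac)
qed

lemma hook_factor_permute:
  assumes "p permutes {1..k}" "q permutes {1..k}"
  shows "hook_factor k m m' a b s t (z \<circ> p) (w \<circ> q) = hook_factor k m m' a b s t z w"
  using prod.permute[OF assms(1), of "\<lambda>i. z i + t"] prod.permute[OF assms(2), of "\<lambda>j. s + w j"]
  by (simp add: hook_factor_def comp_def)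

lemma sp_sum_remove_hook:
  fixes x y :: "nat \<Rightarrow> 'a::comm_ring_1"
  assumes m: "conjugate m m'" "Suc k \<le> m 1" "Suc k \<le> m' 1"
  shows "sp_sum (Suc k) m m' a b x y = (\<Sum>p=1..Suc k. \<Sum>r=1..Suc k.
    of_int (sign (transpose 1 p)) * of_int (sign (transpose 1 r)) *
    hook_factor k m m' a b (x p) (y r) (x \<circ> transpose 1 p \<circ> Suc) (y \<circ> transpose 1 r \<circ> Suc) *
    sp_sum k (remove_hook m) (remove_hook m') a b (x \<circ> transpose 1 p \<circ> Suc) (y \<circ> transpose 1 r \<circ> Suc))"
proof -
  let ?n = "Suc k"
  let ?T = "sp_term k (remove_hook m) (remove_hook m') a b"
  let ?xp = "\<lambda>p. x \<circ> transpose 1 p \<circ> Suc" and ?yr = "\<lambda>r. y \<circ> transpose 1 r \<circ> Suc"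
  let ?s = "\<lambda>p. of_int (sign (transpose 1 (p::nat))) :: 'a"
  have inner: "alternating_sum k (\<lambda>z'. alternating_sum k (\<lambda>w'. hook_factor k m m' a b s t z' w' * ?T z' w') w) z =
      hook_factor k m m' a b s t z w * sp_sum k (remove_hook m) (remove_hook m') a b z w" for s t z w
    unfolding sp_sum_def alternating_sum_cmult[symmetric]
    by (intro alternating_sum_cong) (simp add: hook_factor_permute)
  have "sp_sum ?n m m' a b x y = alternating_sum ?n (\<lambda>z. (\<Sum>r=1..?n. ?s r *
      alternating_sum k (\<lambda>w'. hook_factor k m m' a b (z 1) (y r) (z \<circ> Suc) w' * ?T (z \<circ> Suc) w') (?yr r))) x"
    unfolding sp_sum_def sp_term_remove_hook[OF m]
    by (subst alternating_sum_first[where F = "\<lambda>t w. hook_factor k m m' a b _ t _ w * ?T _ w"]) simp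
  also have "\<dots> = (\<Sum>p=1..?n. ?s p * alternating_sum k (\<lambda>z'. (\<Sum>r=1..?n. ?s r *
      alternating_sum k (\<lambda>w'. hook_factor k m m' a b (x p) (y r) z' w' * ?T z' w') (?yr r))) (?xp p))"
    by (rule alternating_sum_first[where F = "\<lambda>s z'. (\<Sum>r=1..?n. ?s r *
      alternating_sum k (\<lambda>w'. hook_factor k m m' a b s (y r) z' w' * ?T z' w') (?yr r))"])
  also have "\<dots> = (\<Sum>p=1..?n. ?s p * (\<Sum>r=1..?n. ?s r * alternating_sum k (\<lambda>z'.
      alternating_sum k (\<lambda>w'. hook_factor k m m' a b (x p) (y r) z' w' * ?T z' w') (?yr r)) (?xp p)))"
  proof -
    have "alternating_sum k (\<lambda>z. \<Sum>r\<in>R. G r z) v = (\<Sum>r\<in>R. alternating_sum k (G r) v)"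
      for R :: "nat set" and G and v :: "nat \<Rightarrow> 'a"
      unfolding alternating_sum_def sum_distrib_left by (rule sum.swap)
    then show ?thesis by (simp only: alternating_sum_cmult)
  qed
  finally show ?thesis
    unfolding inner by (simp only: sum_distrib_left mult.assoc)
qed

section \<open>Removing a hook from the residue determinant\<close>

text \<open>The generalized power \<open>(u|a)^e\<close> for every integer \<open>e\<close>, extended to negative \<open>e\<close> in such a way that
\<open>(u|a)^e = (u|a)^(e - 1) (u - a\<^sub>e)\<close> always holds.\<close>

definition gen_pow :: "(int \<Rightarrow> 'a) \<Rightarrow> int \<Rightarrow> 'a::field fls" where
  "gen_pow a e = (if 0 \<le> e then laurent_poly (\<Prod>l=1..nat e. [:- a (int l), 1:])
     else inverse (laurent_poly (\<Prod>l=1..nat (- e). [:- a (1 - int l), 1:])))"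

text \<open>Rows are counted from 0 here, as in matrices, while \<open>m\<close> counts them from 1.\<close>

definition row_series :: "(nat \<Rightarrow> nat) \<Rightarrow> (int \<Rightarrow> 'a) \<Rightarrow> nat \<Rightarrow> 'a::field fls" where
  "row_series m a i = gen_pow a (int (m (Suc i)) - int (Suc i))"

text \<open>The value of \<open>H(u)\<close> at the point \<open>(x; y)\<close>, expanded at infinity.\<close>

definition H_value :: "nat \<Rightarrow> (nat \<Rightarrow> 'a) \<Rightarrow> (nat \<Rightarrow> 'a) \<Rightarrow> 'a::field fls" where
  "H_value n x y = laurent_poly (root_poly (\<lambda>i. - y i) {1..n}) / laurent_poly (root_poly x {1..n})"

lemma monic_at_laurent_poly_prod: "monic_at (int (card A)) (laurent_poly (\<Prod>l\<in>A. [:c l, 1:]))"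
  unfolding laurent_poly_prod laurent_poly_linear by (intro monic_at_prod monic_at_linear)

lemma monic_at_root_poly: "monic_at (int (card A)) (laurent_poly (root_poly v A))"
  unfolding root_poly_def by (rule monic_at_laurent_poly_prod)

lemma monic_at_gen_pow: "monic_at e (gen_pow a e)"
proof (cases "0 \<le> e")
  case True
  then show ?thesis
    using monic_at_laurent_poly_prod[of "{1..nat e}" "\<lambda>l. - a (int l)"] by (simp add: gen_pow_def)
next
  case False
  then show ?thesis
    using monic_at_inverse[OF monic_at_laurent_poly_prod[of "{1..nat (- e)}" "\<lambda>l. - a (1 - int l)"]]
    by (simp add: gen_pow_def)
qed

lemma monic_at_divide: "monic_at d f \<Longrightarrow> monic_at e g \<Longrightarrow> monic_at (d - e) (f / g)"
  unfolding divide_inverse using monic_at_mult[OF _ monic_at_inverse, of d f e g] by simp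

lemma monic_at_H_value: "monic_at 0 (H_value n x y)"
  unfolding H_value_def
  using monic_at_divide[OF monic_at_root_poly monic_at_root_poly, of "{1..n}" "{1..n}" "\<lambda>i. - y i" x]
  by simp

lemma gen_pow_step: "gen_pow a e = gen_pow a (e - 1) * laurent_poly [:- a e, 1:]"
proof (cases "1 \<le> e")
  case True
  then have "nat e = Suc (nat (e - 1))" by simp
  with True show ?thesis by (simp add: gen_pow_def laurent_poly_mult mult.commute del: mult_pCons_left mult_pCons_right)
next
  case False
  then have suc: "nat (- (e - 1)) = Suc (nat (- e))" by simp
  have "gen_pow a (e - 1) = inverse (laurent_poly (\<Prod>l=1..nat (- e). [:- a (1 - int l), 1:])) * inverse (laurent_poly [:- a e, 1:])"
    using False unfolding gen_pow_def suc
    by (simp add: laurent_poly_mult mult.commute del: mult_pCons_left mult_pCons_right)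
  moreover have "inverse (laurent_poly (\<Prod>l=1..nat (- e). [:- a (1 - int l), 1:])) = gen_pow a e"
    using False by (cases "e = 0") (simp_all add: gen_pow_def)
  ultimately show ?thesis by (simp add: laurent_poly_linear del: fls_const_uminus)
qed

text \<open>The shifted powers in the columns of the Jacobi-Trudi determinant differ from those in the first column by monic
polynomials that depend on the column only.\<close>

lemma gen_pow_shift:
  "gen_pow (\<lambda>i. a (i - int j)) (e + int j) = gen_pow a e * laurent_poly (\<Prod>l<j. [:- a (- int l), 1:])"
proof (induction e rule: int_induct[where k = 0])
  case base
  have "(\<Prod>l=1..j. [:- a (int l - int j), 1:]) = (\<Prod>l<j. [:- a (- int l), 1:])"
    by (rule prod.reindex_bij_witness[where i = "\<lambda>l. j - l" and j = "\<lambda>l. j - l"]) auto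
  then show ?case by (simp add: gen_pow_def)
next
  case (step1 e)
  have "gen_pow (\<lambda>i. a (i - int j)) (e + 1 + int j) =
      gen_pow (\<lambda>i. a (i - int j)) (e + int j) * laurent_poly [:- a (e + 1), 1:]"
    by (subst gen_pow_step) (simp add: algebra_simps)
  moreover have "gen_pow a (e + 1) = gen_pow a e * laurent_poly [:- a (e + 1), 1:]"
    by (subst gen_pow_step) simp
  ultimately show ?case using step1.IH by (simp only: mult_ac)
next
  case (step2 e)
  have "gen_pow (\<lambda>i. a (i - int j)) (e + int j) =
      gen_pow (\<lambda>i. a (i - int j)) (e - 1 + int j) * laurent_poly [:- a e, 1:]"
    by (subst gen_pow_step) (simp add: algebra_simps)
  moreover have "gen_pow a e = gen_pow a (e - 1) * laurent_poly [:- a e, 1:]"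
    by (rule gen_pow_step)
  ultimately have "gen_pow (\<lambda>i. a (i - int j)) (e - 1 + int j) * laurent_poly [:- a e, 1:] =
      gen_pow a (e - 1) * laurent_poly (\<Prod>l<j. [:- a (- int l), 1:]) * laurent_poly [:- a e, 1:]"
    using step2.IH by (simp only: mult_ac)
  then show ?case by (simp add: laurent_poly_linear del: fls_const_uminus)
qed

lemma schur_det_cong: "(\<And>i. i < N \<Longrightarrow> g i = h i) \<Longrightarrow> schur_det g N R = schur_det h N R"
  unfolding schur_det_def by (rule moment_det_cong) simp

lemma conjugate_eq_0:
  assumes "conjugate m m'"
  shows "m (Suc N) = 0 \<longleftrightarrow> m' 1 \<le> N"
  using conjugateD[OF assms, of "Suc N" 1] by auto

text \<open>The rows below the diagram can be dropped one at a time.\<close>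

lemma schur_det_rows:
  assumes "conjugate m m'" "m (Suc N) = 0" "monic_at 0 R"
  shows "schur_det (row_series m a) N R = schur_det (row_series m a) (m' 1) R"
proof -
  have "m' 1 \<le> N" using assms conjugate_eq_0 by blast
  then show ?thesis
  proof (induction N rule: dec_induct)
    case (step N)
    then have "m (Suc N) = 0" using assms(1) conjugate_eq_0 by blast
    then have "row_series m a N = gen_pow a (- int (Suc N))" by (simp add: row_series_def)
    then have "monic_at (- int (Suc N)) (row_series m a N)"
      using monic_at_gen_pow by metis
    then show ?case using schur_det_Suc[OF assms(3)] step.IH by metis
  qed simp
qed

text \<open>The sequence \<open>hat a\<close>, over an arbitrary ring.\<close>

definition dual_param :: "(int \<Rightarrow> 'a::comm_ring_1) \<Rightarrow> int \<Rightarrow> 'a" where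
  "dual_param a i = - a (1 - i)"

lemma H_value_remove:
  assumes "p \<in> {1..Suc k}" "r \<in> {1..Suc k}"
  shows "laurent_poly (root_poly (\<lambda>i. - y i) ({1..Suc k} - {r})) / laurent_poly (root_poly x ({1..Suc k} - {p})) =
    H_value k (x \<circ> transpose 1 p \<circ> Suc) (y \<circ> transpose 1 r \<circ> Suc)"
  unfolding H_value_def root_poly_def
  using prod_transpose_Suc[OF assms(1), of "\<lambda>t. [:- t, 1:]" x]
    prod_transpose_Suc[OF assms(2), of "\<lambda>t. [:- (- t), 1:]" y]
  by (simp only: comp_def)

lemma prod_uminus: "(\<Prod>i\<in>A. - f i) = (-1) ^ card A * (\<Prod>i\<in>A. f i :: 'a::comm_ring_1)"
  by (induction A rule: infinite_finite_induct) simp_all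

text \<open>The first row is removed by \<open>schur_det_row\<close> and the first column by \<open>schur_det_column\<close>, applied to
the points \<open>- y r\<close>. With \<open>N + 1\<close> the length of the first column, \<open>E = (u - a\<^sub>0) ... (u - a\<^sub>1\<^sub>-\<^sub>N)\<close> clears the
denominators of all rows, and its value at \<open>- y r\<close> is the dual generalized power of \<open>y r\<close> up to the sign
\<open>(-1) ^ N\<close>. The remaining rows are those of the smaller diagram, for the same parameters.\<close>

lemma schur_det_remove_hook:
  fixes x y :: "nat \<Rightarrow> 'a::field"
  assumes m: "conjugate m m'" "Suc k \<le> m 1" "Suc k \<le> m' 1"
    and x: "inj_on x {1..Suc k}" and y: "inj_on y {1..Suc k}"
  shows "schur_det (row_series m a) (m' 1) (H_value (Suc k) x y) =
    (\<Sum>p=1..Suc k. \<Sum>r=1..Suc k.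
      hook_factor k m m' a (dual_param a) (x p) (y r) (x \<circ> transpose 1 p \<circ> Suc) (y \<circ> transpose 1 r \<circ> Suc) /
      ((\<Prod>q\<in>{1..Suc k} - {p}. x p - x q) * (\<Prod>s\<in>{1..Suc k} - {r}. y r - y s)) *
      schur_det (row_series (remove_hook m) a) (m' 1 - 1)
        (H_value k (x \<circ> transpose 1 p \<circ> Suc) (y \<circ> transpose 1 r \<circ> Suc)))"
proof -
  let ?I = "{1..Suc k}"
  define N where "N = m' 1 - 1"
  have N: "m' 1 = Suc N" using m(3) by (simp add: N_def)
  define G where "G = (\<Prod>l=1..m 1 - 1. [:- a (int l), 1:])"
  define E where "E = (\<Prod>l<N. [:- a (- int l), 1:])"
  define Y where "Y B = laurent_poly (root_poly (\<lambda>i. - y i) B)" for B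
  define X where "X A = laurent_poly (root_poly x A)" for A
  let ?g = "row_series m a" and ?h = "row_series (remove_hook m) a"
  have g0: "?g 0 = laurent_poly G"
    using m(2) by (simp add: row_series_def gen_pow_def G_def nat_diff_distrib)
  have m_pos: "1 \<le> m i" if "1 \<le> i" "i \<le> Suc N" for i
    using conjugateD[OF m(1), of i 1] that N by simp
  have gh: "(?g \<circ> Suc) i = ?h i" if "i < N" for i
    using m_pos[of "Suc (Suc i)"] that by (simp add: row_series_def remove_hook_def of_nat_diff algebra_simps)
  have E: "degree E = N" "lead_coeff E = 1"
    using degree_root_poly[of "\<lambda>l. a (- int l)" "{..<N}"] lead_coeff_root_poly[of "\<lambda>l. a (- int l)" "{..<N}"]
    by (simp_all add: E_def root_poly_def)
  have Eg: "\<exists>h. laurent_poly E * ?h i = laurent_poly h" if "i < N" for i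
  proof -
    let ?e = "int (remove_hook m (Suc i)) - int (Suc i)"
    have "laurent_poly E * ?h i = gen_pow (\<lambda>i. a (i - int N)) (?e + int N)"
      unfolding gen_pow_shift row_series_def E_def by (simp only: mult.commute)
    moreover have "0 \<le> ?e + int N" using that by simp
    ultimately show ?thesis unfolding gen_pow_def by metis
  qed
  have row: "schur_det ?g (Suc N) (H_value (Suc k) x y) =
    (\<Sum>p\<in>?I. poly G (x p) * poly (root_poly (\<lambda>i. - y i) ?I) (x p) / (\<Prod>s\<in>?I - {p}. x p - x s) *
      schur_det ?h N (Y ?I / X (?I - {p})))"
    unfolding H_value_def X_def Y_def
    by (subst schur_det_row[of ?I x ?g G, OF _ x g0]) (simp_all add: schur_det_cong[OF gh] cong: sum.cong)
  have column: "schur_det ?h N (Y ?I / X (?I - {p})) =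
    (\<Sum>r\<in>?I. (\<Prod>l=1..m' 1 - 1. y r - dual_param a (int l)) * (\<Prod>q\<in>?I - {p}. x q + y r) /
      (\<Prod>s\<in>?I - {r}. y r - y s) * schur_det ?h N (Y (?I - {r}) / X (?I - {p})))"
    if p: "p \<in> ?I" for p
  proof -
    have inj: "inj_on (\<lambda>i. - y i) ?I"
    proof (rule inj_onI)
      fix r s assume "r \<in> ?I" "s \<in> ?I" "- y r = - y s"
      then show "r = s" using inj_onD[OF y, of r s] by simp
    qed
    have card: "card ?I = Suc (card (?I - {p}))" using p by simp
    have "schur_det ?h N (Y ?I / X (?I - {p})) =
      (-1) ^ N * (\<Sum>r\<in>?I. poly (root_poly x (?I - {p}) * E) (- y r) / (\<Prod>s\<in>?I - {r}. - y r - - y s) *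
        schur_det ?h N (Y (?I - {r}) / X (?I - {p})))"
      unfolding X_def Y_def by (rule schur_det_column[OF _ _ inj card E Eg]) auto
    also have "\<dots> = (\<Sum>r\<in>?I. (-1) ^ N * poly (root_poly x (?I - {p}) * E) (- y r) / (\<Prod>s\<in>?I - {r}. - y r - - y s) *
        schur_det ?h N (Y (?I - {r}) / X (?I - {p})))"
      by (simp only: mult.assoc[symmetric] times_divide_eq_right sum_distrib_left)
    also have "\<dots> = (\<Sum>r\<in>?I. (\<Prod>l=1..m' 1 - 1. y r - dual_param a (int l)) * (\<Prod>q\<in>?I - {p}. x q + y r) /
      (\<Prod>s\<in>?I - {r}. y r - y s) * schur_det ?h N (Y (?I - {r}) / X (?I - {p})))"
    proof (intro sum.cong refl arg_cong2[of _ _ _ _ "(*)"])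
      fix r assume r: "r \<in> ?I"
      have "poly (root_poly x (?I - {p})) (- y r) = (\<Prod>q\<in>?I - {p}. - (x q + y r))"
        unfolding poly_root_poly by (intro prod.cong) simp_all
      also have "\<dots> = (-1) ^ k * (\<Prod>q\<in>?I - {p}. x q + y r)"
        using p by (simp only: prod_uminus) simp
      finally have num: "poly (root_poly x (?I - {p})) (- y r) = (-1) ^ k * (\<Prod>q\<in>?I - {p}. x q + y r)" .
      have "poly E (- y r) = (\<Prod>l<N. - (y r + a (- int l)))"
        unfolding E_def poly_prod by (intro prod.cong) simp_all
      also have "\<dots> = (-1) ^ N * (\<Prod>l<N. y r + a (- int l))"
        by (simp only: prod_uminus card_lessThan)
      also have "(\<Prod>l<N. y r + a (- int l)) = (\<Prod>l=1..m' 1 - 1. y r - dual_param a (int l))"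
        unfolding N by (rule prod.reindex_bij_witness[where i = "\<lambda>l. l - 1" and j = Suc])
          (auto simp: dual_param_def)
      finally have E: "poly E (- y r) = (-1) ^ N * (\<Prod>l=1..m' 1 - 1. y r - dual_param a (int l))" .
      have "(\<Prod>s\<in>?I - {r}. - y r - - y s) = (\<Prod>s\<in>?I - {r}. - (y r - y s))"
        by (intro prod.cong) simp_all
      also have "\<dots> = (-1) ^ k * (\<Prod>s\<in>?I - {r}. y r - y s)"
        using r by (simp only: prod_uminus) simp
      finally have den: "(\<Prod>s\<in>?I - {r}. - y r - - y s) = (-1) ^ k * (\<Prod>s\<in>?I - {r}. y r - y s)" .
      have sq: "(-1) ^ N * (-1) ^ N = (1::'a)" by (simp flip: power_add)
      have "(-1) ^ N * poly (root_poly x (?I - {p}) * E) (- y r) =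
          (-1) ^ k * ((-1) ^ N * (-1) ^ N) * ((\<Prod>l=1..m' 1 - 1. y r - dual_param a (int l)) * (\<Prod>q\<in>?I - {p}. x q + y r))"
        unfolding poly_mult num E by (simp only: mult_ac)
      then show "(-1) ^ N * poly (root_poly x (?I - {p}) * E) (- y r) / (\<Prod>s\<in>?I - {r}. - y r - - y s) =
        (\<Prod>l=1..m' 1 - 1. y r - dual_param a (int l)) * (\<Prod>q\<in>?I - {p}. x q + y r) / (\<Prod>s\<in>?I - {r}. y r - y s)"
        unfolding den sq by simp
    qed
    finally show ?thesis .
  qed
  have coeff: "poly G (x p) * poly (root_poly (\<lambda>i. - y i) ?I) (x p) / (\<Prod>s\<in>?I - {p}. x p - x s) *
      ((\<Prod>l=1..m' 1 - 1. y r - dual_param a (int l)) * (\<Prod>q\<in>?I - {p}. x q + y r) /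
      (\<Prod>s\<in>?I - {r}. y r - y s)) =
    hook_factor k m m' a (dual_param a) (x p) (y r) (x \<circ> transpose 1 p \<circ> Suc) (y \<circ> transpose 1 r \<circ> Suc) /
      ((\<Prod>q\<in>?I - {p}. x p - x q) * (\<Prod>s\<in>?I - {r}. y r - y s))"
    if p: "p \<in> ?I" and r: "r \<in> ?I" for p r
  proof -
    have "poly (root_poly (\<lambda>i. - y i) ?I) (x p) = (x p + y r) * (\<Prod>s\<in>?I - {r}. x p + y s)"
      unfolding poly_root_poly using r by (simp only: diff_minus_eq_add) (rule prod.remove, simp_all)
    then have "poly (root_poly (\<lambda>i. - y i) ?I) (x p) =
        (x p + y r) * (\<Prod>j=1..k. x p + (y \<circ> transpose 1 r \<circ> Suc) j)"
      using prod_transpose_Suc[OF r, of "\<lambda>t. x p + t" y] by simp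
    moreover have "(\<Prod>q\<in>?I - {p}. x q + y r) = (\<Prod>i=1..k. (x \<circ> transpose 1 p \<circ> Suc) i + y r)"
      using prod_transpose_Suc[OF p, of "\<lambda>t. t + y r" x] by simp
    moreover have "poly G (x p) = (\<Prod>l=1..m 1 - 1. x p - a (int l))"
      by (simp add: G_def poly_prod)
    ultimately show ?thesis by (simp add: hook_factor_def mult_ac)
  qed
  have "schur_det ?g (Suc N) (H_value (Suc k) x y) = (\<Sum>p\<in>?I. \<Sum>r\<in>?I.
      poly G (x p) * poly (root_poly (\<lambda>i. - y i) ?I) (x p) / (\<Prod>s\<in>?I - {p}. x p - x s) *
      ((\<Prod>l=1..m' 1 - 1. y r - dual_param a (int l)) * (\<Prod>q\<in>?I - {p}. x q + y r) /
      (\<Prod>s\<in>?I - {r}. y r - y s)) * schur_det ?h N (Y (?I - {r}) / X (?I - {p})))"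
    unfolding row
  proof (rule sum.cong[OF refl])
    fix p assume p: "p \<in> ?I"
    show "poly G (x p) * poly (root_poly (\<lambda>i. - y i) ?I) (x p) / (\<Prod>s\<in>?I - {p}. x p - x s) *
        schur_det ?h N (Y ?I / X (?I - {p})) = (\<Sum>r\<in>?I.
      poly G (x p) * poly (root_poly (\<lambda>i. - y i) ?I) (x p) / (\<Prod>s\<in>?I - {p}. x p - x s) *
      ((\<Prod>l=1..m' 1 - 1. y r - dual_param a (int l)) * (\<Prod>q\<in>?I - {p}. x q + y r) /
      (\<Prod>s\<in>?I - {r}. y r - y s)) * schur_det ?h N (Y (?I - {r}) / X (?I - {p})))"
      unfolding column[OF p] sum_distrib_left mult.assoc ..
  qed
  also have "\<dots> = (\<Sum>p\<in>?I. \<Sum>r\<in>?I.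
      hook_factor k m m' a (dual_param a) (x p) (y r) (x \<circ> transpose 1 p \<circ> Suc) (y \<circ> transpose 1 r \<circ> Suc) /
      ((\<Prod>q\<in>?I - {p}. x p - x q) * (\<Prod>s\<in>?I - {r}. y r - y s)) *
      schur_det ?h N (H_value k (x \<circ> transpose 1 p \<circ> Suc) (y \<circ> transpose 1 r \<circ> Suc)))"
  proof (intro sum.cong refl)
    fix p r assume p: "p \<in> ?I" and r: "r \<in> ?I"
    have "Y (?I - {r}) / X (?I - {p}) = H_value k (x \<circ> transpose 1 p \<circ> Suc) (y \<circ> transpose 1 r \<circ> Suc)"
      unfolding X_def Y_def by (rule H_value_remove[OF p r])
    then show "poly G (x p) * poly (root_poly (\<lambda>i. - y i) ?I) (x p) / (\<Prod>s\<in>?I - {p}. x p - x s) *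
      ((\<Prod>l=1..m' 1 - 1. y r - dual_param a (int l)) * (\<Prod>q\<in>?I - {p}. x q + y r) /
      (\<Prod>s\<in>?I - {r}. y r - y s)) * schur_det ?h N (Y (?I - {r}) / X (?I - {p})) =
      hook_factor k m m' a (dual_param a) (x p) (y r) (x \<circ> transpose 1 p \<circ> Suc) (y \<circ> transpose 1 r \<circ> Suc) /
      ((\<Prod>q\<in>?I - {p}. x p - x q) * (\<Prod>s\<in>?I - {r}. y r - y s)) *
      schur_det ?h N (H_value k (x \<circ> transpose 1 p \<circ> Suc) (y \<circ> transpose 1 r \<circ> Suc))"
      unfolding coeff[OF p r] by (simp only:)
  qed
  finally show ?thesis unfolding N by simp
qed

section \<open>The identity at points in general position\<close>

text \<open>The determinant has as many rows as the diagram; the degree bound in \<open>y\<close> depends on that.\<close>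

definition schur_identity :: "nat \<Rightarrow> (nat \<Rightarrow> nat) \<Rightarrow> (nat \<Rightarrow> nat) \<Rightarrow> (int \<Rightarrow> 'a) \<Rightarrow>
    (nat \<Rightarrow> 'a) \<Rightarrow> (nat \<Rightarrow> 'a::field) \<Rightarrow> bool" where
  "schur_identity n m m' a x y \<longleftrightarrow>
     schur_det (row_series m a) (m' 1) (H_value n x y) * (vander n x * vander n y) =
     sp_sum n m m' a (dual_param a) x y"

lemma root_poly_permute: "p permutes A \<Longrightarrow> root_poly (v \<circ> p) A = root_poly v A"
  unfolding root_poly_def using prod.permute[of p A "\<lambda>r. [:- v r, 1:]"] by (simp add: comp_def)

lemma H_value_transpose:
  assumes "i \<in> {1..n}" "j \<in> {1..n}"
  shows "H_value n (x \<circ> transpose i j) y = H_value n x y" "H_value n x (y \<circ> transpose i j) = H_value n x y"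
  using root_poly_permute[OF permutes_swap_id[OF assms], of x]
    root_poly_permute[OF permutes_swap_id[OF assms], of "\<lambda>i. - y i"]
  by (simp_all add: H_value_def comp_def)

lemma schur_identity_transpose_x:
  assumes "i \<in> {1..n}" "j \<in> {1..n}"
  shows "schur_identity n m m' a (x \<circ> transpose i j) y \<longleftrightarrow> schur_identity n m m' a x y"
  unfolding schur_identity_def H_value_transpose[OF assms] vander_transpose[OF assms] sp_sum_transpose_x[OF assms]
  by (simp add: sign_swap_id)

lemma schur_identity_transpose_y:
  assumes "conjugate m m'" "i \<in> {1..n}" "j \<in> {1..n}"
  shows "schur_identity n m m' a x (y \<circ> transpose i j) \<longleftrightarrow> schur_identity n m m' a x y"
  unfolding schur_identity_def H_value_transpose[OF assms(2,3)] vander_transpose[OF assms(2,3)]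
    sp_sum_transpose_y[OF assms(2,3,1)]
  by (simp add: sign_swap_id)

lemma root_poly_Suc: "root_poly v {1..Suc k} = root_poly v {1..k} * [:- v (Suc k), 1:]"
  unfolding root_poly_def by (simp add: prod.nat_ivl_Suc' mult.commute del: mult_pCons_left mult_pCons_right)

lemma root_poly_cong: "(\<And>i. i \<in> A \<Longrightarrow> v i = w i) \<Longrightarrow> root_poly v A = root_poly w A"
  unfolding root_poly_def by (intro prod.cong) auto

lemma H_value_cancel:
  assumes "x (Suc k) + y (Suc k) = 0"
  shows "H_value (Suc k) x y = H_value k x y"
proof -
  have "- (- y (Suc k)) = - x (Suc k)" using assms by (simp add: add_eq_0_iff)
  then show ?thesis
    unfolding H_value_def root_poly_Suc laurent_poly_mult laurent_poly_linear
    by (simp only: mult_divide_mult_cancel_right[OF linear_neq_0])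
qed

lemma vander_update: "vander (Suc k) (x(Suc k := t)) = vander k x * (\<Prod>i=1..k. x i - t)"
  unfolding vander_last
  by (intro arg_cong2[of _ _ _ _ "(*)"] vander_cong prod.cong) auto

text \<open>Opposite values of the last variables cancel in \<open>H(u)\<close>; the alternating sum loses the same factor as
the two Vandermonde products, by \<open>sp_sum_cancel\<close>.\<close>

lemma schur_identity_cancel:
  fixes x y :: "nat \<Rightarrow> 'a::field"
  assumes two: "(2::'a) \<noteq> 0" and m: "conjugate m m'" "m (Suc k) \<le> k"
    and gen: "generic_point k x y" and IH: "schur_identity k m m' a x y"
    and opp: "x (Suc k) + y (Suc k) = 0"
  shows "schur_identity (Suc k) m m' a x y"
proof -
  let ?t = "x (Suc k)"
  have y: "y (Suc k) = - ?t" using opp by (simp add: add_eq_0_iff2)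
  have upd: "x(Suc k := ?t) = x" "y(Suc k := - ?t) = y" using y by auto
  have cancel: "sp_sum (Suc k) m m' a (dual_param a) x y =
      (\<Prod>i=1..k. (x i - ?t) * (y i + ?t)) * sp_sum k m m' a (dual_param a) x y"
    using sp_sum_cancel[OF two m gen, of a "dual_param a" ?t] unfolding upd .
  have vander: "vander (Suc k) x * vander (Suc k) y =
      (\<Prod>i=1..k. (x i - ?t) * (y i + ?t)) * (vander k x * vander k y)"
    using y by (simp add: vander_last prod.distrib mult_ac)
  show ?thesis
    unfolding schur_identity_def H_value_cancel[of x k y, OF opp] cancel vander
      IH[unfolded schur_identity_def, symmetric]
    by (rule mult.left_commute)
qed

lemma generic_point_cong:
  assumes "\<And>i. i \<in> {1..k} \<Longrightarrow> x i = x' i" "\<And>i. i \<in> {1..k} \<Longrightarrow> y i = y' i"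
  shows "generic_point k x y \<longleftrightarrow> generic_point k x' y'"
  unfolding generic_point_def by (simp only: assms cong: ball_cong inj_on_cong)

text \<open>Exchanging a variable with the last one and then dropping the last place amounts to dropping that variable.\<close>

lemma generic_point_drop:
  assumes "generic_point (Suc k) x y" "i \<in> {1..Suc k}" "j \<in> {1..Suc k}"
  shows "generic_point k (x \<circ> transpose i (Suc k)) (y \<circ> transpose j (Suc k))"
proof -
  have inj: "inj_on x {1..Suc k}" "inj_on y {1..Suc k}"
    and nz: "\<And>i. i \<in> {1..Suc k} \<Longrightarrow> x i \<noteq> 0 \<and> y i \<noteq> 0"
    and sum: "\<And>i j. i \<in> {1..Suc k} \<Longrightarrow> j \<in> {1..Suc k} \<Longrightarrow> x i + y j \<noteq> 0"
    using assms(1) unfolding generic_point_def by blast+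
  have img: "transpose l (Suc k) r \<in> {1..Suc k}" if "l \<in> {1..Suc k}" "r \<in> {1..k}" for l r
    using that by (auto simp: transpose_def)
  have inj_comp: "inj_on (v \<circ> transpose l (Suc k)) {1..k}" if "inj_on v {1..Suc k}" "l \<in> {1..Suc k}" for v l
  proof (rule comp_inj_on)
    show "inj_on (transpose l (Suc k)) {1..k}" by (meson inj_on_subset inj_transpose subset_UNIV)
    show "inj_on v (transpose l (Suc k) ` {1..k})"
      using that(1) by (rule inj_on_subset) (use img[OF that(2)] in blast)
  qed
  show ?thesis
    unfolding generic_point_def
    using inj_comp[OF inj(1) assms(2)] inj_comp[OF inj(2) assms(3)] nz sum img[OF assms(2)] img[OF assms(3)]
    by (metis comp_apply)
qed

lemma generic_point_remove:
  assumes "generic_point (Suc k) x y" "p \<in> {1..Suc k}" "r \<in> {1..Suc k}"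
  shows "generic_point k (x \<circ> transpose 1 p \<circ> Suc) (y \<circ> transpose 1 r \<circ> Suc)"
proof -
  have inj: "inj_on x {1..Suc k}" "inj_on y {1..Suc k}"
    and nz: "\<And>i. i \<in> {1..Suc k} \<Longrightarrow> x i \<noteq> 0 \<and> y i \<noteq> 0"
    and sum: "\<And>i j. i \<in> {1..Suc k} \<Longrightarrow> j \<in> {1..Suc k} \<Longrightarrow> x i + y j \<noteq> 0"
    using assms(1) unfolding generic_point_def by blast+
  have img: "(transpose 1 l \<circ> Suc) r \<in> {1..Suc k}" if "l \<in> {1..Suc k}" "r \<in> {1..k}" for l r
    using that by (auto simp: transpose_def)
  have inj_comp: "inj_on (v \<circ> (transpose 1 l \<circ> Suc)) {1..k}" if "inj_on v {1..Suc k}" "l \<in> {1..Suc k}" for v l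
  proof (rule comp_inj_on)
    show "inj_on (transpose 1 l \<circ> Suc) {1..k}"
      by (meson inj_Suc inj_compose inj_on_subset inj_transpose subset_UNIV)
    show "inj_on v ((transpose 1 l \<circ> Suc) ` {1..k})"
      using that(1) by (rule inj_on_subset) (use img[OF that(2)] in blast)
  qed
  show ?thesis
    unfolding generic_point_def comp_assoc
    using inj_comp[OF inj(1) assms(2)] inj_comp[OF inj(2) assms(3)] nz sum img[OF assms(2)] img[OF assms(3)]
    by (metis comp_apply)
qed

lemma polynomial_function_prod_minus: "polynomial_function k (\<lambda>t. \<Prod>i=1..k. c i - t)"
  using polynomial_function_prod[of "{1..k}" "\<lambda>_. Suc 0" "\<lambda>i t. c i - t", OF polynomial_function_linear(4)] by simp

text \<open>The difference of both sides has degree at most \<open>m 1 + k \<le> 2 k\<close> in the last variable of \<open>x\<close>, and it has the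
\<open>2 k + 1\<close> zeros \<open>x i\<close> for \<open>i \<le> k\<close> and \<open>- y j\<close> for \<open>j \<le> k + 1\<close>.\<close>

lemma schur_identity_short_row:
  fixes x y :: "nat \<Rightarrow> 'a::field"
  assumes two: "(2::'a) \<noteq> 0" and m: "conjugate m m'" "m 1 \<le> k"
    and gen: "generic_point (Suc k) x y"
    and IH: "\<And>x y. generic_point k x y \<Longrightarrow> schur_identity k m m' a x (y :: nat \<Rightarrow> 'a)"
  shows "schur_identity (Suc k) m m' a x y"
proof -
  let ?n = "Suc k"
  have m_n: "m ?n \<le> k" using conjugate_antimono[OF m(1), of 1 ?n] m(2) by simp
  define W where "W = laurent_poly (root_poly (\<lambda>i. - y i) {1..?n}) / laurent_poly (root_poly x {1..k})"
  have H_value_t: "H_value ?n (x(?n := t)) y = W / (fls_X_inv + fls_const (- t))" for t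
  proof -
    have "root_poly (x(?n := t)) {1..k} = root_poly x {1..k}" by (rule root_poly_cong) auto
    then show ?thesis unfolding H_value_def W_def root_poly_Suc[of "x(?n := t)"] laurent_poly_mult laurent_poly_linear by simp
  qed
  let ?S = "\<lambda>t. schur_det (row_series m a) (m' 1) (W / (fls_X_inv + fls_const (- t)))"
  let ?D = "\<lambda>t. ?S t * (vander ?n (x(?n := t)) * vander ?n y) - sp_sum ?n m m' a (dual_param a) (x(?n := t)) y"
  have S: "polynomial_function (m 1) ?S"
  proof (rule polynomial_function_schur_det_root)
    fix i l assume "i < m' 1" "l < - int (m 1)"
    have "monic_at (1 + (int (m (Suc i)) - int (Suc i))) (W * row_series m a i)"
      unfolding W_def row_series_def
      using monic_at_divide[OF monic_at_root_poly monic_at_root_poly, of "{1..?n}" "{1..k}" "\<lambda>i. - y i" x]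
      by (intro monic_at_mult monic_at_gen_pow) simp
    moreover have "m (Suc i) \<le> m 1" using conjugate_antimono[OF m(1), of 1 "Suc i"] by simp
    ultimately show "fls_nth (W * row_series m a i) l = 0"
      using \<open>l < - int (m 1)\<close> unfolding monic_at_def by simp
  qed
  have "polynomial_function (m 1 + (k + 0)) (\<lambda>t. ?S t * ((\<Prod>i=1..k. x i - t) * (vander k x * vander ?n y)))"
    by (intro polynomial_function_mult S polynomial_function_prod_minus polynomial_function_const)
  then have D: "polynomial_function (m 1 + k) ?D"
    unfolding vander_update
    using polynomial_function_sp_sum[OF m(1), of ?n ?n a "dual_param a" x y]
    by (intro polynomial_function_diff) (simp_all add: mult_ac add.commute)
  have inj: "inj_on x {1..?n}" "inj_on y {1..?n}"
    and sum: "\<And>i j. i \<in> {1..?n} \<Longrightarrow> j \<in> {1..?n} \<Longrightarrow> x i + y j \<noteq> 0"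
    using gen unfolding generic_point_def by blast+
  let ?Z = "x ` {1..k} \<union> (\<lambda>j. - y j) ` {1..?n}"
  have card: "card ?Z = k + ?n"
    using inj sum by (intro card_union_negated) (auto intro: inj_on_subset)
  have "?D (x ?n) = 0"
  proof (rule polynomial_function_eq_0[OF D, of ?Z])
    show "m 1 + k < card ?Z" unfolding card using m(2) by simp
    fix t assume "t \<in> ?Z"
    then consider i where "i \<in> {1..k}" "t = x i" | j where "j \<in> {1..?n}" "t = - y j" by blast
    then show "?D t = 0"
    proof cases
      case (1 i)
      then have "(\<Prod>i=1..k. x i - t) = 0" by (intro prod_zero) auto
      moreover have "sp_sum ?n m m' a (dual_param a) (x(?n := t)) y = 0"
        unfolding sp_sum_def using 1 by (intro alternating_sum_eq_0[OF two, of i _ ?n]) auto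
      ultimately show ?thesis by (simp add: vander_update)
    next
      case (2 j)
      let ?y = "y \<circ> transpose j ?n"
      have "generic_point k (x \<circ> transpose ?n ?n) ?y"
        using 2 by (intro generic_point_drop gen) simp_all
      moreover have "generic_point k (x \<circ> transpose ?n ?n) ?y \<longleftrightarrow> generic_point k (x(?n := t)) ?y"
        by (intro generic_point_cong) auto
      ultimately have "generic_point k (x(?n := t)) ?y" by blast
      then have "schur_identity ?n m m' a (x(?n := t)) ?y"
        using 2 by (intro schur_identity_cancel two m m_n IH) simp_all
      then have "schur_identity ?n m m' a (x(?n := t)) y"
        using schur_identity_transpose_y[OF m(1) 2(1), of ?n a "x(?n := t)" y] by simp
      then show ?thesis by (simp add: schur_identity_def H_value_t)
    qed
  qed simp
  then show ?thesis
    unfolding schur_identity_def H_value_t[of "x ?n", symmetric] by simp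
qed

text \<open>The same argument in the last variable of \<open>y\<close>. Only the degree bound for the determinant is
different.\<close>

lemma schur_identity_short_column:
  fixes x y :: "nat \<Rightarrow> 'a::field"
  assumes two: "(2::'a) \<noteq> 0" and m: "conjugate m m'" "m' 1 \<le> k"
    and gen: "generic_point (Suc k) x y"
    and IH: "\<And>x y. generic_point k x y \<Longrightarrow> schur_identity k m m' a x (y :: nat \<Rightarrow> 'a)"
  shows "schur_identity (Suc k) m m' a x y"
proof -
  let ?n = "Suc k"
  have m_n: "m ?n \<le> k" using m conjugate_eq_0[OF m(1), of k] by simp
  define W where "W = laurent_poly (root_poly (\<lambda>i. - y i) {1..k}) / laurent_poly (root_poly x {1..?n})"
  have H_value_t: "H_value ?n x (y(?n := t)) = W * (fls_X_inv + fls_const t)" for t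
  proof -
    have "root_poly (\<lambda>i. - (y(?n := t)) i) {1..k} = root_poly (\<lambda>i. - y i) {1..k}"
      by (rule root_poly_cong) auto
    then show ?thesis
      unfolding H_value_def W_def root_poly_Suc[of "\<lambda>i. - (y(?n := t)) i"] laurent_poly_mult laurent_poly_linear by simp
  qed
  let ?S = "\<lambda>t. schur_det (row_series m a) (m' 1) (W * (fls_X_inv + fls_const t))"
  let ?D = "\<lambda>t. ?S t * (vander ?n x * vander ?n (y(?n := t))) - sp_sum ?n m m' a (dual_param a) x (y(?n := t))"
  have "polynomial_function (m' 1 + (k + 0)) (\<lambda>t. ?S t * ((\<Prod>i=1..k. y i - t) * (vander k y * vander ?n x)))"
    by (intro polynomial_function_mult polynomial_function_schur_det_pole polynomial_function_prod_minus polynomial_function_const)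
  moreover have "polynomial_function (m' 1 + k) (\<lambda>t. sp_sum ?n m m' a (dual_param a) x (y(?n := t)))"
    unfolding sp_sum_swap[OF m(1)]
    using polynomial_function_sp_sum[OF conjugate_sym[OF m(1)], of ?n ?n "dual_param a" a y x]
    by (simp add: add.commute)
  ultimately have D: "polynomial_function (m' 1 + k) ?D"
    unfolding vander_update by (intro polynomial_function_diff) (simp_all add: mult_ac)
  have inj: "inj_on x {1..?n}" "inj_on y {1..?n}"
    and sum: "\<And>i j. i \<in> {1..?n} \<Longrightarrow> j \<in> {1..?n} \<Longrightarrow> y i + x j \<noteq> 0"
    using gen unfolding generic_point_def by (blast, blast, metis add.commute)
  let ?Z = "y ` {1..k} \<union> (\<lambda>j. - x j) ` {1..?n}"
  have card: "card ?Z = k + ?n"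
    using inj sum by (intro card_union_negated) (auto intro: inj_on_subset)
  have "?D (y ?n) = 0"
  proof (rule polynomial_function_eq_0[OF D, of ?Z])
    show "m' 1 + k < card ?Z" unfolding card using m(2) by simp
    fix t assume "t \<in> ?Z"
    then consider i where "i \<in> {1..k}" "t = y i" | j where "j \<in> {1..?n}" "t = - x j" by blast
    then show "?D t = 0"
    proof cases
      case (1 i)
      then have "(\<Prod>i=1..k. y i - t) = 0" by (intro prod_zero) auto
      moreover have "sp_sum ?n m m' a (dual_param a) x (y(?n := t)) = 0"
        unfolding sp_sum_swap[OF m(1)] unfolding sp_sum_def
        using 1 by (intro alternating_sum_eq_0[OF two, of i _ ?n]) auto
      ultimately show ?thesis by (simp add: vander_update)
    next
      case (2 j)
      let ?x = "x \<circ> transpose j ?n"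
      have "generic_point k ?x (y \<circ> transpose ?n ?n)"
        using 2 by (intro generic_point_drop gen) simp_all
      moreover have "generic_point k ?x (y \<circ> transpose ?n ?n) \<longleftrightarrow> generic_point k ?x (y(?n := t))"
        by (intro generic_point_cong) auto
      ultimately have "generic_point k ?x (y(?n := t))" by blast
      then have "schur_identity ?n m m' a ?x (y(?n := t))"
        using 2 by (intro schur_identity_cancel two m m_n IH) simp_all
      then have "schur_identity ?n m m' a x (y(?n := t))"
        using schur_identity_transpose_x[OF 2(1), of ?n m m' a x "y(?n := t)"] by simp
      then show ?thesis by (simp add: schur_identity_def H_value_t)
    qed
  qed simp
  then show ?thesis
    unfolding schur_identity_def H_value_t[of "y ?n", symmetric] by simp
qed

lemma vander_remove:
  assumes "p \<in> {1..Suc k}"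
  shows "vander (Suc k) x = of_int (sign (transpose 1 p)) *
    ((\<Prod>q\<in>{1..Suc k} - {p}. x p - x q) * vander k (x \<circ> transpose 1 p \<circ> Suc))"
proof -
  have "vander (Suc k) (x \<circ> transpose 1 p) =
      (\<Prod>i=1..k. x p - (x \<circ> transpose 1 p \<circ> Suc) i) * vander k (x \<circ> transpose 1 p \<circ> Suc)"
    unfolding vander_first by simp
  then have "of_int (sign (transpose 1 p)) * vander (Suc k) x =
      (\<Prod>q\<in>{1..Suc k} - {p}. x p - x q) * vander k (x \<circ> transpose 1 p \<circ> Suc)"
    using vander_transpose[of 1 "Suc k" p x] prod_transpose_Suc[OF assms, of "\<lambda>t. x p - t" x] assms
    by simp
  moreover have "of_int (sign (transpose 1 p)) * (of_int (sign (transpose 1 p)) * c) = c" for c :: 'a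
    unfolding mult.assoc[symmetric] of_int_mult[symmetric] by simp
  ultimately show ?thesis by metis
qed

text \<open>Both sides satisfy the same recursion: the factors \<open>x p - x q\<close> and \<open>y r - y s\<close> in the denominators of the
determinantal one are exactly what the Vandermonde products lose with \<open>x p\<close> and \<open>y r\<close>.\<close>

lemma schur_identity_hook:
  fixes x y :: "nat \<Rightarrow> 'a::field"
  assumes m: "conjugate m m'" "Suc k \<le> m 1" "Suc k \<le> m' 1"
    and gen: "generic_point (Suc k) x y"
    and IH: "\<And>x y. generic_point k x y \<Longrightarrow>
      schur_identity k (remove_hook m) (remove_hook m') a x (y :: nat \<Rightarrow> 'a)"
  shows "schur_identity (Suc k) m m' a x y"
proof -
  let ?I = "{1..Suc k}"
  let ?x = "\<lambda>p. x \<circ> transpose 1 p \<circ> Suc" and ?y = "\<lambda>r. y \<circ> transpose 1 r \<circ> Suc"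
  let ?s = "\<lambda>p. of_int (sign (transpose 1 (p::nat))) :: 'a"
  let ?V = "vander (Suc k) x * vander (Suc k) y"
  let ?\<nu> = "remove_hook m" and ?\<nu>' = "remove_hook m'"
  let ?H = "\<lambda>p r. hook_factor k m m' a (dual_param a) (x p) (y r) (?x p) (?y r)"
  let ?T = "\<lambda>p r. schur_det (row_series ?\<nu> a) (m' 1 - 1) (H_value k (?x p) (?y r))"
  have inj: "inj_on x ?I" "inj_on y ?I" using gen unfolding generic_point_def by blast+
  have rows: "schur_det (row_series ?\<nu> a) (m' 1 - 1) R = schur_det (row_series ?\<nu> a) (?\<nu>' 1) R"
    if "monic_at 0 R" for R
  proof (rule schur_det_rows[OF conjugate_remove_hook[OF m(1)] _ that])
    have "m (Suc (m' 1)) = 0" using conjugate_eq_0[OF m(1)] by blast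
    then show "?\<nu> (Suc (m' 1 - 1)) = 0" using m(3) by (simp add: remove_hook_def)
  qed
  have "schur_det (row_series m a) (m' 1) (H_value (Suc k) x y) * ?V =
    (\<Sum>p\<in>?I. \<Sum>r\<in>?I. ?H p r / ((\<Prod>q\<in>?I - {p}. x p - x q) * (\<Prod>s\<in>?I - {r}. y r - y s)) * ?T p r * ?V)"
    unfolding schur_det_remove_hook[OF m inj] sum_distrib_right ..
  also have "\<dots> = (\<Sum>p\<in>?I. \<Sum>r\<in>?I. ?s p * ?s r * ?H p r * sp_sum k ?\<nu> ?\<nu>' a (dual_param a) (?x p) (?y r))"
  proof (intro sum.cong refl)
    fix p r assume p: "p \<in> ?I" and r: "r \<in> ?I"
    have nz: "(\<Prod>q\<in>?I - {p}. x p - x q) \<noteq> 0" "(\<Prod>s\<in>?I - {r}. y r - y s) \<noteq> 0"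
      using inj p r by (auto dest: inj_onD)
    have "?T p r * (vander k (?x p) * vander k (?y r)) = sp_sum k ?\<nu> ?\<nu>' a (dual_param a) (?x p) (?y r)"
      using IH[OF generic_point_remove[OF gen p r]]
      unfolding schur_identity_def rows[OF monic_at_H_value] .
    then show "?H p r / ((\<Prod>q\<in>?I - {p}. x p - x q) * (\<Prod>s\<in>?I - {r}. y r - y s)) * ?T p r * ?V =
      ?s p * ?s r * ?H p r * sp_sum k ?\<nu> ?\<nu>' a (dual_param a) (?x p) (?y r)"
      unfolding vander_remove[OF p, of x] vander_remove[OF r, of y] using nz by (simp add: field_simps)
  qed
  also have "\<dots> = sp_sum (Suc k) m m' a (dual_param a) x y"
    by (rule sp_sum_remove_hook[OF m, symmetric])
  finally show ?thesis unfolding schur_identity_def .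
qed

text \<open>Induction on \<open>n\<close>. The diagram has no square \<open>(n + 1, n + 1)\<close>. After the removal of a hook it has no square
\<open>(n, n)\<close>, and neither has a diagram with a first row or column shorter than \<open>n\<close>; so the induction hypothesis applies in
all cases.\<close>

theorem schur_identity_at_generic_point:
  fixes x y :: "nat \<Rightarrow> 'a::field"
  assumes two: "(2::'a) \<noteq> 0" and "conjugate m m'" "m (Suc n) \<le> n" "generic_point n x y"
  shows "schur_identity n m m' a x y"
  using assms(2-)
proof (induction n arbitrary: m m' x y)
  case 0
  have "m (Suc 0) = 0" using 0 by simp
  then have "m' 1 = 0" using conjugate_eq_0[OF 0(1), of 0] by simp
  moreover have "vander 0 z = 1" for z :: "nat \<Rightarrow> 'a"
  proof -
    have "{(i, k). 1 \<le> i \<and> i < k \<and> k \<le> (0::nat)} = {}" by auto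
    then show ?thesis unfolding vander_def by (simp only: prod.empty)
  qed
  ultimately show ?case
    by (simp add: schur_identity_def schur_det_def moment_det_def sp_sum_def alternating_sum_def
        sp_term_def squares_def)
next
  case (Suc k)
  show ?case
  proof (cases "Suc k \<le> m 1 \<and> Suc k \<le> m' 1")
    case True
    have "remove_hook m (Suc k) \<le> k" using Suc.prems(2) by (simp add: remove_hook_def)
    with True show ?thesis
      by (intro schur_identity_hook Suc.prems Suc.IH conjugate_remove_hook) auto
  next
    case False
    then consider "m 1 \<le> k" | "m' 1 \<le> k" by linarith
    then show ?thesis
    proof cases
      case 1
      then have "m (Suc k) \<le> k" using conjugate_antimono[OF Suc.prems(1), of 1 "Suc k"] by simp
      then show ?thesis by (intro schur_identity_short_row two Suc.prems 1 Suc.IH)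
    next
      case 2
      then have "m (Suc k) \<le> k" using conjugate_eq_0[OF Suc.prems(1), of k] by simp
      then show ?thesis by (intro schur_identity_short_column two Suc.prems 2 Suc.IH)
    qed
  qed
qed

section \<open>Substitution as a ring homomorphism\<close>

lemma Const_add: "Const (a + b) = Const a + Const b"
  by (simp add: Const_def single_add)

lemma Const_mult: "Const (a * b) = Const a * Const b"
  by (simp add: Const_def mult_single)

lemma Const_0 [simp]: "Const 0 = 0" and Const_1 [simp]: "Const 1 = 1"
  by (simp_all add: Const_def)

lemma Const_uminus: "Const (- a) = - Const a"
  by (simp add: Const_def single_uminus)

lemma Const_of_nat: "Const (of_nat k) = of_nat k"
  by (simp add: Const_def)

definition monomial_value :: "('v \<Rightarrow> 'w cpoly) \<Rightarrow> ('v \<Rightarrow>\<^sub>0 nat) \<Rightarrow> 'w cpoly" where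
  "monomial_value \<sigma> m = (\<Prod>v\<in>Poly_Mapping.keys m. \<sigma> v ^ Poly_Mapping.lookup m v)"

lemma monomial_value_add: "monomial_value \<sigma> (m + m') = monomial_value \<sigma> m * monomial_value \<sigma> m'"
proof -
  let ?A = "Poly_Mapping.keys m \<union> Poly_Mapping.keys m'"
  have expand: "monomial_value \<sigma> p = (\<Prod>v\<in>?A. \<sigma> v ^ Poly_Mapping.lookup p v)"
    if "Poly_Mapping.keys p \<subseteq> ?A" for p
    unfolding monomial_value_def using that
    by (intro prod.mono_neutral_left) (auto simp: in_keys_iff)
  show ?thesis
    using keys_add[of m m'] by (simp add: expand lookup_add power_add prod.distrib)
qed

lemma substitute_alt:
  "substitute \<sigma> f = (\<Sum>m\<in>Poly_Mapping.keys f. Const (Poly_Mapping.lookup f m) * monomial_value \<sigma> m)"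
  by (simp add: substitute_def monomial_value_def)

lemma substitute_add: "substitute \<sigma> (f + g) = substitute \<sigma> f + substitute \<sigma> g"
  unfolding substitute_alt
  by (rule setsum_keys_plus_distrib) (simp_all add: Const_add distrib_right)

lemma substitute_single: "substitute \<sigma> (Poly_Mapping.single m c) = Const c * monomial_value \<sigma> m"
  by (cases "c = 0") (simp_all add: substitute_alt)

lemma substitute_0 [simp]: "substitute \<sigma> 0 = 0"
  by (simp add: substitute_def)

lemma substitute_sum: "substitute \<sigma> (\<Sum>i\<in>A. f i) = (\<Sum>i\<in>A. substitute \<sigma> (f i))"
  by (induction A rule: infinite_finite_induct) (simp_all add: substitute_add)

lemma poly_mapping_as_sum:
  "f = (\<Sum>m\<in>Poly_Mapping.keys f. Poly_Mapping.single m (Poly_Mapping.lookup f m))"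
proof (rule poly_mapping_eqI)
  fix k
  show "Poly_Mapping.lookup f k =
      Poly_Mapping.lookup (\<Sum>m\<in>Poly_Mapping.keys f. Poly_Mapping.single m (Poly_Mapping.lookup f m)) k"
    by (simp add: lookup_sum lookup_single when_def in_keys_iff)
qed

lemma substitute_mult: "substitute \<sigma> (f * g) = substitute \<sigma> f * substitute \<sigma> g"
proof -
  let ?s = "\<lambda>f m. Poly_Mapping.single m (Poly_Mapping.lookup f m)"
  have "f * g = (\<Sum>m\<in>Poly_Mapping.keys f. \<Sum>m'\<in>Poly_Mapping.keys g. ?s f m * ?s g m')"
    by (subst poly_mapping_as_sum[of f], subst poly_mapping_as_sum[of g]) (rule sum_product)
  then have "substitute \<sigma> (f * g) = (\<Sum>m\<in>Poly_Mapping.keys f. \<Sum>m'\<in>Poly_Mapping.keys g.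
      Const (Poly_Mapping.lookup f m * Poly_Mapping.lookup g m') * monomial_value \<sigma> (m + m'))"
    by (simp add: substitute_sum mult_single substitute_single)
  also have "\<dots> = substitute \<sigma> f * substitute \<sigma> g"
    unfolding substitute_alt sum_product
    by (simp add: Const_mult monomial_value_add mult_ac)
  finally show ?thesis .
qed

lemma substitute_Const: "substitute \<sigma> (Const c) = Const c"
  by (simp add: Const_def[of c] substitute_single) (simp add: Const_def monomial_value_def)

lemma substitute_Var: "substitute \<sigma> (Var v) = \<sigma> v"
  by (simp add: Var_def substitute_single monomial_value_def)

interpretation substitute: comm_ring_hom "substitute \<sigma>"
proof
  show "substitute \<sigma> 1 = 1" using substitute_Const[of \<sigma> 1] by simp
qed (simp_all add: substitute_add substitute_mult)

interpretation to_fract: comm_ring_hom "to_fract :: 'a::idom \<Rightarrow> 'a fract"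
  by unfold_locales simp_all

section \<open>The generating series of the complete functions\<close>

definition map_fps :: "('a \<Rightarrow> 'b) \<Rightarrow> 'a fps \<Rightarrow> 'b fps" where
  "map_fps h F = Abs_fps (\<lambda>k. h (F $ k))"

lemma map_fps_nth [simp]: "fps_nth (map_fps h F) k = h (fps_nth F k)"
  by (simp add: map_fps_def)

lemma map_fps_mult:
  assumes "comm_ring_hom h"
  shows "map_fps h (F * G) = map_fps h F * map_fps h G"
proof -
  interpret comm_ring_hom h by fact
  show ?thesis by (rule fps_ext) (simp add: fps_mult_nth hom_distribs)
qed

lemma map_fps_linear:
  assumes "comm_ring_hom h"
  shows "map_fps h (1 + fps_const c * fps_X) = 1 + fps_const (h c) * fps_X"
    "map_fps h (1 - fps_const c * fps_X) = 1 - fps_const (h c) * fps_X"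
proof -
  interpret comm_ring_hom h by fact
  show "map_fps h (1 + fps_const c * fps_X) = 1 + fps_const (h c) * fps_X"
    "map_fps h (1 - fps_const c * fps_X) = 1 - fps_const (h c) * fps_X"
    by (rule fps_ext; simp add: hom_distribs fps_X_def)+
qed

lemma map_fps_1: "comm_ring_hom h \<Longrightarrow> map_fps h 1 = 1"
proof -
  assume "comm_ring_hom h"
  then interpret comm_ring_hom h .
  show ?thesis by (rule fps_ext) simp
qed

lemma map_fps_prod:
  assumes "comm_ring_hom h"
  shows "map_fps h (\<Prod>i\<in>A. F i) = (\<Prod>i\<in>A. map_fps h (F i))"
  using assms by (induction A rule: infinite_finite_induct) (simp_all add: map_fps_1 map_fps_mult)

text \<open>A series is determined by its constant term and its logarithmic derivative.\<close>

lemma fps_log_deriv_unique: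
  fixes F G S :: "'a::{idom, ring_char_0} fps"
  assumes "fps_deriv F = F * S" "fps_deriv G = G * S" "fps_nth F 0 = fps_nth G 0"
  shows "F = G"
proof (rule fps_ext)
  fix n show "fps_nth F n = fps_nth G n"
  proof (induction n rule: less_induct)
    case (less n)
    show ?case
    proof (cases n)
      case (Suc k)
      have "fps_nth (F * S) k = fps_nth (G * S) k"
        unfolding fps_mult_nth using less Suc by (intro sum.cong) auto
      then have "of_nat (Suc k) * fps_nth F (Suc k) = of_nat (Suc k) * fps_nth G (Suc k)"
        unfolding assms(1,2)[symmetric] by simp
      then show ?thesis unfolding Suc by (simp del: of_nat_Suc)
    qed (use assms in simp)
  qed
qed

lemma fps_deriv_prod_log:
  fixes f :: "'b \<Rightarrow> 'a::comm_ring_1 fps"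
  assumes "\<And>i. i \<in> A \<Longrightarrow> fps_deriv (f i) = f i * c i"
  shows "fps_deriv (\<Prod>i\<in>A. f i) = (\<Prod>i\<in>A. f i) * (\<Sum>i\<in>A. c i)"
  using assms by (induction A rule: infinite_finite_induct) (simp_all add: algebra_simps)

text \<open>The logarithm of \<open>H(u)\<close> is \<open>\<Sum> p\<^sub>k u^(- k) / k\<close>, and differentiation with respect to \<open>u\<^sup>-\<^sup>1\<close> removes the
denominators.\<close>

lemma H_series_deriv: "fps_deriv H_series = H_series * Abs_fps (\<lambda>k. psum (Suc k))"
proof -
  let ?E = "Abs_fps (\<lambda>k. Const (1 / fact k)) :: symfun fps"
  let ?L = "Abs_fps (\<lambda>k. if k = 0 then 0 else Const (1 / of_nat k) * psum k)"
  have cancel: "of_nat (Suc k) * Const (c / of_nat (Suc k)) = (Const c :: symfun)" for k c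
    unfolding Const_of_nat[symmetric] Const_mult[symmetric] by (simp del: of_nat_Suc)
  have "fps_deriv ?E = ?E"
  proof (rule fps_ext)
    fix k
    have "(1::complex) / fact (Suc k) = (1 / fact k) / of_nat (Suc k)" by simp
    then show "fps_nth (fps_deriv ?E) k = fps_nth ?E k"
      by (simp only: fps_deriv_nth fps_nth_Abs_fps Suc_eq_plus1[symmetric] cancel)
  qed
  moreover have "fps_deriv ?L = Abs_fps (\<lambda>k. psum (Suc k))"
  proof (rule fps_ext)
    fix k
    show "fps_nth (fps_deriv ?L) k = fps_nth (Abs_fps (\<lambda>k. psum (Suc k))) k"
      using cancel[of k 1] by (simp add: mult.assoc[symmetric] del: of_nat_Suc)
  qed
  ultimately show ?thesis
    unfolding H_series_def by (subst fps_compose_deriv) simp_all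
qed

lemma super_eval_psum:
  "super_eval n (psum (Suc k)) = (\<Sum>i=1..n. xv i ^ Suc k) + (-1) ^ k * (\<Sum>i=1..n. yv i ^ Suc k)"
  by (simp add: super_eval_def psum_def substitute_Var)

lemma comm_ring_hom_super_eval: "comm_ring_hom (super_eval n)"
  unfolding super_eval_def by (rule substitute.comm_ring_hom_axioms)

lemma super_eval_Const: "super_eval n (Const c) = Const c"
  by (simp add: super_eval_def substitute_Const)

text \<open>This is \<open>H(u) = \<Prod>(u + y\<^sub>i) / \<Prod>(u - x\<^sub>i)\<close> in the variable \<open>u\<^sup>-\<^sup>1\<close>, without denominators. The power sum of
degree \<open>k + 1\<close> is sent to the coefficient of \<open>u^(- k)\<close> in the logarithmic derivative of this quotient with respect to
\<open>u\<^sup>-\<^sup>1\<close>, so that both sides of the identity have the same logarithmic derivative.\<close>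

lemma super_eval_H_series:
  "map_fps (super_eval n) H_series * (\<Prod>i=1..n. 1 - fps_const (xv i) * fps_X) =
    (\<Prod>i=1..n. 1 + fps_const (yv i) * fps_X)"
proof -
  interpret comm_ring_hom "super_eval n" by (rule comm_ring_hom_super_eval)
  let ?H = "map_fps (super_eval n) H_series"
  let ?A = "\<Prod>i=1..n. 1 - fps_const (xv i) * fps_X" and ?B = "\<Prod>i=1..n. 1 + fps_const (yv i) * fps_X"
  define X where "X i = Abs_fps (\<lambda>k. xv i ^ Suc k)" for i
  define Y where "Y i = Abs_fps (\<lambda>k. (-1) ^ k * yv i ^ Suc k)" for i
  have A: "fps_deriv ?A = ?A * (\<Sum>i=1..n. - X i)"
  proof (rule fps_deriv_prod_log)
    fix i
    have "(1 - fps_const (xv i) * fps_X) * X i = fps_const (xv i)"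
      by (rule fps_ext) (simp add: X_def left_diff_distrib mult.assoc fps_X_mult_nth power_eq_if)
    then show "fps_deriv (1 - fps_const (xv i) * fps_X) = (1 - fps_const (xv i) * fps_X) * - X i"
      by simp
  qed
  have B: "fps_deriv ?B = ?B * (\<Sum>i=1..n. Y i)"
  proof (rule fps_deriv_prod_log)
    fix i
    have "(1 + fps_const (yv i) * fps_X) * Y i = fps_const (yv i)"
    proof (rule fps_ext)
      fix k show "fps_nth ((1 + fps_const (yv i) * fps_X) * Y i) k = fps_nth (fps_const (yv i)) k"
        by (cases k) (simp_all add: Y_def distrib_right mult.assoc)
    qed
    then show "fps_deriv (1 + fps_const (yv i) * fps_X) = (1 + fps_const (yv i) * fps_X) * Y i"
      by simp
  qed
  have "map_fps (super_eval n) (Abs_fps (\<lambda>k. psum (Suc k))) = (\<Sum>i=1..n. X i) + (\<Sum>i=1..n. Y i)"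
    by (rule fps_ext) (simp add: super_eval_psum fps_sum_nth X_def Y_def sum_distrib_left del: power_Suc)
  moreover have "fps_deriv ?H = map_fps (super_eval n) (fps_deriv H_series)"
    by (rule fps_ext) (simp add: hom_distribs)
  ultimately have H: "fps_deriv ?H = ?H * ((\<Sum>i=1..n. X i) + (\<Sum>i=1..n. Y i))"
    by (simp add: H_series_deriv map_fps_mult[OF comm_ring_hom_super_eval])
  show ?thesis
  proof (rule fps_log_deriv_unique[OF _ B])
    show "fps_deriv (?H * ?A) = ?H * ?A * (\<Sum>i=1..n. Y i)"
      unfolding fps_deriv_mult A H sum_negf by (simp add: algebra_simps)
    have "fps_nth (\<Prod>i\<in>S. f i) 0 = 1" if "\<And>i. fps_nth (f i) 0 = 1"
      for S :: "nat set" and f :: "nat \<Rightarrow> xy cpoly fps"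
      using that by (induction S rule: infinite_finite_induct) simp_all
    then show "fps_nth (?H * ?A) 0 = fps_nth ?B 0"
      by (simp add: H_series_nth_0)
  qed
qed

section \<open>Multiparameter Schur functions as residue determinants\<close>

definition specialize :: "nat \<Rightarrow> symfun \<Rightarrow> xy cpoly fract" where
  "specialize n f = to_fract (super_eval n f)"

abbreviation xf :: "nat \<Rightarrow> xy cpoly fract" where "xf i \<equiv> to_fract (xv i)"
abbreviation yf :: "nat \<Rightarrow> xy cpoly fract" where "yf i \<equiv> to_fract (yv i)"
abbreviation cf :: "complex \<Rightarrow> xy cpoly fract" where "cf c \<equiv> to_fract (Const c)"

lemma comm_ring_hom_specialize: "comm_ring_hom (specialize n)"
proof -
  interpret comm_ring_hom "super_eval n" by (rule comm_ring_hom_super_eval)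
  show ?thesis unfolding specialize_def by unfold_locales (simp_all add: hom_distribs)
qed

lemma map_fps_specialize: "map_fps (specialize n) F = map_fps to_fract (map_fps (super_eval n) F)"
  by (rule fps_ext) (simp add: specialize_def)

lemma X_inv_times_X: "fls_X_inv * fls_X = (1 :: 'a::field fls)"
  by (simp add: fls_X_inv_times_conv_shift fls_X_conv_shift_1)

text \<open>Passing from polynomials in \<open>u\<close> to polynomials in \<open>u\<^sup>-\<^sup>1\<close>.\<close>

lemma prod_homogenize:
  "(\<Prod>i\<in>A. fls_X_inv + fls_const (c i)) =
    fls_X_inv ^ card A * fps_to_fls (\<Prod>i\<in>A. 1 + fps_const (c i) * fps_X :: 'a::field fps)"
proof -
  have "fls_X_inv + fls_const c = fls_X_inv * fps_to_fls (1 + fps_const c * fps_X)" for c :: 'a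
    by (simp add: fls_times_fps_to_fls distrib_left mult.left_commute[of fls_X_inv] X_inv_times_X)
  then show ?thesis
    by (induction A rule: infinite_finite_induct) (simp_all add: fls_times_fps_to_fls mult_ac)
qed

lemma specialize_H_series: "fps_to_fls (map_fps (specialize n) H_series) = H_value n xf yf"
proof -
  let ?H = "map_fps (specialize n) H_series"
  let ?I = "{1..n}"
  have neg: "1 + fps_const (- c) * fps_X = 1 - fps_const c * fps_X" for c :: "xy cpoly fract"
    by (simp flip: fps_const_neg)
  have "?H * (\<Prod>i=1..n. 1 + fps_const (- xf i) * fps_X) = (\<Prod>i=1..n. 1 + fps_const (yf i) * fps_X)"
    using arg_cong[OF super_eval_H_series[of n], of "map_fps to_fract"]
    by (simp add: neg map_fps_specialize map_fps_mult[OF to_fract.comm_ring_hom_axioms]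
        map_fps_prod[OF to_fract.comm_ring_hom_axioms] map_fps_linear[OF to_fract.comm_ring_hom_axioms])
  then have "fps_to_fls (?H * (\<Prod>i=1..n. 1 + fps_const (- xf i) * fps_X)) =
      fps_to_fls (\<Prod>i=1..n. 1 + fps_const (yf i) * fps_X)"
    by (rule arg_cong)
  then have "fps_to_fls ?H * fps_to_fls (\<Prod>i=1..n. 1 + fps_const (- xf i) * fps_X) =
      fps_to_fls (\<Prod>i=1..n. 1 + fps_const (yf i) * fps_X)"
    unfolding fls_times_fps_to_fls .
  then have "fps_to_fls ?H * (\<Prod>i\<in>?I. fls_X_inv + fls_const (- xf i)) =
      (\<Prod>i\<in>?I. fls_X_inv + fls_const (yf i))"
    unfolding prod_homogenize mult.left_commute[of "fps_to_fls ?H"] by (rule arg_cong)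
  moreover have "(\<Prod>i\<in>?I. fls_X_inv + fls_const (- xf i)) \<noteq> 0"
    by (simp del: fls_const_uminus)
  ultimately show ?thesis
    unfolding H_value_def root_poly_def laurent_poly_prod laurent_poly_linear by (simp add: eq_divide_eq)
qed

lemma map_fps_X_power:
  assumes "comm_ring_hom h"
  shows "map_fps h (fps_X ^ k) = fps_X ^ k"
proof -
  interpret comm_ring_hom h by fact
  show ?thesis by (rule fps_ext) (simp add: fps_X_power_nth)
qed

lemma multi_h_expansion:
  "(\<Sum>k\<le>n. multi_h b (int k) * fps_nth (inv_falling b k) n) = fps_nth H_series n"
proof -
  have "is_h_seq b (THE h. is_h_seq b h)"
    by (rule theI'[OF ex1_h_seq])
  then have "is_h_seq b (\<lambda>k. multi_h b (int k))"
    by (simp add: multi_h_def)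
  then show ?thesis by (simp add: is_h_seq_iff)
qed

text \<open>The series \<open>inv_falling b k\<close> is \<open>1 / (u|b)^k\<close>.\<close>

lemma specialize_inv_falling:
  "fps_to_fls (map_fps (specialize n) (inv_falling b k)) = inverse (gen_pow (\<lambda>i. cf (b i)) (int k))"
proof -
  let ?F = "map_fps (specialize n) (inv_falling b k)"
  have X_pow: "map_fps (specialize n) (fps_X ^ k) = fps_X ^ k"
    by (rule map_fps_X_power[OF comm_ring_hom_specialize])
  have neg: "1 + fps_const (- c) * fps_X = 1 - fps_const c * fps_X" for c :: "xy cpoly fract"
    by (simp flip: fps_const_neg)
  have "?F * (\<Prod>i=1..k. 1 + fps_const (- cf (b (int i))) * fps_X) = fps_X ^ k"
    using arg_cong[OF inv_falling_inverse[of b k], of "map_fps (specialize n)"]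
    by (simp add: neg X_pow map_fps_mult[OF comm_ring_hom_specialize] map_fps_prod[OF comm_ring_hom_specialize]
        map_fps_linear[OF comm_ring_hom_specialize] specialize_def super_eval_Const)
  then have "fps_to_fls (?F * (\<Prod>i=1..k. 1 + fps_const (- cf (b (int i))) * fps_X)) = fps_to_fls (fps_X ^ k)"
    by (rule arg_cong)
  then have "fps_to_fls ?F * fps_to_fls (\<Prod>i=1..k. 1 + fps_const (- cf (b (int i))) * fps_X) = fls_X ^ k"
    unfolding fls_times_fps_to_fls fps_to_fls_power fps_X_to_fls .
  moreover have "fls_X_inv ^ k * fls_X ^ k = (1 :: xy cpoly fract fls)"
    unfolding power_mult_distrib[symmetric] X_inv_times_X by simp
  moreover have "gen_pow (\<lambda>i. cf (b i)) (int k) =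
      fls_X_inv ^ k * fps_to_fls (\<Prod>i=1..k. 1 + fps_const (- cf (b (int i))) * fps_X)"
    using prod_homogenize[of "\<lambda>i. - cf (b (int i))" "{1..k}"]
    by (simp add: gen_pow_def laurent_poly_prod laurent_poly_linear del: fls_const_uminus)
  ultimately have "fps_to_fls ?F * gen_pow (\<lambda>i. cf (b i)) (int k) = 1"
    by (simp add: mult.left_commute)
  then show ?thesis by (metis inverse_unique mult.commute)
qed

lemma gen_pow_nat_split:
  "j \<le> k \<Longrightarrow> gen_pow a (int k) = gen_pow a (int j) * laurent_poly (\<Prod>l=Suc j..k. [:- a (int l), 1:])"
proof -
  assume "j \<le> k"
  then have "{1..k} = {1..j} \<union> {Suc j..k}" by auto
  then have "(\<Prod>l=1..k. [:- a (int l), 1:]) = (\<Prod>l=1..j. [:- a (int l), 1:]) * (\<Prod>l=Suc j..k. [:- a (int l), 1:])"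
    by (simp only:) (rule prod.union_disjoint, auto)
  then show ?thesis by (simp add: gen_pow_def laurent_poly_mult)
qed

text \<open>Multiply the expansion of \<open>H(u)\<close> by \<open>(u|b)^(e - 1)\<close>: the terms with \<open>j < e\<close> become polynomials, the
term with \<open>j = e\<close> becomes \<open>h\<^sub>e\<^sub>;\<^sub>b / (u - b\<^sub>e)\<close>, and those with \<open>j > e\<close> have degree at most
\<open>-2\<close> in \<open>u\<close>.\<close>

lemma residue_multi_h:
  "residue (H_value n xf yf * gen_pow (\<lambda>i. cf (b i)) (e - 1)) = specialize n (multi_h b e)"
proof -
  interpret comm_ring_hom "specialize n" by (rule comm_ring_hom_specialize)
  let ?g = "gen_pow (\<lambda>i. cf (b i))"
  have monic: "monic_at (e - 1) (H_value n xf yf * ?g (e - 1))"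
  proof -
    have "monic_at (0 + (e - 1)) (H_value n xf yf * ?g (e - 1))"
      by (intro monic_at_mult monic_at_H_value monic_at_gen_pow)
    then show ?thesis by simp
  qed
  show ?thesis
  proof (cases "e < 0")
    case True
    then show ?thesis using residue_monic_0[OF monic] by (simp add: multi_h_def)
  next
    case False
    then obtain k where e: "e = int k" by (metis nonneg_int_cases not_less)
    let ?h = "\<lambda>j. specialize n (multi_h b (int j))"
    \<comment> \<open>The remainder after the terms with \<open>j \<le> k\<close> has degree at most \<open>- k - 1\<close> in \<open>u\<close>.\<close>
    define T where "T = H_value n xf yf - (\<Sum>j\<le>k. fls_const (?h j) * inverse (?g (int j)))"
    have inv_nth: "fls_nth (inverse (?g (int j))) i =
        (if i < 0 then 0 else specialize n (fps_nth (inv_falling b j) (nat i)))" for i j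
      unfolding specialize_inv_falling[of n, symmetric] by simp
    have H_value_nth: "fls_nth (H_value n xf yf) i =
        (if i < 0 then 0 else specialize n (fps_nth H_series (nat i)))" for i
      unfolding specialize_H_series[symmetric] by simp
    have T: "fls_nth T i = 0" if "i \<le> int k" for i
    proof (cases "i < 0")
      case True
      then show ?thesis by (simp add: T_def fls_nth_sum inv_nth H_value_nth)
    next
      case False
      let ?l = "nat i"
      have "(\<Sum>j\<le>k. ?h j * specialize n (fps_nth (inv_falling b j) ?l)) =
          (\<Sum>j\<le>?l. ?h j * specialize n (fps_nth (inv_falling b j) ?l))"
      proof (rule sum.mono_neutral_right)
        show "{..?l} \<subseteq> {..k}" using that False by auto
        show "\<forall>j\<in>{..k} - {..?l}. ?h j * specialize n (fps_nth (inv_falling b j) ?l) = 0"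
          by (simp add: inv_falling_nth)
      qed simp
      also have "\<dots> = specialize n (\<Sum>j\<le>?l. multi_h b (int j) * fps_nth (inv_falling b j) ?l)"
        by (simp only: hom_sum hom_mult)
      also have "\<dots> = specialize n (fps_nth H_series ?l)"
        by (simp only: multi_h_expansion)
      finally show ?thesis
        using False by (simp add: T_def fls_nth_sum inv_nth H_value_nth)
    qed
    have "residue (T * ?g (int k - 1)) = 0"
    proof (cases "T = 0")
      case False
      then have "int k + 1 \<le> fls_subdegree T" using T by (intro fls_subdegree_geI) auto
      moreover have "fls_subdegree (?g (int k - 1)) = - (int k - 1)"
        using monic_at_gen_pow[of "int k - 1" "\<lambda>i. cf (b i)"] by (simp add: monic_at_iff)
      ultimately show ?thesis by (intro fls_times_nth_eq0) simp
    qed simp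
    moreover have "residue (inverse (?g (int j)) * ?g (int k - 1)) = (if j = k then 1 else 0)" if "j \<le> k" for j
    proof (cases "j = k")
      case True
      have "monic_at (- int k + (int k - 1)) (inverse (?g (int k)) * ?g (int k - 1))"
        by (intro monic_at_mult monic_at_inverse monic_at_gen_pow)
      then show ?thesis using True by (simp add: residue_monic)
    next
      case False
      then have "?g (int k - 1) = ?g (int (k - 1))" "j \<le> k - 1" using that by (simp_all add: of_nat_diff)
      moreover have "?g (int j) \<noteq> 0"
        using monic_at_gen_pow[of "int j" "\<lambda>i. cf (b i)"] unfolding monic_at_iff by blast
      ultimately have "inverse (?g (int j)) * ?g (int k - 1) = laurent_poly (\<Prod>l=Suc j..k - 1. [:- cf (b (int l)), 1:])"
        using gen_pow_nat_split[of j "k - 1" "\<lambda>i. cf (b i)"] by simp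
      then show ?thesis using False by (simp add: laurent_poly_nth_pos)
    qed
    moreover have "H_value n xf yf * ?g (int k - 1) = T * ?g (int k - 1) +
        (\<Sum>j\<le>k. fls_const (?h j) * (inverse (?g (int j)) * ?g (int k - 1)))"
      by (simp add: T_def left_diff_distrib sum_distrib_right mult.assoc)
    ultimately have "residue (H_value n xf yf * ?g (int k - 1)) = (\<Sum>j\<le>k. ?h j * (if j = k then 1 else 0))"
      by (simp add: fls_nth_sum)
    also have "\<dots> = (\<Sum>j\<le>k. if j = k then ?h k else 0)"
      by (intro sum.cong) auto
    also have "\<dots> = ?h k" by simp
    finally show ?thesis by (simp only: e)
  qed
qed

text \<open>Column \<open>j\<close> of the Jacobi-Trudi matrix, counted from 0, consists of the values of the row functionals at the
monic polynomial \<open>(u - a\<^sub>0) (u - a\<^sub>-\<^sub>1) ...\<close> of degree \<open>j\<close> supplied by \<open>gen_pow_shift\<close>.\<close>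

lemma specialize_multi_schur:
  "specialize n (multi_schur N \<mu> a) =
    schur_det (row_series (part \<mu>) (\<lambda>i. cf (a i))) N (H_value n xf yf)"
proof -
  interpret comm_ring_hom "specialize n" by (rule comm_ring_hom_specialize)
  let ?R = "H_value n xf yf" and ?a = "\<lambda>i. cf (a i)"
  let ?E = "\<lambda>j. \<Prod>l<j. [:- ?a (- int l), 1:]"
  have entry: "specialize n (multi_h (shift (1 - int (j + 1)) a) (int (part \<mu> (i + 1)) - int (i + 1) + int (j + 1))) =
      residue (?R * row_series (part \<mu>) ?a i * laurent_poly (?E j))" for i j
  proof -
    let ?e = "int (part \<mu> (i + 1)) - int (i + 1)"
    have shift: "shift (1 - int (j + 1)) a = (\<lambda>l. a (l - int j))"
      unfolding shift_def by (rule ext, rule arg_cong[of _ _ a]) simp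
    have "?e + int (j + 1) - 1 = ?e + int j" by simp
    then have "specialize n (multi_h (shift (1 - int (j + 1)) a) (?e + int (j + 1))) =
        residue (?R * gen_pow (\<lambda>l. ?a (l - int j)) (?e + int j))"
      unfolding shift using residue_multi_h[of n "\<lambda>l. a (l - int j)" "?e + int (j + 1)"] by metis
    then show ?thesis
      unfolding gen_pow_shift[of ?a] row_series_def by (simp only: mult.assoc Suc_eq_plus1)
  qed
  have "specialize n (multi_schur N \<mu> a) = det (map_mat (specialize n) (mat N N (\<lambda>(i, j).
     multi_h (shift (1 - int (j + 1)) a) (int (part \<mu> (i + 1)) - int (i + 1) + int (j + 1)))))"
    unfolding multi_schur_def by (rule hom_det[symmetric])
  also have "\<dots> = det (mat N N (\<lambda>(i, j). residue (?R * row_series (part \<mu>) ?a i * laurent_poly (?E j))))"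
    using entry by (intro arg_cong[of _ _ det] eq_matI) auto
  also have "\<dots> = schur_det (row_series (part \<mu>) ?a) N ?R"
    unfolding schur_det_def
    using degree_root_poly[of "\<lambda>l. ?a (- int l)" "{..<_}"] lead_coeff_root_poly[of "\<lambda>l. ?a (- int l)" "{..<_}"]
    by (intro det_monic_basis[where p = ?E] linear_functional_residue) (simp_all add: root_poly_def)
  finally show ?thesis .
qed

section \<open>Partitions and their transposes\<close>

lemma part_antimono: "is_partition \<mu> \<Longrightarrow> 1 \<le> i \<Longrightarrow> i \<le> k \<Longrightarrow> part \<mu> k \<le> part \<mu> i"
  unfolding is_partition_def part_def
  by (cases "i = k") (auto simp: sorted_wrt_iff_nth_less)

lemma part_beyond_length: "length \<mu> < i \<Longrightarrow> part \<mu> i = 0"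
  by (simp add: part_def)

text \<open>Both the columns and the diagonal of a diagram are initial segments of the positive integers, given by their
numbers of elements.\<close>

lemma initial_segment_card:
  fixes P :: "nat \<Rightarrow> bool"
  assumes fin: "finite {i. 1 \<le> i \<and> P i}" and down: "\<And>i k. 1 \<le> i \<Longrightarrow> i \<le> k \<Longrightarrow> P k \<Longrightarrow> P i"
    and "1 \<le> i"
  shows "P i \<longleftrightarrow> i \<le> card {i. 1 \<le> i \<and> P i}"
proof
  assume "P i"
  then have "{1..i} \<subseteq> {i. 1 \<le> i \<and> P i}" using down by auto
  then have "card {1..i} \<le> card {i. 1 \<le> i \<and> P i}" by (rule card_mono[OF fin])
  then show "i \<le> card {i. 1 \<le> i \<and> P i}" by simp
next
  assume le: "i \<le> card {i. 1 \<le> i \<and> P i}"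
  show "P i"
  proof (rule ccontr)
    assume "\<not> P i"
    then have "k < i" if "P k" for k
      using down[of i k] \<open>1 \<le> i\<close> that by (cases "i \<le> k") auto
    then have "{i. 1 \<le> i \<and> P i} \<subseteq> {1..<i}" by auto
    then have "card {i. 1 \<le> i \<and> P i} \<le> card {1..<i}" by (intro card_mono) auto
    with le \<open>1 \<le> i\<close> show False by simp
  qed
qed

lemma conjugate_part:
  assumes "is_partition \<mu>"
  shows "conjugate (part \<mu>) (part_transp \<mu>)"
  unfolding conjugate_def
proof (intro allI impI)
  fix i j :: nat assume ij: "1 \<le> i" "1 \<le> j"
  have eq: "{i. (i, j) \<in> diagram \<mu>} = {i. 1 \<le> i \<and> j \<le> part \<mu> i}"
    using ij by (auto simp: diagram_def)
  have "finite {i. 1 \<le> i \<and> j \<le> part \<mu> i}"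
    by (rule finite_subset[of _ "{..length \<mu>}"]) (use ij in \<open>auto simp: part_def split: if_splits\<close>)
  then show "j \<le> part \<mu> i \<longleftrightarrow> i \<le> part_transp \<mu> j"
    unfolding part_transp_def eq
  proof (rule initial_segment_card[where P = "\<lambda>i. j \<le> part \<mu> i", OF _ _ ij(1)])
    fix i k :: nat assume "1 \<le> i" "i \<le> k" "j \<le> part \<mu> k"
    then show "j \<le> part \<mu> i" using part_antimono[OF assms, of i k] by linarith
  qed
qed

lemma diag_length_iff:
  assumes "is_partition \<mu>" "1 \<le> i"
  shows "i \<le> part \<mu> i \<longleftrightarrow> i \<le> diag_length \<mu>"
proof -
  have eq: "{i. (i, i) \<in> diagram \<mu>} = {i. 1 \<le> i \<and> i \<le> part \<mu> i}"
    by (auto simp: diagram_def)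
  have "finite {i. 1 \<le> i \<and> i \<le> part \<mu> i}"
    by (rule finite_subset[of _ "{..length \<mu>}"]) (auto simp: part_def split: if_splits)
  then show ?thesis
    unfolding diag_length_def eq
  proof (rule initial_segment_card[where P = "\<lambda>i. i \<le> part \<mu> i", OF _ _ assms(2)])
    fix i k :: nat assume "1 \<le> i" "i \<le> k" "k \<le> part \<mu> k"
    then show "i \<le> part \<mu> i" using part_antimono[OF assms(1), of i k] by linarith
  qed
qed

section \<open>The formula for polynomials\<close>

lemma Const_hat: "Const (hat a i) = dual_param (\<lambda>i. Const (a i)) i"
  by (simp add: hat_def dual_param_def Const_uminus add.commute)

lemma f_poly_eq_sp_term:
  assumes \<mu>: "is_partition \<mu>" and d: "diag_length \<mu> \<le> n"
  shows "f_poly n \<mu> a = sp_term n (part \<mu>) (part_transp \<mu>) (\<lambda>i. Const (a i))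
    (dual_param (\<lambda>i. Const (a i))) xv yv"
proof -
  let ?m = "part \<mu>" and ?m' = "part_transp \<mu>" and ?a = "\<lambda>i. Const (a i)" and ?d = "diag_length \<mu>"
  have diag: "i \<le> ?m i \<longleftrightarrow> i \<le> ?d" "i \<le> ?m' i \<longleftrightarrow> i \<le> ?d" if "1 \<le> i" for i
    using diag_length_iff[OF \<mu> that] conjugateD[OF conjugate_part[OF \<mu>] that that] by blast+
  have split: "(\<Prod>i=1..n. f i) = (\<Prod>i=1..?d. f i) * (\<Prod>i=?d + 1..n. f i)" for f :: "nat \<Rightarrow> xy cpoly"
  proof -
    have "{1..n} = {1..?d} \<union> {?d + 1..n}" using d by auto
    then show ?thesis by (simp only:) (rule prod.union_disjoint, auto)
  qed
  have "(\<Prod>i=1..n. row_factor n ?m ?a i (xv i)) * (\<Prod>i=1..n. row_factor n ?m' (dual_param ?a) i (yv i)) =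
      (\<Prod>i=1..n. row_factor n ?m ?a i (xv i) * row_factor n ?m' (dual_param ?a) i (yv i))"
    by (rule prod.distrib[symmetric])
  also have "\<dots> =
      (\<Prod>i=1..?d. gen_power (xv i) a (?m i - i) * xv i ^ (n - ?m i) *
        gen_power (yv i) (hat a) (?m' i - i) * yv i ^ (n - ?m' i)) *
      (\<Prod>i=?d + 1..n. xv i ^ (n - i) * yv i ^ (n - i))"
    unfolding split[of "\<lambda>i. row_factor n ?m ?a i (xv i) * row_factor n ?m' (dual_param ?a) i (yv i)"]
    by (rule arg_cong2[of _ _ _ _ "(*)"]; rule prod.cong[OF refl])
      (simp_all add: row_factor_def diag gen_power_def Const_hat mult.assoc)
  finally have "(\<Prod>i=1..n. row_factor n ?m ?a i (xv i)) * (\<Prod>i=1..n. row_factor n ?m' (dual_param ?a) i (yv i)) =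
      (\<Prod>i=1..?d. gen_power (xv i) a (?m i - i) * xv i ^ (n - ?m i) *
        gen_power (yv i) (hat a) (?m' i - i) * yv i ^ (n - ?m' i)) *
      (\<Prod>i=?d + 1..n. xv i ^ (n - i) * yv i ^ (n - i))" .
  moreover have "{(i, j). i \<le> n \<and> j \<le> n \<and> (i, j) \<in> diagram \<mu>} = squares n ?m"
    by (auto simp: squares_def diagram_def)
  ultimately show ?thesis
    unfolding f_poly_def sp_term_def by (simp add: mult.assoc)
qed

lemma sp_term_hom:
  assumes "comm_ring_hom h"
  shows "h (sp_term n m m' a b x y) =
    sp_term n m m' (\<lambda>i. h (a i)) (\<lambda>i. h (b i)) (\<lambda>i. h (x i)) (\<lambda>i. h (y i))"
proof -
  interpret comm_ring_hom h by fact
  have row: "h (row_factor n m a i t) = row_factor n m (\<lambda>i. h (a i)) i (h t)" for m a i t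
    by (simp add: row_factor_def hom_distribs)
  show ?thesis by (simp add: sp_term_def hom_distribs row case_prod_beta)
qed

lemma to_fract_act_f_poly:
  assumes "is_partition \<mu>" "diag_length \<mu> \<le> n"
  shows "to_fract (act w (f_poly n \<mu> a)) = sp_term n (part \<mu>) (part_transp \<mu>) (\<lambda>i. cf (a i))
    (dual_param (\<lambda>i. cf (a i))) (xf \<circ> fst w) (yf \<circ> snd w)"
proof -
  have "comm_ring_hom (act w)" unfolding act_def by (rule substitute.comm_ring_hom_axioms)
  then have "act w (f_poly n \<mu> a) = sp_term n (part \<mu>) (part_transp \<mu>) (\<lambda>i. act w (Const (a i)))
      (\<lambda>i. act w (dual_param (\<lambda>i. Const (a i)) i)) (\<lambda>i. act w (xv i)) (\<lambda>i. act w (yv i))"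
    unfolding f_poly_eq_sp_term[OF assms] by (rule sp_term_hom)
  also have "\<dots> = sp_term n (part \<mu>) (part_transp \<mu>) (\<lambda>i. Const (a i))
      (dual_param (\<lambda>i. Const (a i))) (\<lambda>i. xv (fst w i)) (\<lambda>i. yv (snd w i))"
  proof -
    have "(\<lambda>i. act w (dual_param (\<lambda>i. Const (a i)) i)) = dual_param (\<lambda>i. Const (a i))"
      by (simp add: fun_eq_iff act_def dual_param_def substitute.hom_uminus substitute_Const)
    then show ?thesis by (simp add: act_def substitute_Const substitute_Var)
  qed
  finally have "to_fract (act w (f_poly n \<mu> a)) = sp_term n (part \<mu>) (part_transp \<mu>) (\<lambda>i. cf (a i))
      (\<lambda>i. to_fract (dual_param (\<lambda>i. Const (a i)) i)) (\<lambda>i. xf (fst w i)) (\<lambda>i. yf (snd w i))"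
    by (simp only: sp_term_hom[OF to_fract.comm_ring_hom_axioms])
  moreover have "(\<lambda>i. to_fract (dual_param (\<lambda>i. Const (a i)) i)) = dual_param (\<lambda>i. cf (a i))"
    by (simp add: fun_eq_iff dual_param_def)
  ultimately show ?thesis by (simp add: comp_def)
qed

lemma to_fract_numerator:
  assumes "is_partition \<mu>" "diag_length \<mu> \<le> n"
  shows "to_fract (\<Sum>w\<in>{p. p permutes {1..n}} \<times> {p. p permutes {1..n}}.
      of_int (eps w) * act w (f_poly n \<mu> a)) =
    sp_sum n (part \<mu>) (part_transp \<mu>) (\<lambda>i. cf (a i)) (dual_param (\<lambda>i. cf (a i))) xf yf"
  unfolding sp_sum_def alternating_sum_def sum_distrib_left sum.cartesian_product
  by (simp add: to_fract.hom_sum to_fract_act_f_poly[OF assms] eps_def to_fract.hom_of_int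
      case_prod_beta mult.assoc)

lemma to_fract_vandermonde: "to_fract (vandermonde n z) = vander n (\<lambda>i. to_fract (z i))"
  by (simp add: vandermonde_def vander_def to_fract.hom_prod case_prod_beta)

lemma Var_neq_0: "Var v \<noteq> (0 :: 'v cpoly)"
  by (metis Var_def lookup_single_eq lookup_zero one_neq_zero)

text \<open>Together with \<open>Var_neq\<close>, this puts the point formed by the variables in general position.\<close>

lemma Var_add_neq_0: "v \<noteq> w \<Longrightarrow> Var v + Var w \<noteq> (0 :: 'v cpoly)"
proof
  assume "v \<noteq> w" "Var v + Var w = (0 :: 'v cpoly)"
  then have "Poly_Mapping.lookup (Var v + Var w :: 'v cpoly) (Poly_Mapping.single v 1) = 0" by simp
  moreover have "Poly_Mapping.single w (1::nat) \<noteq> Poly_Mapping.single v 1"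
    using \<open>v \<noteq> w\<close> by (metis lookup_single_eq lookup_single_not_eq zero_neq_one)
  ultimately show False by (simp add: Var_def lookup_add lookup_single_not_eq)
qed

lemma generic_point_variables: "generic_point n xf yf"
proof -
  have "xf i \<noteq> xf j" "yf i \<noteq> yf j" if "i \<noteq> j" for i j
    using Var_neq[of "Xvar i" "Xvar j"] Var_neq[of "Yvar i" "Yvar j"] that by simp_all
  then have "inj_on xf {1..n}" "inj_on yf {1..n}"
    unfolding inj_on_def by blast+
  then show ?thesis
    unfolding generic_point_def to_fract_add[symmetric] to_fract_eq_0_iff
    by (simp add: Var_neq_0 Var_add_neq_0)
qed

theorem theorem6p1:
  fixes a :: "int \<Rightarrow> complex" and n N :: nat and \<mu> :: "nat list"
  assumes "n \<ge> 1"
    and "is_partition \<mu>"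
    and "diag_length \<mu> \<le> n"
    and "length \<mu> \<le> N"
  shows "Fract (super_eval n (multi_schur N \<mu> a)) 1 =
    Fract (\<Sum>w\<in>{p. p permutes {1..n}} \<times> {p. p permutes {1..n}}.
             of_int (eps w) * act w (f_poly n \<mu> a))
          (vandermonde n xv * vandermonde n yv)"
proof -
  let ?m = "part \<mu>" and ?m' = "part_transp \<mu>" and ?a = "\<lambda>i. cf (a i)"
  let ?num = "\<Sum>w\<in>{p. p permutes {1..n}} \<times> {p. p permutes {1..n}}. of_int (eps w) * act w (f_poly n \<mu> a)"
  let ?den = "vandermonde n xv * vandermonde n yv"
  note conj = conjugate_part[OF assms(2)]
  have two: "(2 :: xy cpoly fract) \<noteq> 0"
  proof
    assume "(2 :: xy cpoly fract) = 0"
    then have "to_fract (2 :: xy cpoly) = 0" by (metis one_add_one to_fract_1 to_fract_add)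
    then show False by simp
  qed
  have "?m (Suc n) \<le> n"
    using diag_length_iff[OF assms(2), of "Suc n"] assms(3) by auto
  then have "schur_identity n ?m ?m' ?a xf yf"
    by (rule schur_identity_at_generic_point[OF two conj _ generic_point_variables])
  moreover have "specialize n (multi_schur N \<mu> a) = schur_det (row_series ?m ?a) (?m' 1) (H_value n xf yf)"
    unfolding specialize_multi_schur
    using assms(4) by (intro schur_det_rows[OF conj] monic_at_H_value part_beyond_length) simp
  ultimately have "to_fract (super_eval n (multi_schur N \<mu> a) * ?den) = to_fract ?num"
    unfolding schur_identity_def to_fract_numerator[OF assms(2,3)] to_fract_mult to_fract_vandermonde specialize_def
    by simp
  then have "super_eval n (multi_schur N \<mu> a) * ?den = ?num"
    unfolding to_fract_eq_iff .
  then show ?thesis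
    using vandermonde_nonzero[of n] by (simp add: eq_fract)
qed

end
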